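(* Let $p=(p^i,i\ge 0)$ be a probability distribution on $\{0,1,2,\ldots\}$ with mean $1$ and finite variance $\sigma^2$. For each $n\ge 1$ let $s_n=(s_n^i,i\ge 0)$ be a degree sequence with $\sum_{i\ge 0}s_n^i=n$, let $c_n=c(s_n)=\sum_{i\ge 0}(1-i)s_n^i$, and suppose that $c_n=o(n^{1/2})$ and $n^{-1}s_n\to p$ in $L^2$. Let $(C_{n,1},\ldots,C_{n,n})$ be a uniformly random permutation of the vector $d(s_n)$, and set $X_{n,k}=C_{n,k}-1$ and $S_{n,k}=\sum_{j=1}^kX_{n,j}$ for $1\le k\le n$ (with $S_{n,0}=0$). Then, as $n\to\infty$, $$\left(\frac1{c_n}S_{n,\lfloor tc_n^2\rfloor},\ t\ge 0\right)\overset{d}{\longrightarrow}\left(\sigma B(t),\ t\ge 0\right),$$ where $(B(t),t\ge0)$ is standard Brownian motion.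
   Context: A degree sequence is a sequence $s=(s^i,i\ge0)$ of non-negative integers with $\sum_is^i<\infty$ and $c(s):=\sum_i(1-i)s^i>0$. If $\sum_i s^i=n$, then $d(s)\in\mathbb Z_{\ge0}^n$ is the weakly increasing vector having exactly $s^i$ entries equal to $i$ for each $i\ge 0$. "$n^{-1}s_n\to p$ in $L^2$" means, with $p_n^i=s_n^i/n$, that $p_n^i\to p^i$ for every $i\ge0$ and $\sum_{i\ge0}i^2|p_n^i-p^i|\to0$ (equivalently, coordinatewise convergence together with convergence of second moments). Convergence in distribution is of processes on $[0,\infty)$. For $k>n$ put $S_{n,k}=S_{n,n}$; since $c_n^2=o(n)$ this convention is irrelevant on compact time intervals for large $n$.
   Formalization: The formal statement additionally assumes that c_n tends to infinity whenever σ > 0; without this the claim is false (e.g. p^0 = p^2 = 1/2 with c_n = 1 for all n, where the walk at t = 1 is integer-valued). *)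

theory Defs
  imports
    "HOL-Probability.Probability"
    "HOL-Combinatorics.Combinatorics"
    "HOL-Library.Landau_Symbols"
begin

section \<open>Degree sequences\<close>

definition degree_excess :: "(nat \<Rightarrow> nat) \<Rightarrow> int" where
  "degree_excess s = (\<Sum>i. (1 - int i) * int (s i))"

text \<open>Summability of a sequence of natural numbers means that its support is finite, so
  \<^const>\<open>degree_excess\<close> is then a finite sum as well.\<close>

definition degree_sequence :: "(nat \<Rightarrow> nat) \<Rightarrow> bool" where
  "degree_sequence s \<longleftrightarrow> summable s \<and> degree_excess s > 0"

definition degree_vector :: "(nat \<Rightarrow> nat) \<Rightarrow> nat list" where
  "degree_vector s = sorted_list_of_multiset (Abs_multiset s)"

definition L2_convergent_to :: "(nat \<Rightarrow> nat \<Rightarrow> real) \<Rightarrow> (nat \<Rightarrow> real) \<Rightarrow> bool" where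
  "L2_convergent_to q p \<longleftrightarrow>
     (\<forall>i. (\<lambda>n. q n i) \<longlonglongrightarrow> p i) \<and>
     (\<lambda>n. \<Sum>i. (real i)\<^sup>2 * \<bar>q n i - p i\<bar>) \<longlonglongrightarrow> 0"

section \<open>The random walk\<close>

text \<open>The law of \<open>(d\<^sub>\<pi>\<^sub>(\<^sub>1\<^sub>), \<dots>, d\<^sub>\<pi>\<^sub>(\<^sub>n\<^sub>))\<close> with \<open>\<pi>\<close> uniform among the \<open>n!\<close> permutations of the indices.\<close>

definition uniform_permutation :: "'a list \<Rightarrow> 'a list pmf" where
  "uniform_permutation d =
     map_pmf (\<lambda>\<pi>. permute_list \<pi> d) (pmf_of_set {\<pi>. \<pi> permutes {..<length d}})"

text \<open>List positions start at \<open>0\<close>; the walk is frozen after \<open>length C\<close> steps.\<close>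

definition walk :: "nat list \<Rightarrow> nat \<Rightarrow> int" where
  "walk C k = (\<Sum>j<min k (length C). int (C ! j) - 1)"

definition scaled_walk :: "int \<Rightarrow> nat list \<Rightarrow> real \<Rightarrow> real" where
  "scaled_walk c C = (\<lambda>t\<in>{0..}. real_of_int (walk C (nat \<lfloor>t * (real_of_int c)\<^sup>2\<rfloor>)) / real_of_int c)"

section \<open>The Skorokhod space on the half-line\<close>

text \<open>Paths live on \<open>[0,\<infinity>)\<close>, hence extensionality.\<close>

definition cadlag_paths :: "(real \<Rightarrow> real) set" where
  "cadlag_paths = {x \<in> extensional {0..}.
     (\<forall>t\<ge>0. continuous (at_right t) x) \<and> (\<forall>t>0. \<exists>l. (x \<longlongrightarrow> l) (at_left t))}"

text \<open>A strictly increasing map of \<open>[0,\<infinity>)\<close> onto itself is continuous and fixes \<open>0\<close>.\<close>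

definition time_changes :: "(real \<Rightarrow> real) set" where
  "time_changes = {l. strict_mono_on {0..} l \<and> l ` {0..} = {0..}}"

definition skorokhod_tendsto :: "(nat \<Rightarrow> real \<Rightarrow> real) \<Rightarrow> (real \<Rightarrow> real) \<Rightarrow> bool" where
  "skorokhod_tendsto X x \<longleftrightarrow>
     (\<exists>l. (\<forall>n. l n \<in> time_changes) \<and>
          uniform_limit {0..} l (\<lambda>t. t) sequentially \<and>
          (\<forall>T. uniform_limit {0..T} (\<lambda>n t. X n (l n t)) x sequentially))"

text \<open>The \<open>J\<^sub>1\<close> topology on \<open>D[0,\<infinity>)\<close> is the metrizable topology whose convergent sequences are
  those of \<^const>\<open>skorokhod_tendsto\<close> (Jacod and Shiryaev, Limit Theorems for Stochastic
  Processes, VI.1.14). Being metrizable, its open sets are the sequentially open ones.\<close>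

definition skorokhod_open :: "(real \<Rightarrow> real) set \<Rightarrow> bool" where
  "skorokhod_open U \<longleftrightarrow> U \<subseteq> cadlag_paths \<and>
     (\<forall>x\<in>U. \<forall>X. range X \<subseteq> cadlag_paths \<and> skorokhod_tendsto X x \<longrightarrow>
        (\<forall>\<^sub>F n in sequentially. X n \<in> U))"

definition skorokhod_topology :: "(real \<Rightarrow> real) topology" where
  "skorokhod_topology = topology skorokhod_open"

lemma istopology_skorokhod_open: "istopology skorokhod_open"
  unfolding istopology_def
proof (intro conjI allI impI)
  fix U V assume "skorokhod_open U" "skorokhod_open V"
  then show "skorokhod_open (U \<inter> V)"
    unfolding skorokhod_open_def by (auto simp: eventually_conj_iff)
next
  fix \<K> assume K: "\<forall>U\<in>\<K>. skorokhod_open U"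
  show "skorokhod_open (\<Union>\<K>)"
    unfolding skorokhod_open_def
  proof (intro conjI ballI allI impI)
    show "\<Union>\<K> \<subseteq> cadlag_paths"
      using K unfolding skorokhod_open_def by blast
  next
    fix x X assume "x \<in> \<Union>\<K>" and X: "range X \<subseteq> cadlag_paths \<and> skorokhod_tendsto X x"
    then obtain U where U: "U \<in> \<K>" "x \<in> U" by blast
    with K X have "\<forall>\<^sub>F n in sequentially. X n \<in> U"
      unfolding skorokhod_open_def by blast
    then show "\<forall>\<^sub>F n in sequentially. X n \<in> \<Union>\<K>"
      by (rule eventually_mono) (use U in blast)
  qed
qed

lemma openin_skorokhod_topology: "openin skorokhod_topology U \<longleftrightarrow> skorokhod_open U"
  unfolding skorokhod_topology_def using istopology_skorokhod_open by simp

lemma topspace_skorokhod_topology [simp]: "topspace skorokhod_topology = cadlag_paths"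
proof
  show "topspace skorokhod_topology \<subseteq> cadlag_paths"
    using openin_topspace[of skorokhod_topology]
    unfolding openin_skorokhod_topology skorokhod_open_def by blast
  have "skorokhod_open cadlag_paths"
    unfolding skorokhod_open_def by (auto intro!: always_eventually)
  then show "cadlag_paths \<subseteq> topspace skorokhod_topology"
    using openin_subset openin_skorokhod_topology by blast
qed

section \<open>Convergence in distribution and Brownian motion\<close>

definition borel_algebra :: "'a topology \<Rightarrow> 'a measure" where
  "borel_algebra T = sigma (topspace T) {U. openin T U}"

text \<open>The random elements may live on different probability spaces; finitely many indices do
  not matter.\<close>

definition converges_in_distribution ::
  "'c topology \<Rightarrow> (nat \<Rightarrow> 'a measure) \<Rightarrow> (nat \<Rightarrow> 'a \<Rightarrow> 'c) \<Rightarrow> 'b measure \<Rightarrow> ('b \<Rightarrow> 'c) \<Rightarrow> bool" where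
  "converges_in_distribution T M X N Y \<longleftrightarrow>
     (\<forall>\<^sub>F n in sequentially. X n \<in> measurable (M n) (borel_algebra T)) \<and>
     Y \<in> measurable N (borel_algebra T) \<and>
     (\<forall>f. continuous_map T euclideanreal f \<and> bounded (f ` topspace T) \<longrightarrow>
        (\<lambda>n. \<integral>\<omega>. f (X n \<omega>) \<partial>M n) \<longlonglongrightarrow> (\<integral>\<omega>. f (Y \<omega>) \<partial>N))"

definition standard_brownian_motion :: "'a measure \<Rightarrow> (real \<Rightarrow> 'a \<Rightarrow> real) \<Rightarrow> bool" where
  "standard_brownian_motion M B \<longleftrightarrow>
     prob_space M \<and>
     (\<forall>t\<ge>0. B t \<in> borel_measurable M) \<and>
     (\<forall>\<omega>\<in>space M. B 0 \<omega> = 0) \<and>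
     (\<forall>\<omega>\<in>space M. continuous_on {0..} (\<lambda>t. B t \<omega>)) \<and>
     (\<forall>r t. 0 \<le> r \<and> r < t \<longrightarrow>
        distributed M lborel (\<lambda>\<omega>. B t \<omega> - B r \<omega>) (normal_density 0 (sqrt (t - r)))) \<and>
     (\<forall>(k::nat) \<tau>. 0 \<le> \<tau> 0 \<and> strict_mono \<tau> \<longrightarrow>
        prob_space.indep_vars M (\<lambda>_. borel) (\<lambda>i \<omega>. B (\<tau> (Suc i)) \<omega> - B (\<tau> i) \<omega>) {..<k})"

end

(* On paths, Skorokhod convergence is only ever used with the identity as time change, that is, through
   locally uniform convergence.  This topology has a simple bounded metric, for which a bounded
   continuous functional is the increasing limit of its Lipschitz inf-convolutions; a Lipschitz
   functional changes little when the path is replaced by its values on a grid of mesh 1/m.  Hence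
   the theorem reduces to the convergence of finitely many increments and to a bound for the
   oscillation between grid points.

   For a test function of the past, the next step of a uniform permutation may be replaced by the average
   of the remaining entries.  As only O(c_n^2) = o(n) entries have been used, that average is close to
   the average over the whole vector, and multiplying out the steps gives the Gaussian characteristic
   function for the increment, uniformly in the weight carried by the past.  Tilting the
   uniform law by the weight, Levy's continuity theorem yields the limit of each increment
   jointly with the past, thus of products of test functions of the increments; Stone-Weierstrass
   extends this to all continuous functions.

   The oscillation is controlled by an inequality of Ottaviani's type, whose conditional second moment
   is again computed by exchangeability; the sixth moment of the Gaussian limit beats the number m^2 of
   grid intervals.  The case sigma = 0, where c_n may stay bounded, needs no separate treatment,
   because only sigma / c_n -> 0 enters. *)

theory Submission
  imports Defs
begin

section \<open>Skorokhod convergence through a metric for locally uniform convergence\<close>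

text \<open>The obstacle is that the steps are neither independent nor centred given the past. Over
  O(c_n^2) steps an error o(c_n^{-2}) per step is affordable. After k steps the remaining entries
  sum to -c_n - S_{n,k}, which is O(n^{1/2}) in mean absolute value; the drift that it causes in the
  characteristic function is of order c_n^{-1} n^{-1/2} per step and c_n n^{-1/2} in total, and this
  is where c_n = o(n^{1/2}) enters. Such a bound holds on average over the past, not for every past,
  which is why weights depending on the past are carried along instead of conditional laws. In the
  tightness estimate the mesh 1/m and the horizon m are tied together, so that one parameter
  controls both and m^2 windows have to be handled. The Gaussian variance of a window is
  \<sigma>^2/m; a fourth moment would only give m^2 m^{-2}, which does not vanish, whereas the sixth
  gives m^2 m^{-3}.\<close>

lemma floor_step_cadlag:
  fixes v :: "nat \<Rightarrow> real"
  assumes "a > 0"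
  shows "(\<lambda>t\<in>{0..}. v (nat \<lfloor>a * t\<rfloor>)) \<in> cadlag_paths"
proof -
  let ?x = "\<lambda>t\<in>{0..}. v (nat \<lfloor>a * t\<rfloor>)"
  have right: "continuous (at_right t) ?x" if t: "t \<ge> 0" for t
  proof -
    have "eventually (\<lambda>s. s \<in> {t<..<(of_int \<lfloor>a * t\<rfloor> + 1) / a}) (at_right t)"
      by (rule eventually_at_right_real) (use assms in \<open>simp add: field_simps\<close>; linarith)
    then have "eventually (\<lambda>s. ?x s = ?x t) (at_right t)"
    proof eventually_elim
      case (elim s)
      then have "a * s < of_int \<lfloor>a * t\<rfloor> + 1" "a * t < a * s"
        using assms by (simp_all add: field_simps)
      then have "\<lfloor>a * s\<rfloor> = \<lfloor>a * t\<rfloor>" by linarith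
      then show ?case using t elim by auto
    qed
    then have "(?x \<longlongrightarrow> ?x t) (at_right t)"
      by (rule tendsto_eventually)
    then show ?thesis by (simp add: continuous_within)
  qed
  have left: "\<exists>l. (?x \<longlongrightarrow> l) (at_left t)" if t: "t > 0" for t
  proof -
    have "eventually (\<lambda>s. s \<in> {max 0 ((of_int \<lceil>a * t\<rceil> - 1) / a)<..<t}) (at_left t)"
      by (rule eventually_at_left_real) (use assms t in \<open>simp add: field_simps; linarith\<close>)
    \<comment> \<open>The left limit reads the index \<open>\<lceil>a * t\<rceil> - 1\<close>. It
      differs from \<open>\<lfloor>a * t\<rfloor>\<close> exactly when \<open>a * t\<close> is an
      integer, that is, at a possible jump.\<close>
    then have "eventually (\<lambda>s. ?x s = v (nat (\<lceil>a * t\<rceil> - 1))) (at_left t)"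
    proof eventually_elim
      case (elim s)
      then have "a * s > of_int \<lceil>a * t\<rceil> - 1" "a * s < a * t" "s > 0"
        using assms by (simp_all add: field_simps)
      then have "\<lfloor>a * s\<rfloor> = \<lceil>a * t\<rceil> - 1" by linarith
      then show ?case using \<open>s > 0\<close> by auto
    qed
    then show ?thesis using tendsto_eventually by blast
  qed
  show ?thesis
    using right left by (auto simp: cadlag_paths_def)
qed

text \<open>The cap 1 / (1 + t) keeps the supremum finite for unbounded paths and limits the
  contribution of times beyond T to 1 / (1 + T), so a small distance means uniform closeness on a
  long interval. Capping by a minimum, unlike dividing by a weight, preserves the actual difference
  where it is small.\<close>

definition path_dist :: "(real \<Rightarrow> real) \<Rightarrow> (real \<Rightarrow> real) \<Rightarrow> real" where
  "path_dist x y = (SUP t\<in>{0..}. min (1 / (1 + t)) \<bar>x t - y t\<bar>)"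

lemma path_dist_bdd:
  fixes x y :: "real \<Rightarrow> real"
  shows "bdd_above ((\<lambda>t. min (1 / (1 + t)) \<bar>x t - y t\<bar>) ` {0..})"
  by (rule bdd_aboveI[of _ 1]) (auto simp: min_le_iff_disj)

lemma path_dist_upper:
  "t \<ge> 0 \<Longrightarrow> min (1 / (1 + t)) \<bar>x t - y t\<bar> \<le> path_dist x y"
  unfolding path_dist_def by (rule cSUP_upper[OF _ path_dist_bdd]) auto

lemma path_dist_least:
  assumes "\<And>t. t \<ge> 0 \<Longrightarrow> min (1 / (1 + t)) \<bar>x t - y t\<bar> \<le> e"
  shows "path_dist x y \<le> e"
  unfolding path_dist_def by (rule cSUP_least) (use assms in auto)

lemma path_dist_nonneg: "0 \<le> path_dist x y"
  by (rule order_trans[OF _ path_dist_upper[of 0]]) auto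

lemma path_dist_le_1: "path_dist x y \<le> 1"
  by (rule path_dist_least) (auto simp: min_le_iff_disj)

lemma path_dist_refl [simp]: "path_dist x x = 0"
  by (intro antisym path_dist_nonneg path_dist_least) auto

lemma path_dist_commute: "path_dist x y = path_dist y x"
  by (simp add: path_dist_def abs_minus_commute)

lemma path_dist_triangle: "path_dist x z \<le> path_dist x y + path_dist y z"
proof (rule path_dist_least)
  fix t :: real assume t: "t \<ge> 0"
  have "min (1 / (1 + t)) \<bar>x t - z t\<bar>
      \<le> min (1 / (1 + t)) \<bar>x t - y t\<bar> + min (1 / (1 + t)) \<bar>y t - z t\<bar>"
    using t by (smt (verit) divide_nonneg_nonneg)
  also have "\<dots> \<le> path_dist x y + path_dist y z"
    by (intro add_mono path_dist_upper t)
  finally show "min (1 / (1 + t)) \<bar>x t - z t\<bar> \<le> path_dist x y + path_dist y z" .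
qed

lemma path_dist_le_window:
  assumes "T \<ge> 0" "1 / (1 + T) \<le> e" "\<And>t. 0 \<le> t \<Longrightarrow> t < T \<Longrightarrow> \<bar>x t - y t\<bar> \<le> e"
  shows "path_dist x y \<le> e"
proof (rule path_dist_least)
  fix t :: real assume t: "t \<ge> 0"
  show "min (1 / (1 + t)) \<bar>x t - y t\<bar> \<le> e"
  proof (cases "t < T")
    case False
    then have "1 / (1 + t) \<le> 1 / (1 + T)"
      using assms(1) by (intro divide_left_mono) auto
    then show ?thesis using assms(2) by linarith
  qed (use assms(3)[of t] t in auto)
qed

lemma skorokhod_tendsto_path_dist:
  assumes "(\<lambda>n. path_dist (X n) x) \<longlonglongrightarrow> 0"
  shows "skorokhod_tendsto X x"
  unfolding skorokhod_tendsto_def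
proof (intro exI[of _ "\<lambda>n t. t"] conjI allI)
  show "(\<lambda>t. t) \<in> time_changes"
    by (auto simp: time_changes_def strict_mono_on_def)
  show "uniform_limit {0..} (\<lambda>n t. t) (\<lambda>t. t) sequentially"
    by (rule uniform_limit_const)
  fix T :: real
  show "uniform_limit {0..T} (\<lambda>n. X n) x sequentially"
  proof (rule uniform_limitI)
    fix e :: real assume "e > 0"
    \<comment> \<open>Below 1 / (1 + \<bar>T\<bar>) the cap is not the smaller argument of the
      minimum on {0..T}, so a distance below \<open>e'\<close> bounds the difference of the paths
      itself.\<close>
    define e' where "e' = min e (1 / (1 + \<bar>T\<bar>))"
    have "e' > 0" using \<open>e > 0\<close> by (auto simp: e'_def)
    then have "\<forall>\<^sub>F n in sequentially. path_dist (X n) x < e'"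
      using order_tendstoD(2)[OF assms] by blast
    then show "\<forall>\<^sub>F n in sequentially. \<forall>t\<in>{0..T}. dist (X n t) (x t) < e"
    proof eventually_elim
      case (elim n)
      show ?case
      proof
        fix t assume t: "t \<in> {0..T}"
        have "1 / (1 + \<bar>T\<bar>) \<le> 1 / (1 + t)"
          using t by (intro divide_left_mono) auto
        moreover have "min (1 / (1 + t)) \<bar>X n t - x t\<bar> \<le> path_dist (X n) x"
          using t by (intro path_dist_upper) auto
        ultimately show "dist (X n t) (x t) < e"
          using elim by (auto simp: e'_def dist_real_def)
      qed
    qed
  qed
qed

text \<open>Freezing the index at \<open>m * m\<close>, hence the path at time m, leaves finitely
  many relevant coordinates of \<open>v\<close> and lets the single parameter \<open>m\<close> fix
  both mesh and horizon.\<close>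

definition step_path :: "nat \<Rightarrow> (nat \<Rightarrow> real) \<Rightarrow> real \<Rightarrow> real" where
  "step_path m v = (\<lambda>t\<in>{0..}. v (min (nat \<lfloor>real m * t\<rfloor>) (m * m)))"

definition grid_path :: "nat \<Rightarrow> (real \<Rightarrow> real) \<Rightarrow> real \<Rightarrow> real" where
  "grid_path m x = step_path m (\<lambda>i. x (real i / real m))"

lemma step_path_cadlag: "m > 0 \<Longrightarrow> step_path m v \<in> cadlag_paths"
  using floor_step_cadlag[of "real m" "\<lambda>i. v (min i (m * m))"] by (simp add: step_path_def)

lemma path_dist_step_path:
  "path_dist (step_path m v) (step_path m w) \<le> (\<Sum>i\<le>m * m. \<bar>v i - w i\<bar>)"
proof (rule path_dist_least)
  fix t :: real assume t: "t \<ge> 0"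
  define i where "i = min (nat \<lfloor>real m * t\<rfloor>) (m * m)"
  have "\<bar>v i - w i\<bar> \<le> (\<Sum>i\<le>m * m. \<bar>v i - w i\<bar>)"
    by (rule member_le_sum[of i _ "\<lambda>i. \<bar>v i - w i\<bar>"]) (auto simp: i_def)
  then show "min (1 / (1 + t)) \<bar>step_path m v t - step_path m w t\<bar> \<le> (\<Sum>i\<le>m * m. \<bar>v i - w i\<bar>)"
    using t by (simp add: step_path_def i_def min_le_iff_disj)
qed

lemma grid_path_apply:
  assumes "0 \<le> t" "t < real m"
  shows "grid_path m x t = x (real (nat \<lfloor>real m * t\<rfloor>) / real m)"
proof -
  have "real m * t \<le> real m * real m" using assms by (intro mult_left_mono) auto
  then have "nat \<lfloor>real m * t\<rfloor> \<le> m * m"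
    by (metis floor_mono floor_of_nat nat_int nat_mono of_nat_mult)
  then show ?thesis using assms by (simp add: grid_path_def step_path_def min_absorb1)
qed

lemma grid_path_tendsto:
  assumes "continuous_on {0..} x"
  shows "(\<lambda>m. path_dist (grid_path m x) x) \<longlonglongrightarrow> 0"
proof (rule tendstoI)
  fix e :: real assume e: "e > 0"
  obtain T :: nat where T: "1 / (1 + real T) < e / 2"
    using e reals_Archimedean[of "e/2"] by (auto simp: inverse_eq_divide add.commute)
  have "uniformly_continuous_on {0..real T} x"
    by (intro compact_uniformly_continuous continuous_on_subset[OF assms]) auto
  then obtain \<delta> where \<delta>: "\<delta> > 0"
    "\<And>t t'. t \<in> {0..real T} \<Longrightarrow> t' \<in> {0..real T} \<Longrightarrow> dist t' t < \<delta> \<Longrightarrow> dist (x t') (x t) < e / 2"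
    using e unfolding uniformly_continuous_on_def by (metis half_gt_zero)
  obtain m0 :: nat where m0: "1 / real (Suc m0) < \<delta>"
    using \<delta>(1) reals_Archimedean[of \<delta>] by (auto simp: inverse_eq_divide)
  have "path_dist (grid_path m x) x < e" if m: "m \<ge> T" "m \<ge> Suc m0" for m
  proof -
    have "path_dist (grid_path m x) x \<le> e / 2"
    proof (rule path_dist_le_window[of "real T"])
      fix t assume t: "0 \<le> t" "t < real T"
      define t' where "t' = real (nat \<lfloor>real m * t\<rfloor>) / real m"
      have "real (nat \<lfloor>real m * t\<rfloor>) = of_int \<lfloor>real m * t\<rfloor>"
        using t by simp
      then have n: "real (nat \<lfloor>real m * t\<rfloor>) \<le> real m * t" "real (nat \<lfloor>real m * t\<rfloor>) > real m * t - 1"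
        by linarith+
      have "t' \<le> t"
        using n m by (simp add: t'_def field_simps)
      moreover have "t' > t - 1 / real m"
        using divide_strict_right_mono[OF n(2), of "real m"] m
        by (simp add: t'_def diff_divide_distrib)
      moreover have "1 / real m \<le> 1 / real (Suc m0)"
        using m by (intro divide_left_mono) auto
      moreover have "t' \<ge> 0" by (simp add: t'_def)
      ultimately have "dist (x t') (x t) < e / 2"
        using t m0 by (intro \<delta>(2)) (auto simp: dist_real_def)
      moreover have "grid_path m x t = x t'"
        using t m unfolding t'_def by (intro grid_path_apply) auto
      ultimately show "\<bar>grid_path m x t - x t\<bar> \<le> e / 2"
        by (simp add: dist_real_def)
    qed (use T in auto)
    then show ?thesis using e by simp
  qed
  then show "\<forall>\<^sub>F m in sequentially. dist (path_dist (grid_path m x) x) 0 < e"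
    using path_dist_nonneg
    by (auto simp: eventually_sequentially intro!: exI[of _ "max T (Suc m0)"])
qed

text \<open>Open sets are sequentially open by definition, so the preimage of a neighbourhood
  eventually contains the sequence; metrizability is not invoked.\<close>

lemma continuous_map_skorokhod_tendsto:
  assumes f: "continuous_map skorokhod_topology euclideanreal f"
    and x: "x \<in> cadlag_paths" "\<And>n. X n \<in> cadlag_paths" "skorokhod_tendsto X x"
  shows "(\<lambda>n. f (X n)) \<longlonglongrightarrow> f x"
proof (rule topological_tendstoI)
  fix V assume V: "open V" "f x \<in> V"
  have "openin skorokhod_topology {y \<in> topspace skorokhod_topology. f y \<in> V}"
    using f V by (intro openin_continuous_map_preimage) auto
  then have "skorokhod_open {y \<in> cadlag_paths. f y \<in> V}"
    by (simp add: openin_skorokhod_topology)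
  then have "\<forall>\<^sub>F n in sequentially. X n \<in> {y \<in> cadlag_paths. f y \<in> V}"
    using x V unfolding skorokhod_open_def by blast
  then show "\<forall>\<^sub>F n in sequentially. f (X n) \<in> V" by eventually_elim simp
qed

section \<open>Lipschitz functionals of paths\<close>

definition path_lipschitz :: "real \<Rightarrow> ((real \<Rightarrow> real) \<Rightarrow> real) \<Rightarrow> bool" where
  "path_lipschitz K g \<longleftrightarrow> (\<forall>x\<in>cadlag_paths. \<forall>y\<in>cadlag_paths. \<bar>g x - g y\<bar> \<le> K * path_dist x y)"

lemma path_lipschitzD:
  "path_lipschitz K g \<Longrightarrow> x \<in> cadlag_paths \<Longrightarrow> y \<in> cadlag_paths \<Longrightarrow> \<bar>g x - g y\<bar> \<le> K * path_dist x y"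
  by (auto simp: path_lipschitz_def)

text \<open>An infimum of K-Lipschitz functions is K-Lipschitz once it is finite. Two instances
  matter: \<open>f\<close> = 0 and \<open>K\<close> = 1 give the distance to the set
  \<open>A\<close>, and a bounded \<open>f\<close> on all paths gives its Lipschitz
  minorants.\<close>

lemma path_lipschitz_INF:
  assumes "K \<ge> 0" "A \<noteq> {}" "\<And>y. y \<in> A \<Longrightarrow> L \<le> f y"
  shows "path_lipschitz K (\<lambda>x. INF y\<in>A. f y + K * path_dist x y)"
proof -
  have bdd: "bdd_below ((\<lambda>y. f y + K * path_dist x y) ` A)" for x
    by (rule bdd_belowI[of _ L]) (use assms path_dist_nonneg in \<open>force intro: add_increasing2\<close>)
  have le: "(INF y\<in>A. f y + K * path_dist x y) - K * path_dist x z \<le> (INF y\<in>A. f y + K * path_dist z y)" for x z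
  proof (rule cINF_greatest[OF assms(2)])
    fix y assume "y \<in> A"
    then have "(INF y\<in>A. f y + K * path_dist x y) \<le> f y + K * path_dist x y"
      by (intro cINF_lower bdd)
    also have "\<dots> \<le> f y + K * (path_dist x z + path_dist z y)"
      using assms(1) path_dist_triangle by (intro add_left_mono mult_left_mono)
    finally show "(INF y\<in>A. f y + K * path_dist x y) - K * path_dist x z \<le> f y + K * path_dist z y"
      by (simp add: algebra_simps)
  qed
  show ?thesis
    unfolding path_lipschitz_def
  proof (intro ballI)
    fix x z
    show "\<bar>(INF y\<in>A. f y + K * path_dist x y) - (INF y\<in>A. f y + K * path_dist z y)\<bar> \<le> K * path_dist x z"
      using le[of x z] le[of z x] by (simp add: path_dist_commute[of z x])
  qed
qed

text \<open>Continuity is meant in the product topology; it holds because finitely many coordinates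
  dominate the distance of step paths. This makes functionals of grid values measurable and
  admissible as finite-dimensional test functions.\<close>

lemma path_lipschitz_step_continuous:
  assumes "path_lipschitz K g" "m > 0" "K \<ge> 0"
  shows "continuous_on UNIV (\<lambda>v. g (step_path m v))"
  unfolding continuous_on_def
proof
  fix v :: "nat \<Rightarrow> real"
  show "((\<lambda>w. g (step_path m w)) \<longlongrightarrow> g (step_path m v)) (at v within UNIV)"
  proof (rule LIM_zero_cancel, rule Lim_null_comparison)
    show "\<forall>\<^sub>F w in at v within UNIV.
      norm (g (step_path m w) - g (step_path m v)) \<le> K * (\<Sum>i\<le>m * m. \<bar>w i - v i\<bar>)"
    proof (rule always_eventually, rule allI)
      fix w
      have "\<bar>g (step_path m w) - g (step_path m v)\<bar> \<le> K * path_dist (step_path m w) (step_path m v)"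
        using assms by (intro path_lipschitzD step_path_cadlag)
      also have "\<dots> \<le> K * (\<Sum>i\<le>m * m. \<bar>w i - v i\<bar>)"
        using assms by (intro mult_left_mono path_dist_step_path)
      finally show "norm (g (step_path m w) - g (step_path m v)) \<le> K * (\<Sum>i\<le>m * m. \<bar>w i - v i\<bar>)"
        by simp
    qed
    have "continuous_on UNIV (\<lambda>w :: nat \<Rightarrow> real. K * (\<Sum>i\<le>m * m. \<bar>w i - v i\<bar>))"
      by (intro continuous_intros continuous_on_product_coordinates)
    from this[unfolded continuous_on_def, THEN bspec, of v]
    show "((\<lambda>w. K * (\<Sum>i\<le>m * m. \<bar>w i - v i\<bar>)) \<longlongrightarrow> 0) (at v within UNIV)"
      by simp
  qed
qed

lemma path_lipschitz_grid_tendsto: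
  assumes g: "path_lipschitz K g" and x: "x \<in> cadlag_paths" "continuous_on {0..} x"
  shows "(\<lambda>m. g (grid_path m x)) \<longlonglongrightarrow> g x"
proof -
  have lim: "(\<lambda>m. K * path_dist (grid_path m x) x) \<longlonglongrightarrow> 0"
    by (rule tendsto_mult_right_zero[OF grid_path_tendsto[OF x(2)]])
  have "\<forall>\<^sub>F m in sequentially. norm (g (grid_path m x) - g x) \<le> K * path_dist (grid_path m x) x"
    using eventually_gt_at_top[of 0]
  proof eventually_elim
    case (elim m)
    then show ?case
      unfolding real_norm_def
      using x by (intro path_lipschitzD[OF g]) (simp_all add: grid_path_def step_path_cadlag)
  qed
  from Lim_null_comparison[OF this lim]
  show ?thesis by (simp add: LIM_zero_iff)
qed

text \<open>Measurability of the process with respect to the non-separable space of all paths comes for free: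
  Lipschitz functionals of a continuous path are limits of functions of grid values.\<close>

locale continuous_process =
  fixes N :: "'b measure" and Y :: "'b \<Rightarrow> real \<Rightarrow> real"
  assumes prob: "prob_space N"
    and coordinate_measurable: "\<And>t. t \<ge> 0 \<Longrightarrow> (\<lambda>\<omega>. Y \<omega> t) \<in> borel_measurable N"
    and cadlag: "\<And>\<omega>. \<omega> \<in> space N \<Longrightarrow> Y \<omega> \<in> cadlag_paths"
    and continuous: "\<And>\<omega>. \<omega> \<in> space N \<Longrightarrow> continuous_on {0..} (Y \<omega>)"
begin

sublocale prob_space N by (rule prob)

lemma grid_measurable:
  assumes "path_lipschitz K g" "m > 0" "K \<ge> 0"
  shows "(\<lambda>\<omega>. g (grid_path m (Y \<omega>))) \<in> borel_measurable N"
proof -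
  have "(\<lambda>\<omega> i. Y \<omega> (real i / real m)) \<in> borel_measurable N"
    by (intro measurable_coordinatewise_then_product coordinate_measurable) auto
  moreover have "(\<lambda>v. g (step_path m v)) \<in> borel_measurable borel"
    by (intro borel_measurable_continuous_onI path_lipschitz_step_continuous[OF assms])
  ultimately show ?thesis
    unfolding grid_path_def by (rule measurable_compose)
qed

lemma lipschitz_measurable:
  assumes g: "path_lipschitz K g" "K \<ge> 0"
  shows "(\<lambda>\<omega>. g (Y \<omega>)) \<in> borel_measurable N"
proof (rule borel_measurable_LIMSEQ_real)
  show "(\<lambda>i. g (grid_path (Suc i) (Y \<omega>))) \<longlonglongrightarrow> g (Y \<omega>)" if "\<omega> \<in> space N" for \<omega>
    using path_lipschitz_grid_tendsto[OF g(1) cadlag[OF that] continuous[OF that]]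
    by (rule LIMSEQ_Suc)
  show "(\<lambda>\<omega>. g (grid_path (Suc i) (Y \<omega>))) \<in> borel_measurable N" for i
    by (rule grid_measurable[OF g(1) _ g(2)]) simp
qed

text \<open>An open set is the set where the distance to its complement is positive, and this
  distance is a Lipschitz functional, whose measurability along continuous paths is already
  known.\<close>

lemma measurable_skorokhod: "Y \<in> measurable N (borel_algebra skorokhod_topology)"
  unfolding borel_algebra_def
proof (rule measurable_measure_of)
  show "{U. openin skorokhod_topology U} \<subseteq> Pow (topspace skorokhod_topology)"
    using openin_subset by blast
  show "Y \<in> space N \<rightarrow> topspace skorokhod_topology"
    using cadlag by simp
  fix U assume "U \<in> {U. openin skorokhod_topology U}"
  then have U: "skorokhod_open U" by (simp add: openin_skorokhod_topology)
  show "Y -` U \<inter> space N \<in> sets N"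
  \<comment> \<open>The infimum defining the distance says nothing about an empty
    complement.\<close>
  proof (cases "cadlag_paths - U = {}")
    case True
    then have "Y -` U \<inter> space N = space N" using cadlag by blast
    then show ?thesis by simp
  next
    case False
    define g where "g x = (INF y\<in>cadlag_paths - U. 0 + 1 * path_dist x y)" for x
    have g: "path_lipschitz 1 g"
      unfolding g_def by (rule path_lipschitz_INF[where L = 0]) (use False in auto)
    have bdd: "bdd_below ((\<lambda>y. 0 + 1 * path_dist x y) ` (cadlag_paths - U))" for x
      using path_dist_nonneg by (intro bdd_belowI[of _ 0]) auto
    have "x \<in> U \<longleftrightarrow> g x > 0" if x: "x \<in> cadlag_paths" for x
    proof
      assume "g x > 0"
      moreover have "g x \<le> 0" if "x \<notin> U"
        unfolding g_def by (rule cINF_lower2[OF bdd, of x]) (use x that in auto)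
      ultimately show "x \<in> U" by force
    next
      assume xU: "x \<in> U"
      show "g x > 0"
      proof (rule ccontr)
        assume "\<not> g x > 0"
        \<comment> \<open>A point of \<open>U\<close> at distance 0 from the complement would be the
          limit of points outside \<open>U\<close>, against sequential openness.\<close>
        then have "\<exists>y\<in>cadlag_paths - U. path_dist y x < 1 / real (Suc n)" for n
        proof -
          have "g x < 1 / real (Suc n)"
            using \<open>\<not> g x > 0\<close> by (smt (verit) divide_pos_pos of_nat_0_less_iff zero_less_Suc)
          then show ?thesis
            unfolding g_def cINF_less_iff[OF False bdd] by (auto simp: path_dist_commute)
        qed
        then obtain X where X: "\<And>n. X n \<in> cadlag_paths - U" "\<And>n. path_dist (X n) x < 1 / real (Suc n)"
          by metis
        have "(\<lambda>n. path_dist (X n) x) \<longlonglongrightarrow> 0"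
          using path_dist_nonneg X(2)
          by (intro tendsto_sandwich[OF _ _ tendsto_const LIMSEQ_Suc[OF lim_1_over_n]] always_eventually allI)
            (auto intro: less_imp_le)
        then have "skorokhod_tendsto X x" by (rule skorokhod_tendsto_path_dist)
        then have "\<forall>\<^sub>F n in sequentially. X n \<in> U"
          using U xU X(1) unfolding skorokhod_open_def by blast
        then show False using X(1) by (auto simp: eventually_sequentially)
      qed
    qed
    then have "Y -` U \<inter> space N = {\<omega> \<in> space N. g (Y \<omega>) > 0}"
      using cadlag by blast
    also have "\<dots> \<in> sets N"
      using lipschitz_measurable[OF g] by measurable
    finally show ?thesis .
  qed
qed

end

text \<open>The interface between the topology of paths and the probabilistic estimates: convergence
  of values on every grid, and tightness in the form of a small mean distance to the discretised
  path, first n and then m tending to infinity. The number \<open>d\<close> expresses that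
  \<open>G\<close> depends on finitely many coordinates although it is defined on sequences.\<close>

locale process_approximation = continuous_process N Y
  for N :: "'b measure" and Y +
  fixes Q :: "nat \<Rightarrow> 'q pmf" and X :: "nat \<Rightarrow> 'q \<Rightarrow> real \<Rightarrow> real"
  assumes X_cadlag: "\<forall>\<^sub>F n in sequentially. \<forall>q. X n q \<in> cadlag_paths"
    and finite_dimensional: "\<And>m G d. m > 0 \<Longrightarrow> continuous_on UNIV G \<Longrightarrow> bounded (range G) \<Longrightarrow>
        (\<And>v w :: nat \<Rightarrow> real. (\<And>i. i \<le> d \<Longrightarrow> v i = w i) \<Longrightarrow> G v = G w) \<Longrightarrow>
        (\<lambda>n. measure_pmf.expectation (Q n) (\<lambda>q. G (\<lambda>i. X n q (real i / real m)))) \<longlonglongrightarrow>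
        expectation (\<lambda>\<omega>. G (\<lambda>i. Y \<omega> (real i / real m)) :: real)"
    and grid_approximation: "\<And>e. e > 0 \<Longrightarrow> \<forall>\<^sub>F m in sequentially. \<forall>\<^sub>F n in sequentially.
        measure_pmf.expectation (Q n) (\<lambda>q. path_dist (X n q) (grid_path m (X n q))) \<le> e"
begin

text \<open>Three comparisons: \<open>g\<close> of the path with \<open>g\<close> of its
  discretisation, by the Lipschitz bound; discretised walk with discretised limit, by
  finite-dimensional convergence; discretised limit with the limit, by continuity of its paths and
  dominated convergence.\<close>

lemma lipschitz_converges:
  assumes g: "path_lipschitz K g" "K > 0" and bd: "\<And>x. x \<in> cadlag_paths \<Longrightarrow> \<bar>g x\<bar> \<le> L"
  shows "(\<lambda>n. measure_pmf.expectation (Q n) (\<lambda>q. g (X n q))) \<longlonglongrightarrow> expectation (\<lambda>\<omega>. g (Y \<omega>))"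
proof (rule tendstoI)
  fix e :: real assume e: "e > 0"
  have "(\<lambda>m. expectation (\<lambda>\<omega>. g (grid_path (Suc m) (Y \<omega>)))) \<longlonglongrightarrow> expectation (\<lambda>\<omega>. g (Y \<omega>))"
  proof (rule integral_dominated_convergence[where w = "\<lambda>_. L"])
    show "(\<lambda>\<omega>. g (Y \<omega>)) \<in> borel_measurable N" using g lipschitz_measurable by simp
    show "(\<lambda>\<omega>. g (grid_path (Suc i) (Y \<omega>))) \<in> borel_measurable N" for i
      using g by (intro grid_measurable) auto
    show "AE \<omega> in N. (\<lambda>i. g (grid_path (Suc i) (Y \<omega>))) \<longlonglongrightarrow> g (Y \<omega>)"
      using path_lipschitz_grid_tendsto[OF g(1) cadlag continuous, THEN LIMSEQ_Suc] by auto
    show "AE \<omega> in N. norm (g (grid_path (Suc i) (Y \<omega>))) \<le> L" for i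
      by (auto simp: grid_path_def intro!: AE_I2 bd step_path_cadlag)
  qed auto
  then have "\<forall>\<^sub>F m in sequentially. dist (expectation (\<lambda>\<omega>. g (grid_path (Suc m) (Y \<omega>)))) (expectation (\<lambda>\<omega>. g (Y \<omega>))) < e / 3"
    using e by (intro tendstoD) auto
  then have "\<forall>\<^sub>F m in sequentially. dist (expectation (\<lambda>\<omega>. g (grid_path m (Y \<omega>)))) (expectation (\<lambda>\<omega>. g (Y \<omega>))) < e / 3"
    by (rule eventually_sequentially_Suc[THEN iffD1])
  moreover have "\<forall>\<^sub>F m in sequentially. \<forall>\<^sub>F n in sequentially.
        measure_pmf.expectation (Q n) (\<lambda>q. path_dist (X n q) (grid_path m (X n q))) \<le> e / (3 * K)"
    using e g by (intro grid_approximation) auto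
  ultimately have "\<forall>\<^sub>F m in sequentially. m > 0 \<and> dist (expectation (\<lambda>\<omega>. g (grid_path m (Y \<omega>)))) (expectation (\<lambda>\<omega>. g (Y \<omega>))) < e / 3
      \<and> (\<forall>\<^sub>F n in sequentially.
        measure_pmf.expectation (Q n) (\<lambda>q. path_dist (X n q) (grid_path m (X n q))) \<le> e / (3 * K))"
    using eventually_gt_at_top[of 0] by eventually_elim auto
  then obtain m where m: "m > 0" 
      "dist (expectation (\<lambda>\<omega>. g (grid_path m (Y \<omega>)))) (expectation (\<lambda>\<omega>. g (Y \<omega>))) < e / 3"
      "\<forall>\<^sub>F n in sequentially.
        measure_pmf.expectation (Q n) (\<lambda>q. path_dist (X n q) (grid_path m (X n q))) \<le> e / (3 * K)"
    unfolding eventually_sequentially by blast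
  have "(\<lambda>n. measure_pmf.expectation (Q n) (\<lambda>q. g (step_path m (\<lambda>i. X n q (real i / real m))))) \<longlonglongrightarrow>
      expectation (\<lambda>\<omega>. g (step_path m (\<lambda>i. Y \<omega> (real i / real m))))"
  proof (rule finite_dimensional[OF m(1), of "\<lambda>v. g (step_path m v)" "m * m"])
    show "continuous_on UNIV (\<lambda>v. g (step_path m v))"
      using g m by (intro path_lipschitz_step_continuous) auto
    show "bounded (range (\<lambda>v. g (step_path m v)))"
      using bd m by (auto simp: bounded_iff intro!: exI[of _ L] step_path_cadlag)
    show "g (step_path m v) = g (step_path m w)" if "\<And>i. i \<le> m * m \<Longrightarrow> v i = w i" for v w
      using that by (simp add: step_path_def)
  qed
  then have "\<forall>\<^sub>F n in sequentially. dist (measure_pmf.expectation (Q n) (\<lambda>q. g (grid_path m (X n q))))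
      (expectation (\<lambda>\<omega>. g (grid_path m (Y \<omega>)))) < e / 3"
    unfolding grid_path_def using e by (intro tendstoD) auto
  with m(3) X_cadlag show "\<forall>\<^sub>F n in sequentially. dist (measure_pmf.expectation (Q n) (\<lambda>q. g (X n q)))
      (expectation (\<lambda>\<omega>. g (Y \<omega>))) < e"
  proof eventually_elim
    case (elim n)
    have int: "integrable (measure_pmf (Q n)) f" if "\<And>q. \<bar>f q\<bar> \<le> B" for f :: "'q \<Rightarrow> real" and B
      by (rule measure_pmf.integrable_const_bound[where B = B]) (use that in auto)
    have grid: "grid_path m (X n q) \<in> cadlag_paths" for q
      using m by (simp add: grid_path_def step_path_cadlag)
    have i1: "integrable (measure_pmf (Q n)) (\<lambda>q. g (X n q))"
      "integrable (measure_pmf (Q n)) (\<lambda>q. g (grid_path m (X n q)))"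
      using elim grid bd by (auto intro!: int[of _ L])
    have i2: "integrable (measure_pmf (Q n)) (\<lambda>q. path_dist (X n q) (grid_path m (X n q)))"
      using path_dist_nonneg path_dist_le_1 by (auto intro!: int[of _ 1])
    have "\<bar>measure_pmf.expectation (Q n) (\<lambda>q. g (X n q)) - measure_pmf.expectation (Q n) (\<lambda>q. g (grid_path m (X n q)))\<bar>
        = \<bar>measure_pmf.expectation (Q n) (\<lambda>q. g (X n q) - g (grid_path m (X n q)))\<bar>"
      using i1 by simp
    also have "\<dots> \<le> measure_pmf.expectation (Q n) (\<lambda>q. K * path_dist (X n q) (grid_path m (X n q)))"
      using elim(2) grid path_lipschitzD[OF g(1)] i1 i2
      by (intro order_trans[OF integral_abs_bound] integral_mono) auto
    also have "\<dots> \<le> K * (e / (3 * K))"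
      unfolding integral_mult_right_zero using elim(1) g(2) by (intro mult_left_mono) auto
    also have "\<dots> = e / 3" using g(2) by simp
    finally show ?case
      using elim(3) m(2) unfolding dist_real_def by linarith
  qed
qed

text \<open>\<open>F k\<close> below is the largest \<open>k\<close>-Lipschitz function that is nowhere above \<open>f\<close>. One-sided bounds suffice
  since \<open>- f\<close> satisfies the same assumptions.\<close>

lemma lower_bound:
  fixes f :: "(real \<Rightarrow> real) \<Rightarrow> real"
  assumes f: "\<And>x. x \<in> cadlag_paths \<Longrightarrow> \<bar>f x\<bar> \<le> L"
    and cont: "\<And>x Z. x \<in> cadlag_paths \<Longrightarrow> (\<And>n. Z n \<in> cadlag_paths) \<Longrightarrow> skorokhod_tendsto Z x \<Longrightarrow> (\<lambda>n. f (Z n)) \<longlonglongrightarrow> f x"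
    and e: "e > 0"
  shows "(\<lambda>\<omega>. f (Y \<omega>)) \<in> borel_measurable N"
    and "\<forall>\<^sub>F n in sequentially. measure_pmf.expectation (Q n) (\<lambda>q. f (X n q)) \<ge> expectation (\<lambda>\<omega>. f (Y \<omega>)) - e"
proof -
  define F where "F k x = (INF y\<in>cadlag_paths. f y + real k * path_dist x y)" for k x
  have ne: "cadlag_paths \<noteq> {}" using step_path_cadlag[of 1] by auto
  then have "L \<ge> 0" using f by fastforce
  have bdd: "bdd_below ((\<lambda>y. f y + real k * path_dist x y) ` cadlag_paths)" for k x
    by (rule bdd_belowI[of _ "-L"]) (use f path_dist_nonneg in \<open>force simp: abs_le_iff intro: add_increasing2\<close>)
  have lip: "path_lipschitz (real k) (F k)" for k
    unfolding F_def by (rule path_lipschitz_INF[where L = "-L"]) (use f ne in \<open>auto simp: abs_le_iff\<close>, force)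
  have F_le: "F k x \<le> f x" if "x \<in> cadlag_paths" for k x
    unfolding F_def by (rule cINF_lower2[OF bdd that]) simp
  have F_ge: "F k x \<ge> - L" for k x
    unfolding F_def by (rule cINF_greatest[OF ne]) (use f path_dist_nonneg in \<open>force simp: abs_le_iff intro: add_increasing2\<close>)
  have F_bd: "\<bar>F k x\<bar> \<le> L" if "x \<in> cadlag_paths" for k x
    using F_le[OF that, of k] F_ge[of k x] f[OF that] by linarith
  have F_lim: "(\<lambda>k. F k x) \<longlonglongrightarrow> f x" if x: "x \<in> cadlag_paths" for x
  proof (rule tendstoI)
    fix r :: real assume r: "r > 0"
    have "\<exists>\<delta>>0. \<forall>y\<in>cadlag_paths. path_dist y x < \<delta> \<longrightarrow> \<bar>f y - f x\<bar> < r / 2"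
    proof (rule ccontr)
      assume no: "\<not> ?thesis"
      have "\<exists>y\<in>cadlag_paths. path_dist y x < 1 / real (Suc n) \<and> \<bar>f y - f x\<bar> \<ge> r / 2" for n
      proof (rule ccontr)
        assume "\<not> ?thesis"
        then have "1 / real (Suc n) > 0 \<and> (\<forall>y\<in>cadlag_paths. path_dist y x < 1 / real (Suc n) \<longrightarrow> \<bar>f y - f x\<bar> < r / 2)"
          by force
        with no show False by blast
      qed
      then obtain Z where Z: "\<And>n. Z n \<in> cadlag_paths" "\<And>n. path_dist (Z n) x < 1 / real (Suc n)"
          "\<And>n. \<bar>f (Z n) - f x\<bar> \<ge> r / 2" by metis
      have "(\<lambda>n. path_dist (Z n) x) \<longlonglongrightarrow> 0"
        using path_dist_nonneg Z(2)
        by (intro tendsto_sandwich[OF _ _ tendsto_const LIMSEQ_Suc[OF lim_1_over_n]] always_eventually allI)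
            (auto intro: less_imp_le)
      then have "(\<lambda>n. f (Z n)) \<longlonglongrightarrow> f x"
        using x Z(1) by (intro cont skorokhod_tendsto_path_dist)
      then have "\<forall>\<^sub>F n in sequentially. dist (f (Z n)) (f x) < r / 2"
        using r by (intro tendstoD) auto
      then show False using Z(3) by (auto simp: eventually_sequentially dist_real_def not_less[symmetric])
    qed
    then obtain \<delta> where \<delta>: "\<delta> > 0" "\<And>y. y \<in> cadlag_paths \<Longrightarrow> path_dist y x < \<delta> \<Longrightarrow> \<bar>f y - f x\<bar> < r / 2"
      by blast
    \<comment> \<open>Points closer than \<delta> change \<open>f\<close> by less than r / 2. For
      the others the penalty is at least 2 * L, the largest possible oscillation of
      \<open>f\<close>, as soon as k \<ge> 2 * L / \<delta>.\<close>
    have "\<bar>F k x - f x\<bar> < r" if k: "real k \<ge> 2 * L / \<delta>" for k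
    proof -
      have "f x - r / 2 \<le> F k x"
        unfolding F_def
      proof (rule cINF_greatest[OF ne])
        fix y assume y: "y \<in> cadlag_paths"
        show "f x - r / 2 \<le> f y + real k * path_dist x y"
        proof (cases "path_dist y x < \<delta>")
          case True
          have "0 \<le> real k * path_dist x y" using path_dist_nonneg by simp
          then show ?thesis using \<delta>(2)[OF y True] by linarith
        next
          case False
          then have "real k * path_dist x y \<ge> 2 * L / \<delta> * \<delta>"
            using k \<delta>(1) \<open>L \<ge> 0\<close> by (intro mult_mono) (auto simp: path_dist_commute)
          then have "real k * path_dist x y \<ge> 2 * L" using \<delta>(1) by simp
          then show ?thesis using f[OF y] f[OF x] r by linarith
        qed
      qed
      then show ?thesis using F_le[OF x, of k] r by linarith
    qed
    moreover have "\<forall>\<^sub>F k in sequentially. real k \<ge> 2 * L / \<delta>"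
      using filterlim_real_sequentially by (simp add: filterlim_at_top)
    ultimately show "\<forall>\<^sub>F k in sequentially. dist (F k x) (f x) < r"
      by (auto elim!: eventually_mono simp: dist_real_def)
  qed
  have F_meas: "(\<lambda>\<omega>. F k (Y \<omega>)) \<in> borel_measurable N" for k
    using lip by (rule lipschitz_measurable) auto
  show meas: "(\<lambda>\<omega>. f (Y \<omega>)) \<in> borel_measurable N"
    by (rule borel_measurable_LIMSEQ_real[OF F_lim F_meas]) (rule cadlag)
  have "(\<lambda>k. expectation (\<lambda>\<omega>. F k (Y \<omega>))) \<longlonglongrightarrow> expectation (\<lambda>\<omega>. f (Y \<omega>))"
    using F_lim F_bd cadlag
    by (intro integral_dominated_convergence[where w = "\<lambda>_. L"] meas F_meas AE_I2) auto
  then have "\<forall>\<^sub>F k in sequentially. k > 0 \<and> dist (expectation (\<lambda>\<omega>. F k (Y \<omega>))) (expectation (\<lambda>\<omega>. f (Y \<omega>))) < e / 2"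
    using e by (intro eventually_conj tendstoD eventually_gt_at_top) auto
  then obtain k where k: "k > 0" "dist (expectation (\<lambda>\<omega>. F k (Y \<omega>))) (expectation (\<lambda>\<omega>. f (Y \<omega>))) < e / 2"
    unfolding eventually_sequentially by blast
  have "(\<lambda>n. measure_pmf.expectation (Q n) (\<lambda>q. F k (X n q))) \<longlonglongrightarrow> expectation (\<lambda>\<omega>. F k (Y \<omega>))"
    using k F_bd by (intro lipschitz_converges[OF lip]) auto
  then have "\<forall>\<^sub>F n in sequentially. dist (measure_pmf.expectation (Q n) (\<lambda>q. F k (X n q))) (expectation (\<lambda>\<omega>. F k (Y \<omega>))) < e / 2"
    using e by (intro tendstoD) auto
  with X_cadlag show "\<forall>\<^sub>F n in sequentially. measure_pmf.expectation (Q n) (\<lambda>q. f (X n q)) \<ge> expectation (\<lambda>\<omega>. f (Y \<omega>)) - e"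
  proof eventually_elim
    case (elim n)
    have "measure_pmf.expectation (Q n) (\<lambda>q. F k (X n q)) \<le> measure_pmf.expectation (Q n) (\<lambda>q. f (X n q))"
      using elim F_bd f F_le
      by (intro integral_mono measure_pmf.integrable_const_bound[where B = L]) auto
    then show ?case using elim(2) k(2) unfolding dist_real_def by linarith
  qed
qed

theorem skorokhod_converges:
  assumes f: "continuous_map skorokhod_topology euclideanreal f" "bounded (f ` cadlag_paths)"
  shows "(\<lambda>n. measure_pmf.expectation (Q n) (\<lambda>q. f (X n q))) \<longlonglongrightarrow> expectation (\<lambda>\<omega>. f (Y \<omega>))"
proof (rule tendstoI)
  fix e :: real assume "e > 0"
  then have e: "e / 2 > 0" by simp
  obtain L where L: "\<And>x. x \<in> cadlag_paths \<Longrightarrow> \<bar>f x\<bar> \<le> L"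
    using f(2) by (auto simp: bounded_iff)
  note c = continuous_map_skorokhod_tendsto[OF f(1)]
  have "\<forall>\<^sub>F n in sequentially. measure_pmf.expectation (Q n) (\<lambda>q. f (X n q)) \<ge> expectation (\<lambda>\<omega>. f (Y \<omega>)) - e / 2"
    by (rule lower_bound(2)[OF L c e])
  moreover have "\<forall>\<^sub>F n in sequentially. measure_pmf.expectation (Q n) (\<lambda>q. - f (X n q)) \<ge> expectation (\<lambda>\<omega>. - f (Y \<omega>)) - e / 2"
    by (rule lower_bound(2)[OF _ tendsto_minus[OF c] e]) (use L in auto)
  ultimately show "\<forall>\<^sub>F n in sequentially. dist (measure_pmf.expectation (Q n) (\<lambda>q. f (X n q))) (expectation (\<lambda>\<omega>. f (Y \<omega>))) < e"
    by eventually_elim (use e in \<open>simp add: dist_real_def abs_less_iff\<close>)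
qed

end

section \<open>Finite-dimensional convergence from products of test functions\<close>

text \<open>A scalar can be absorbed into a factor, so the two rules generate an algebra. It is the
  span of tensor products, to which convergence extends by linearity.\<close>

inductive_set product_span :: "nat \<Rightarrow> ((nat \<Rightarrow> real) \<Rightarrow> real) set" for d where
  product: "(\<And>i. continuous_on UNIV (h i)) \<Longrightarrow> (\<And>i. bounded (range (h i))) \<Longrightarrow>
      (\<lambda>v. \<Prod>i\<le>d. h i (v i)) \<in> product_span d"
| add: "F \<in> product_span d \<Longrightarrow> G \<in> product_span d \<Longrightarrow> (\<lambda>v. F v + G v) \<in> product_span d"

lemma bounded_range_mult:
  fixes f g :: "'a \<Rightarrow> real"
  assumes "bounded (range f)" "bounded (range g)"
  shows "bounded (range (\<lambda>x. f x * g x))"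
proof -
  obtain A B where "\<And>x. \<bar>f x\<bar> \<le> A" "\<And>x. \<bar>g x\<bar> \<le> B"
    using assms by (auto simp: bounded_iff)
  then have "\<bar>f x * g x\<bar> \<le> A * B" for x
    unfolding abs_mult by (intro mult_mono) (auto intro: order_trans[OF abs_ge_zero])
  then show ?thesis by (auto simp: bounded_iff)
qed

lemma product_span_mult_product:
  assumes "F \<in> product_span d" "\<And>i. continuous_on UNIV (h i)" "\<And>i. bounded (range (h i))"
  shows "(\<lambda>v. F v * (\<Prod>i\<le>d. h i (v i))) \<in> product_span d"
  using assms(1)
proof induction
  case (product k)
  have "(\<lambda>v. \<Prod>i\<le>d. k i (v i) * h i (v i)) \<in> product_span d"
    using product assms(2,3)
    by (intro product_span.product continuous_on_mult bounded_range_mult)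
  then show ?case by (simp add: prod.distrib)
next
  case (add F G)
  then show ?case by (auto simp: distrib_right intro: product_span.add)
qed

lemma product_span_mult:
  assumes "F \<in> product_span d" "G \<in> product_span d"
  shows "(\<lambda>v. F v * G v) \<in> product_span d"
  using assms(2)
proof induction
  case (product k)
  then show ?case using assms(1) by (intro product_span_mult_product)
next
  case (add G G')
  then show ?case by (auto simp: distrib_left intro: product_span.add)
qed

lemma product_span_coordinate:
  assumes "continuous_on UNIV q" "bounded (range q)" "i \<le> d"
  shows "(\<lambda>v. q (v i)) \<in> product_span d"
proof -
  have "(\<lambda>v. \<Prod>j\<le>d. (if j = i then q else (\<lambda>_. 1)) (v j)) \<in> product_span d"
    using assms by (intro product_span.product) auto
  also have "(\<lambda>v. \<Prod>j\<le>d. (if j = i then q else (\<lambda>_. 1)) (v j)) = (\<lambda>v. \<Prod>j\<le>d. if j = i then q (v j) else 1)"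
    by (intro ext prod.cong) auto
  also have "\<dots> = (\<lambda>v. q (v i))"
    using assms(3) by simp
  finally show ?thesis .
qed

lemma product_span_const: "(\<lambda>_. c) \<in> product_span d"
  using product_span_coordinate[of "\<lambda>_. c" 0 d] by simp

lemma product_span_continuous: "F \<in> product_span d \<Longrightarrow> continuous_on UNIV F"
proof (induction rule: product_span.induct)
  case (product h)
  show ?case
  proof (rule continuous_on_prod)
    fix i
    show "continuous_on UNIV (\<lambda>v :: nat \<Rightarrow> real. h i (v i))"
      by (rule continuous_on_compose2[OF product(1)]) auto
  qed
qed (intro continuous_intros)

lemma product_span_bounded: "F \<in> product_span d \<Longrightarrow> bounded (range F)"
proof (induction rule: product_span.induct)
  case (product h)
  then obtain B where B: "\<And>i y. \<bar>h i y\<bar> \<le> B i"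
    unfolding bounded_iff by (metis rangeI real_norm_def)
  have "\<bar>\<Prod>i\<le>d. h i (v i)\<bar> \<le> (\<Prod>i\<le>d. B i)" for v
    unfolding abs_prod by (intro prod_mono) (use B in auto)
  then show ?case by (auto simp: bounded_iff)
next
  case (add F G)
  show ?case using add.IH by (rule bounded_plus_comp)
qed

text \<open>A retraction onto a cube. Coordinates beyond \<open>d\<close> are set to 0 so that the
  image lies in a compact set of sequences. Since it acts coordinatewise, composing with it
  preserves \<open>product_span\<close>, which yields approximants that are controlled off the cube
  as well.\<close>

definition clamp_coordinates :: "nat \<Rightarrow> real \<Rightarrow> (nat \<Rightarrow> real) \<Rightarrow> nat \<Rightarrow> real" where
  "clamp_coordinates d L v = (\<lambda>i. if i \<le> d then max (- L) (min L (v i)) else 0)"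

lemma product_span_clamp:
  assumes "F \<in> product_span d"
  shows "(\<lambda>v. F (clamp_coordinates d L v)) \<in> product_span d"
  using assms
proof induction
  case (product h)
  have "(\<lambda>v. \<Prod>i\<le>d. h i (max (- L) (min L (v i)))) \<in> product_span d"
  proof (rule product_span.product)
    fix i
    show "continuous_on UNIV (\<lambda>y. h i (max (- L) (min L y)))"
      by (rule continuous_on_compose2[OF product(1)[of i]]) (auto intro!: continuous_intros)
    show "bounded (range (\<lambda>y. h i (max (- L) (min L y))))"
      by (rule bounded_subset[OF product(2)[of i]]) auto
  qed
  then show ?case by (simp add: clamp_coordinates_def)
next
  case (add F G)
  then show ?case by (intro product_span.add)
qed

lemma Stone_Weierstrass_product_span:
  fixes G :: "(nat \<Rightarrow> real) \<Rightarrow> real"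
  assumes "continuous_on UNIV G" "e > 0"
  shows "\<exists>F\<in>product_span d. \<forall>v\<in>range (clamp_coordinates d L). \<bar>G v - F v\<bar> < e"
proof -
  \<comment> \<open>The minima and maxima make this a nonempty cube containing the clamped points
    for either sign of \<open>L\<close>; it is compact by Tychonoff's theorem.\<close>
  define S where "S = PiE UNIV (\<lambda>i. if i \<le> d then {min (-L) L..max (-L) L} else {0::real})"
  have "compactin (product_topology (\<lambda>_. euclidean) UNIV) S"
    unfolding S_def by (subst compactin_PiE) auto
  then have S: "compact S" by (simp add: euclidean_product_topology)
  interpret function_ring_on "product_span d" S
  proof
    fix F assume "F \<in> product_span d"
    then show "continuous_on S F"
      using product_span_continuous continuous_on_subset by blast
  next
    fix x y assume xy: "x \<in> S" "y \<in> S" "x \<noteq> y"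
    then obtain i where i: "x i \<noteq> y i" by blast
    have "i \<le> d"
    proof (rule ccontr)
      assume "\<not> i \<le> d"
      then have "x i = 0" "y i = 0" using xy by (auto simp: S_def PiE_iff dest!: spec[of _ i])
      then show False using i by simp
    qed
    \<comment> \<open>A coordinate function is unbounded and thus no admissible factor. Its clamped
      version is bounded and agrees with it on \<open>S\<close>, so it still separates
      points.\<close>
    define q where "q = (\<lambda>y. max (min (-L) L) (min (max (-L) L) y))"
    have "bounded (range q)"
      by (rule bounded_subset[of "{min (-L) L..max (-L) L}"]) (auto simp: q_def)
    moreover have "continuous_on UNIV q"
      unfolding q_def by (intro continuous_intros)
    ultimately have "(\<lambda>v. q (v i)) \<in> product_span d"
      using \<open>i \<le> d\<close> by (intro product_span_coordinate)
    moreover have "q (x i) = x i" "q (y i) = y i"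
      using xy \<open>i \<le> d\<close> by (auto simp: S_def PiE_iff q_def dest!: spec[of _ i])
    ultimately show "\<exists>f\<in>product_span d. f x \<noteq> f y"
      using i by (intro bexI[of _ "\<lambda>v. q (v i)"]) auto
  qed (auto intro: S product_span.add product_span_mult product_span_const)
  have "range (clamp_coordinates d L) \<subseteq> S"
    by (auto simp: S_def clamp_coordinates_def)
  moreover obtain F where "F \<in> product_span d" "\<forall>v\<in>S. \<bar>G v - F v\<bar> < e"
    using Stone_Weierstrass_basic[OF continuous_on_subset[OF assms(1)] assms(2)] by auto
  ultimately show ?thesis by blast
qed

text \<open>A continuous substitute for the indicator of large values, reaching 1 at \<bar>y\<bar> =
  L + 1. Being an admissible factor, it transfers tightness from the limit to the approximating
  laws.\<close>

definition tail_cutoff :: "real \<Rightarrow> real \<Rightarrow> real" where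
  "tail_cutoff L y = max 0 (min 1 (\<bar>y\<bar> - L))"

locale product_convergence = prob_space N
  for N :: "'b measure" +
  fixes Z :: "'b \<Rightarrow> nat \<Rightarrow> real"
    and Q :: "nat \<Rightarrow> 'q pmf" and Y :: "nat \<Rightarrow> 'q \<Rightarrow> nat \<Rightarrow> real" and d :: nat
  assumes Z_measurable: "\<And>i. (\<lambda>\<omega>. Z \<omega> i) \<in> borel_measurable N"
    and products: "\<And>h. (\<And>i. continuous_on UNIV (h i)) \<Longrightarrow> (\<And>i. bounded (range (h i))) \<Longrightarrow>
        (\<lambda>n. measure_pmf.expectation (Q n) (\<lambda>q. \<Prod>i\<le>d. h i (Y n q i))) \<longlonglongrightarrow>
        expectation (\<lambda>\<omega>. \<Prod>i\<le>d. h i (Z \<omega> i) :: real)"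
begin

lemma Z_measurable_compose:
  fixes G :: "(nat \<Rightarrow> real) \<Rightarrow> real"
  assumes "continuous_on UNIV G"
  shows "(\<lambda>\<omega>. G (Z \<omega>)) \<in> borel_measurable N"
proof (rule measurable_compose[of Z _ borel])
  show "Z \<in> borel_measurable N"
    by (rule measurable_coordinatewise_then_product) (rule Z_measurable)
qed (rule borel_measurable_continuous_onI[OF assms])

lemma integrable_bounded:
  fixes G :: "(nat \<Rightarrow> real) \<Rightarrow> real"
  assumes "bounded (range G)"
  shows "integrable (measure_pmf (Q n)) (\<lambda>q. G (Y n q))"
    and "continuous_on UNIV G \<Longrightarrow> integrable N (\<lambda>\<omega>. G (Z \<omega>))"
proof -
  obtain B where B: "\<And>v. \<bar>G v\<bar> \<le> B" using assms by (auto simp: bounded_iff)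
  show "integrable (measure_pmf (Q n)) (\<lambda>q. G (Y n q))"
    by (rule measure_pmf.integrable_const_bound[where B = B]) (use B in auto)
  show "continuous_on UNIV G \<Longrightarrow> integrable N (\<lambda>\<omega>. G (Z \<omega>))"
    by (rule integrable_const_bound[where B = B]) (use B Z_measurable_compose in auto)
qed

lemma product_span_converges:
  assumes "F \<in> product_span d"
  shows "(\<lambda>n. measure_pmf.expectation (Q n) (\<lambda>q. F (Y n q))) \<longlonglongrightarrow> expectation (\<lambda>\<omega>. F (Z \<omega>))"
  using assms
proof induction
  case (product h)
  then show ?case by (rule products)
next
  case (add F G)
  have int: "integrable (measure_pmf (Q n)) (\<lambda>q. H (Y n q))" "integrable N (\<lambda>\<omega>. H (Z \<omega>))"
    if "H \<in> product_span d" for H n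
    using that by (auto intro!: integrable_bounded product_span_bounded product_span_continuous)
  show ?case
    using add int by (auto intro: tendsto_add)
qed

lemma tail_cutoff_small:
  assumes "e > 0"
  shows "\<exists>L>0. expectation (\<lambda>\<omega>. \<Sum>i\<le>d. tail_cutoff L (Z \<omega> i)) < e"
proof -
  have "(\<lambda>k. expectation (\<lambda>\<omega>. \<Sum>i\<le>d. tail_cutoff (real (Suc k)) (Z \<omega> i))) \<longlonglongrightarrow> expectation (\<lambda>\<omega>. 0)"
  proof (rule integral_dominated_convergence[where w = "\<lambda>_. real (Suc d)"])
    show "AE \<omega> in N. (\<lambda>k. \<Sum>i\<le>d. tail_cutoff (real (Suc k)) (Z \<omega> i)) \<longlonglongrightarrow> 0"
    proof (rule AE_I2)
      fix \<omega>
      have "(\<lambda>k. tail_cutoff (real (Suc k)) (Z \<omega> i)) \<longlonglongrightarrow> 0" for i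
      proof (rule tendsto_eventually)
        have "\<forall>\<^sub>F k in sequentially. \<bar>Z \<omega> i\<bar> \<le> real k"
          using filterlim_real_sequentially by (simp add: filterlim_at_top)
        then show "\<forall>\<^sub>F k in sequentially. tail_cutoff (real (Suc k)) (Z \<omega> i) = 0"
          by eventually_elim (auto simp: tail_cutoff_def)
      qed
      then show "(\<lambda>k. \<Sum>i\<le>d. tail_cutoff (real (Suc k)) (Z \<omega> i)) \<longlonglongrightarrow> 0"
        by (intro tendsto_null_sum)
    qed
    show "AE \<omega> in N. norm (\<Sum>i\<le>d. tail_cutoff (real (Suc k)) (Z \<omega> i)) \<le> real (Suc d)" for k
    proof (rule AE_I2)
      fix \<omega>
      have "norm (\<Sum>i\<le>d. tail_cutoff (real (Suc k)) (Z \<omega> i)) \<le> (\<Sum>i\<le>d. 1)"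
        by (rule sum_norm_le) (auto simp: tail_cutoff_def)
      then show "norm (\<Sum>i\<le>d. tail_cutoff (real (Suc k)) (Z \<omega> i)) \<le> real (Suc d)" by simp
    qed
    show "(\<lambda>\<omega>. \<Sum>i\<le>d. tail_cutoff (real (Suc k)) (Z \<omega> i)) \<in> borel_measurable N" for k
      unfolding tail_cutoff_def using Z_measurable by measurable
  qed auto
  then have "\<forall>\<^sub>F k in sequentially. expectation (\<lambda>\<omega>. \<Sum>i\<le>d. tail_cutoff (real (Suc k)) (Z \<omega> i)) < e"
    using assms by (intro order_tendstoD) auto
  then show ?thesis
    unfolding eventually_sequentially by (metis of_nat_0_less_iff order_refl zero_less_Suc)
qed

theorem continuous_converges:
  fixes G :: "(nat \<Rightarrow> real) \<Rightarrow> real"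
  assumes G: "continuous_on UNIV G" "bounded (range G)"
    and dep: "\<And>v w. (\<And>i. i \<le> d \<Longrightarrow> v i = w i) \<Longrightarrow> G v = G w"
  shows "(\<lambda>n. measure_pmf.expectation (Q n) (\<lambda>q. G (Y n q))) \<longlonglongrightarrow> expectation (\<lambda>\<omega>. G (Z \<omega>))"
proof (rule tendstoI)
  fix e :: real assume e: "e > 0"
  obtain B' where "\<And>v. \<bar>G v\<bar> \<le> B'" using G by (auto simp: bounded_iff)
  then obtain B where B: "B > 0" "\<And>v. \<bar>G v\<bar> \<le> B"
    by (metis abs_ge_zero less_add_one order_trans less_eq_real_def add_pos_nonneg zero_less_one)
  obtain L where L: "L > 0" "expectation (\<lambda>\<omega>. \<Sum>i\<le>d. tail_cutoff L (Z \<omega> i)) < e / (10 * B)"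
    using tail_cutoff_small[of "e / (10 * B)"] e B by auto
  \<comment> \<open>\<open>tail_cutoff L\<close> equals 1 only from L + 1 on, so this is the cube
    outside of which \<open>T\<close> is at least 1.\<close>
  define L' where "L' = L + 1"
  obtain F where F: "F \<in> product_span d" 
      "\<And>v. \<bar>G (clamp_coordinates d L' v) - F (clamp_coordinates d L' v)\<bar> < e / 10"
    using Stone_Weierstrass_product_span[OF G(1), of "e / 10" d L'] e by auto
  define F' where "F' = (\<lambda>v. F (clamp_coordinates d L' v))"
  define T where "T = (\<lambda>v :: nat \<Rightarrow> real. \<Sum>i\<le>d. tail_cutoff L (v i))"
  have F': "F' \<in> product_span d" unfolding F'_def by (rule product_span_clamp[OF F(1)])
  have "\<bar>tail_cutoff L y\<bar> \<le> 1" for y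
    by (auto simp: tail_cutoff_def)
  then have q: "bounded (range (tail_cutoff L))" "continuous_on UNIV (tail_cutoff L)"
    by (auto simp: bounded_iff) (auto simp: tail_cutoff_def intro!: continuous_intros)
  have "(\<lambda>v. \<Sum>i\<in>I. tail_cutoff L (v i)) \<in> product_span d" if "finite I" "I \<subseteq> {..d}" for I
    using that by (induction I rule: finite_induct)
      (auto intro!: product_span_const product_span.add product_span_coordinate q)
  then have T: "T \<in> product_span d" unfolding T_def by simp
  have near: "\<bar>G v - F' v\<bar> \<le> e / 10 + 2 * B * T v" for v
  proof -
    have "\<bar>G v - G (clamp_coordinates d L' v)\<bar> \<le> 2 * B * T v"
    proof (cases "\<forall>i\<le>d. \<bar>v i\<bar> \<le> L'")
      case True
      then have "G v = G (clamp_coordinates d L' v)"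
        by (intro dep) (auto simp: clamp_coordinates_def abs_le_iff min_def max_def)
      moreover have "T v \<ge> 0" by (auto simp: T_def tail_cutoff_def intro!: sum_nonneg)
      ultimately show ?thesis using B by simp
    next
      case False
      then obtain i where i: "i \<le> d" "\<bar>v i\<bar> > L'" by force
      have "1 \<le> tail_cutoff L (v i)" using i by (auto simp: tail_cutoff_def L'_def)
      also have "\<dots> \<le> T v"
        unfolding T_def by (rule member_le_sum[of i _ "\<lambda>i. tail_cutoff L (v i)"]) (use i in \<open>auto simp: tail_cutoff_def\<close>)
      finally have "2 * B * 1 \<le> 2 * B * T v" using B by (intro mult_left_mono) auto
      then show ?thesis using B(2)[of v] B(2)[of "clamp_coordinates d L' v"] by linarith
    qed
    then show ?thesis using F(2)[of v] unfolding F'_def by linarith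
  qed
  define A where "A = (\<lambda>v. e / 10 + 2 * B * T v)"
  have "(\<lambda>v. 2 * B * T v) \<in> product_span d"
    using product_span_mult[OF product_span_const T] by auto
  then have A: "A \<in> product_span d"
    unfolding A_def by (intro product_span.add product_span_const)
  have intN: "integrable N (\<lambda>\<omega>. H (Z \<omega>))" "integrable (measure_pmf (Q n)) (\<lambda>q. H (Y n q))"
    if "H \<in> product_span d" for H n
    using that by (auto intro!: integrable_bounded product_span_bounded product_span_continuous)
  note intG = integrable_bounded[OF G(2)]
  have "expectation (\<lambda>\<omega>. A (Z \<omega>)) = e / 10 + 2 * B * expectation (\<lambda>\<omega>. T (Z \<omega>))"
    using intN[OF T] by (simp add: A_def prob_space)
  moreover have "2 * B * expectation (\<lambda>\<omega>. T (Z \<omega>)) \<le> 2 * B * (e / (10 * B))"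
    using L B by (intro mult_left_mono) (auto simp: T_def)
  ultimately have EA: "expectation (\<lambda>\<omega>. A (Z \<omega>)) \<le> 3 * e / 10" using B by simp
  have Zb: "\<bar>expectation (\<lambda>\<omega>. G (Z \<omega>)) - expectation (\<lambda>\<omega>. F' (Z \<omega>))\<bar> \<le> 3 * e / 10"
  proof -
    have "\<bar>expectation (\<lambda>\<omega>. G (Z \<omega>)) - expectation (\<lambda>\<omega>. F' (Z \<omega>))\<bar> = \<bar>expectation (\<lambda>\<omega>. G (Z \<omega>) - F' (Z \<omega>))\<bar>"
      using intN[OF F'] intG G by simp
    also have "\<dots> \<le> expectation (\<lambda>\<omega>. A (Z \<omega>))"
      using near intN[OF F'] intN[OF A] intG G
      by (intro order_trans[OF integral_abs_bound] integral_mono) (auto simp: A_def)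
    finally show ?thesis using EA by simp
  qed
  \<comment> \<open>The budget: 3e/10 for replacing \<open>G\<close> by \<open>F'\<close> in the
    limit, e/10 for the convergence of \<open>F'\<close>, and 3e/10 + e/10 for replacing
    \<open>G\<close> by \<open>F'\<close> before the limit.\<close>
  have "\<forall>\<^sub>F n in sequentially. dist (measure_pmf.expectation (Q n) (\<lambda>q. F' (Y n q))) (expectation (\<lambda>\<omega>. F' (Z \<omega>))) < e / 10"
    by (rule tendstoD[OF product_span_converges[OF F']]) (use e in auto)
  moreover have "\<forall>\<^sub>F n in sequentially. dist (measure_pmf.expectation (Q n) (\<lambda>q. A (Y n q))) (expectation (\<lambda>\<omega>. A (Z \<omega>))) < e / 10"
    by (rule tendstoD[OF product_span_converges[OF A]]) (use e in auto)
  ultimately show "\<forall>\<^sub>F n in sequentially. dist (measure_pmf.expectation (Q n) (\<lambda>q. G (Y n q))) (expectation (\<lambda>\<omega>. G (Z \<omega>))) < e"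
  proof eventually_elim
    case (elim n)
    have "\<bar>measure_pmf.expectation (Q n) (\<lambda>q. G (Y n q)) - measure_pmf.expectation (Q n) (\<lambda>q. F' (Y n q))\<bar>
        = \<bar>measure_pmf.expectation (Q n) (\<lambda>q. G (Y n q) - F' (Y n q))\<bar>"
      using intN[OF F'] intG G by simp
    also have "\<dots> \<le> measure_pmf.expectation (Q n) (\<lambda>q. A (Y n q))"
      using near intN[OF F'] intN[OF A] intG G
      by (intro order_trans[OF integral_abs_bound] integral_mono) (auto simp: A_def)
    finally show ?case using elim EA Zb e unfolding dist_real_def by linarith
  qed
qed

end

section \<open>Averages over permutations\<close>

text \<open>A finite sum avoids integrability conditions, and values in any normed space allow real
  weights and complex exponentials to be treated alike.\<close>

definition perm_avg :: "nat \<Rightarrow> ((nat \<Rightarrow> nat) \<Rightarrow> 'a) \<Rightarrow> 'a::real_normed_vector" where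
  "perm_avg n F = (\<Sum>\<pi> | \<pi> permutes {..<n}. F \<pi>) /\<^sub>R fact n"

lemma finite_perms [simp]: "finite {\<pi>. \<pi> permutes {..<n::nat}}"
  by (simp add: finite_permutations)

lemma card_perms [simp]: "card {\<pi>. \<pi> permutes {..<n::nat}} = fact n"
  by (rule card_permutations) auto

lemma perms_nonempty [simp]: "{\<pi>. \<pi> permutes {..<n::nat}} \<noteq> {}"
  using permutes_id by blast

lemma perm_avg_eq_expectation:
  "perm_avg n F = measure_pmf.expectation (pmf_of_set {\<pi>. \<pi> permutes {..<n}}) (F :: _ \<Rightarrow> real)"
  by (subst integral_pmf_of_set[OF perms_nonempty finite_perms]) (simp_all add: perm_avg_def divide_inverse mult.commute)

lemma perm_avg_const [simp]: "perm_avg n (\<lambda>_. a) = a"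
  by (simp add: perm_avg_def scaleR_conv_of_real flip: sum_constant_scaleR)
    (simp add: sum_constant_scaleR)

lemma perm_avg_cong:
  "(\<And>\<pi>. \<pi> permutes {..<n} \<Longrightarrow> F \<pi> = G \<pi>) \<Longrightarrow> perm_avg n F = perm_avg n G"
  by (simp add: perm_avg_def)

lemma perm_avg_add: "perm_avg n (\<lambda>\<pi>. F \<pi> + G \<pi>) = perm_avg n F + perm_avg n G"
  by (simp add: perm_avg_def sum.distrib scaleR_right_distrib)

lemma perm_avg_diff: "perm_avg n (\<lambda>\<pi>. F \<pi> - G \<pi>) = perm_avg n F - perm_avg n G"
  by (simp add: perm_avg_def sum_subtractf scaleR_right_diff_distrib)

lemma perm_avg_sum: "perm_avg n (\<lambda>\<pi>. \<Sum>i\<in>I. F i \<pi>) = (\<Sum>i\<in>I. perm_avg n (F i))"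
  by (simp add: perm_avg_def sum.swap[of _ I] flip: scaleR_sum_right)

lemma perm_avg_mult_left:
  "perm_avg n (\<lambda>\<pi>. a * F \<pi>) = a * perm_avg n (F :: _ \<Rightarrow> 'a::real_normed_field)"
  by (simp add: perm_avg_def sum_distrib_left)

lemma perm_avg_mult_right:
  "perm_avg n (\<lambda>\<pi>. F \<pi> * a) = perm_avg n (F :: _ \<Rightarrow> 'a::real_normed_field) * a"
  by (simp add: perm_avg_def sum_distrib_right)

lemma perm_avg_mono:
  fixes F G :: "_ \<Rightarrow> real"
  shows "(\<And>\<pi>. \<pi> permutes {..<n} \<Longrightarrow> F \<pi> \<le> G \<pi>) \<Longrightarrow> perm_avg n F \<le> perm_avg n G"
  unfolding perm_avg_def by (intro scaleR_left_mono sum_mono) auto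

lemma perm_avg_nonneg:
  fixes F :: "_ \<Rightarrow> real"
  shows "(\<And>\<pi>. \<pi> permutes {..<n} \<Longrightarrow> 0 \<le> F \<pi>) \<Longrightarrow> 0 \<le> perm_avg n F"
  unfolding perm_avg_def by (intro scaleR_nonneg_nonneg sum_nonneg) auto

lemma norm_perm_avg: "norm (perm_avg n F) \<le> perm_avg n (\<lambda>\<pi>. norm (F \<pi>))"
  by (simp add: perm_avg_def divide_right_mono norm_sum mult_left_mono)

lemma perm_avg_of_real: "perm_avg n (\<lambda>\<pi>. of_real (F \<pi>)) = (of_real (perm_avg n F) :: complex)"
  by (simp add: perm_avg_def scaleR_conv_of_real)

text \<open>Composition on the right permutes positions, not entries, and is a bijection of the
  permutations. All exchangeability arguments come from this invariance: transpositions give equal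
  conditional laws of unseen entries, a cyclic shift gives stationary increments.\<close>

lemma perm_avg_compose:
  assumes "\<rho> permutes {..<n}"
  shows "perm_avg n (\<lambda>\<pi>. F (\<pi> \<circ> \<rho>)) = perm_avg n F"
  unfolding perm_avg_def using sum_permutations_compose_right[OF assms, of F] by simp

text \<open>Every entry is used exactly once, so statistics of the unseen entries are functions of
  the seen ones.\<close>

lemma perm_tail_sum:
  fixes h :: "nat \<Rightarrow> 'a::ab_group_add"
  assumes "\<pi> permutes {..<n}" "k \<le> n"
  shows "(\<Sum>j\<in>{k..<n}. h (\<pi> j)) = (\<Sum>j<n. h j) - (\<Sum>j<k. h (\<pi> j))"
proof -
  have "(\<Sum>j<n. h j) = (\<Sum>j<n. h (\<pi> j))"
    using sum.permute[OF assms(1), of h] by (simp add: comp_def)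
  also have "\<dots> = (\<Sum>j<k. h (\<pi> j)) + (\<Sum>j\<in>{k..<n}. h (\<pi> j))"
    using assms(2) by (subst sum.union_disjoint[symmetric]) (auto intro!: sum.cong)
  finally show ?thesis by simp
qed

text \<open>Measurability with respect to the first \<open>k\<close> entries. Quantifying over all
  functions and not just permutations spares side conditions when it is checked.\<close>

definition determined_by_first :: "nat \<Rightarrow> ((nat \<Rightarrow> nat) \<Rightarrow> 'a) \<Rightarrow> bool" where
  "determined_by_first k w \<longleftrightarrow> (\<forall>\<pi> \<rho>. (\<forall>i<k. \<pi> i = \<rho> i) \<longrightarrow> w \<pi> = w \<rho>)"

lemma determined_by_firstD:
  "determined_by_first k w \<Longrightarrow> (\<And>i. i < k \<Longrightarrow> \<pi> i = \<rho> i) \<Longrightarrow> w \<pi> = w \<rho>"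
  by (auto simp: determined_by_first_def)

lemma determined_by_first_const [simp]: "determined_by_first k (\<lambda>_. a)"
  by (simp add: determined_by_first_def)

lemma perm_avg_swap:
  fixes h :: "nat \<Rightarrow> 'a::real_normed_field"
  assumes w: "determined_by_first k w" and "i \<in> {k..<n}" "j \<in> {k..<n}"
  shows "perm_avg n (\<lambda>\<pi>. w \<pi> * h (\<pi> i)) = perm_avg n (\<lambda>\<pi>. w \<pi> * h (\<pi> j))"
proof -
  have "Transposition.transpose i j permutes {..<n}" using assms by (intro permutes_swap_id) auto
  from perm_avg_compose[OF this, of "\<lambda>\<pi>. w \<pi> * h (\<pi> i)"]
  have "perm_avg n (\<lambda>\<pi>. w \<pi> * h (\<pi> i)) = perm_avg n (\<lambda>\<pi>. w (\<pi> \<circ> Transposition.transpose i j) * h (\<pi> j))"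
    by simp
  moreover have "w (\<pi> \<circ> Transposition.transpose i j) = w \<pi>" for \<pi>
    using assms by (intro determined_by_firstD[OF w]) (auto simp: Transposition.transpose_def)
  ultimately show ?thesis by simp
qed

text \<open>Given the first \<open>k\<close> entries, the entry at a later position is uniform among
  the n - k remaining ones. Multiplying by n - k states this without conditioning and without
  division.\<close>

lemma perm_avg_next:
  fixes h :: "nat \<Rightarrow> 'a::real_normed_field"
  assumes w: "determined_by_first k w" and "i \<in> {k..<n}"
  shows "of_nat (n - k) * perm_avg n (\<lambda>\<pi>. w \<pi> * h (\<pi> i))
    = perm_avg n (\<lambda>\<pi>. w \<pi> * (\<Sum>j\<in>{k..<n}. h (\<pi> j)))"
proof -
  have "perm_avg n (\<lambda>\<pi>. w \<pi> * (\<Sum>j\<in>{k..<n}. h (\<pi> j)))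
      = (\<Sum>j\<in>{k..<n}. perm_avg n (\<lambda>\<pi>. w \<pi> * h (\<pi> j)))"
    by (simp add: sum_distrib_left perm_avg_sum)
  also have "\<dots> = (\<Sum>j\<in>{k..<n}. perm_avg n (\<lambda>\<pi>. w \<pi> * h (\<pi> i)))"
    using assms by (intro sum.cong perm_avg_swap refl) auto
  finally show ?thesis by simp
qed

lemma perm_avg_swap_pair:
  fixes h :: "nat \<Rightarrow> 'a::real_normed_field"
  assumes w: "determined_by_first k w" and ij: "i \<in> {k..<n}" "j \<in> {k..<n}" "i \<noteq> j"
    and ij': "i' \<in> {k..<n}" "j' \<in> {k..<n}" "i' \<noteq> j'"
  shows "perm_avg n (\<lambda>\<pi>. w \<pi> * (h (\<pi> i) * h (\<pi> j))) = perm_avg n (\<lambda>\<pi>. w \<pi> * (h (\<pi> i') * h (\<pi> j')))"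
proof -
  define E where "E i j = perm_avg n (\<lambda>\<pi>. w \<pi> * (h (\<pi> i) * h (\<pi> j)))" for i j
  have sym: "E i j = E j i" for i j
    by (simp add: E_def mult.commute)
  have swap: "E i j = E l j" if "i \<in> {k..<n}" "j \<in> {k..<n}" "l \<in> {k..<n}" "i \<noteq> j" "l \<noteq> j" for i j l
  proof -
    have "Transposition.transpose i l permutes {..<n}" using that by (intro permutes_swap_id) auto
    from perm_avg_compose[OF this, of "\<lambda>\<pi>. w \<pi> * (h (\<pi> i) * h (\<pi> j))"]
    have "E i j = perm_avg n (\<lambda>\<pi>. w (\<pi> \<circ> Transposition.transpose i l) * (h (\<pi> l) * h (\<pi> j)))"
      using that by (simp add: E_def)
    moreover have "w (\<pi> \<circ> Transposition.transpose i l) = w \<pi>" for \<pi>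
      using that by (intro determined_by_firstD[OF w]) (auto simp: Transposition.transpose_def)
    ultimately show ?thesis by (simp add: E_def)
  qed
  have "E i j = E i' j'"
  \<comment> \<open>Moving i directly to i' would collide with the second index if i' = j. In that
    case i is moved to j', and symmetry finishes.\<close>
  proof (cases "i' = j")
    case True
    then show ?thesis using swap[of i j j'] sym ij ij' by metis
  next
    case False
    then show ?thesis using swap[of i j i'] swap[of j i' j'] sym ij ij' by metis
  qed
  then show ?thesis by (simp add: E_def)
qed

text \<open>By exchangeability all diagonal terms agree and all off-diagonal terms agree, so two
  numbers determine every second moment; \<open>n - k \<ge> 2\<close> provides positions for
  both.\<close>

lemma perm_avg_square_sum:
  fixes h :: "nat \<Rightarrow> real"
  assumes w: "determined_by_first k w" and I: "I \<subseteq> {k..<n}" and n: "n - k \<ge> 2"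
  shows "perm_avg n (\<lambda>\<pi>. w \<pi> * (\<Sum>i\<in>I. h (\<pi> i))\<^sup>2) =
     real (card I) * perm_avg n (\<lambda>\<pi>. w \<pi> * (h (\<pi> k))\<^sup>2)
     + real (card I) * (real (card I) - 1) * perm_avg n (\<lambda>\<pi>. w \<pi> * (h (\<pi> k) * h (\<pi> (Suc k))))"
    (is "_ = _ * ?a + _ * ?b")
proof -
  have fin: "finite I" using I finite_subset by blast
  have "(\<Sum>i\<in>I. h (\<pi> i))\<^sup>2 = (\<Sum>i\<in>I. (h (\<pi> i))\<^sup>2 + (\<Sum>j\<in>I - {i}. h (\<pi> i) * h (\<pi> j)))" for \<pi>
    unfolding power2_eq_square sum_product
    by (intro sum.cong refl sum.remove fin)
  then have "perm_avg n (\<lambda>\<pi>. w \<pi> * (\<Sum>i\<in>I. h (\<pi> i))\<^sup>2) =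
      (\<Sum>i\<in>I. perm_avg n (\<lambda>\<pi>. w \<pi> * (h (\<pi> i))\<^sup>2) + (\<Sum>j\<in>I - {i}. perm_avg n (\<lambda>\<pi>. w \<pi> * (h (\<pi> i) * h (\<pi> j)))))"
    by (simp add: sum_distrib_left distrib_left perm_avg_sum perm_avg_add)
  also have "\<dots> = (\<Sum>i\<in>I. ?a + (\<Sum>j\<in>I - {i}. ?b))"
  proof (intro sum.cong arg_cong2[of _ _ _ _ "(+)"] refl)
    fix i assume "i \<in> I"
    then show "perm_avg n (\<lambda>\<pi>. w \<pi> * (h (\<pi> i))\<^sup>2) = ?a"
      using I n by (intro perm_avg_swap[OF w, of _ _ _ "\<lambda>x. (h x)\<^sup>2"]) auto
  next
    fix i j assume "i \<in> I" "j \<in> I - {i}"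
    then show "perm_avg n (\<lambda>\<pi>. w \<pi> * (h (\<pi> i) * h (\<pi> j))) = ?b"
      using I n by (intro perm_avg_swap_pair[OF w]) auto
  qed
  also have "\<dots> = (\<Sum>i\<in>I. ?a + (real (card I) - 1) * ?b)"
  proof (intro sum.cong refl)
    fix i assume i: "i \<in> I"
    then have "card I > 0" using fin card_gt_0_iff by blast
    then show "?a + (\<Sum>j\<in>I - {i}. ?b) = ?a + (real (card I) - 1) * ?b"
      using i fin by (simp add: card_Diff_singleton of_nat_diff)
  qed
  finally show ?thesis by (simp add: algebra_simps)
qed

text \<open>The off-diagonal term \<open>b\<close> is found by applying the identity to the whole
  tail: R = N a + N (N - 1) b. There R is accessible, since the tail sum is a function of the past.
  Discarding the negative contribution of \<open>a\<close> to \<open>b\<close> leaves the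
  bound.\<close>

lemma perm_avg_square_sum_le:
  fixes h :: "nat \<Rightarrow> real"
  assumes w: "determined_by_first k w" "\<And>\<pi>. w \<pi> \<ge> 0" and I: "I \<subseteq> {k..<n}" and n: "n - k \<ge> 2"
  shows "perm_avg n (\<lambda>\<pi>. w \<pi> * (\<Sum>i\<in>I. h (\<pi> i))\<^sup>2) \<le>
     real (card I) / real (n - k) * (perm_avg n w * (\<Sum>j<n. (h j)\<^sup>2))
     + (real (card I) / real (n - k))\<^sup>2 * perm_avg n (\<lambda>\<pi>. w \<pi> * (\<Sum>j\<in>{k..<n}. h (\<pi> j))\<^sup>2)"
proof -
  define a b where "a = perm_avg n (\<lambda>\<pi>. w \<pi> * (h (\<pi> k))\<^sup>2)"
    and "b = perm_avg n (\<lambda>\<pi>. w \<pi> * (h (\<pi> k) * h (\<pi> (Suc k))))"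
  define R where "R = perm_avg n (\<lambda>\<pi>. w \<pi> * (\<Sum>j\<in>{k..<n}. h (\<pi> j))\<^sup>2)"
  define L N where "L = real (card I)" and "N = real (n - k)"
  have "card I \<le> n - k" using card_mono[OF _ I] by simp
  then have L: "L \<le> N" "N \<ge> 2" and L': "L = 0 \<or> L \<ge> 1" using n by (auto simp: L_def N_def)
  have a0: "a \<ge> 0" unfolding a_def by (intro perm_avg_nonneg) (simp add: w)
  have eq: "R = N * a + N * (N - 1) * b"
    unfolding R_def a_def b_def N_def using perm_avg_square_sum[OF w(1) order_refl n] by simp
  \<comment> \<open>This uses that \<open>L\<close> is a natural number: the product is negative
    strictly between 0 and 1.\<close>
  have L1: "L * (L - 1) \<ge> 0" using L' by auto
  have R0: "R \<ge> 0" unfolding R_def by (intro perm_avg_nonneg) (simp add: w)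
  have Na: "N * a \<le> perm_avg n w * (\<Sum>j<n. (h j)\<^sup>2)"
  proof -
    have "N * a = perm_avg n (\<lambda>\<pi>. w \<pi> * (\<Sum>j\<in>{k..<n}. (h (\<pi> j))\<^sup>2))"
      unfolding N_def a_def using perm_avg_next[OF w(1), of k n "\<lambda>x. (h x)\<^sup>2"] n by simp
    also have "\<dots> \<le> perm_avg n (\<lambda>\<pi>. w \<pi> * (\<Sum>j<n. (h j)\<^sup>2))"
    proof (intro perm_avg_mono mult_left_mono w)
      fix \<pi> assume "\<pi> permutes {..<n}"
      then show "(\<Sum>j\<in>{k..<n}. (h (\<pi> j))\<^sup>2) \<le> (\<Sum>j<n. (h j)\<^sup>2)"
        using perm_tail_sum[of \<pi> n k "\<lambda>x. (h x)\<^sup>2"] n by (simp add: sum_nonneg)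
    qed
    finally show ?thesis by (simp add: perm_avg_mult_right)
  qed
  have "b = (R - N * a) / (N * (N - 1))" using eq L by (simp add: field_simps)
  also have "\<dots> \<le> R / (N * (N - 1))" using L a0 by (intro divide_right_mono) auto
  finally have "L * a + L * (L - 1) * b \<le> L * a + L * (L - 1) * (R / (N * (N - 1)))"
    using L1 by (intro add_left_mono mult_left_mono)
  also have "\<dots> \<le> L / N * (perm_avg n w * (\<Sum>j<n. (h j)\<^sup>2)) + (L / N)\<^sup>2 * R"
  proof (intro add_mono)
    have "L / N * (N * a) \<le> L / N * (perm_avg n w * (\<Sum>j<n. (h j)\<^sup>2))"
      using L by (intro mult_left_mono Na) (auto simp: L_def)
    then show "L * a \<le> L / N * (perm_avg n w * (\<Sum>j<n. (h j)\<^sup>2))" using L by simp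
    have "L * (L - 1) / (N * (N - 1)) \<le> (L / N)\<^sup>2"
    proof -
      have "L * ((L - 1) * N) \<le> L * (L * (N - 1))"
        using L L' by (intro mult_left_mono) (auto simp: algebra_simps)
      then have "L * (L - 1) * (N * N) \<le> L * L * (N * (N - 1))"
        using L mult_left_mono[of "L * ((L - 1) * N)" "L * (L * (N - 1))" N] by (simp add: algebra_simps)
      then show ?thesis using L by (simp add: power2_eq_square field_simps)
    qed
    from mult_right_mono[OF this R0]
    show "L * (L - 1) * (R / (N * (N - 1))) \<le> (L / N)\<^sup>2 * R" by simp
  qed
  finally show ?thesis
    unfolding perm_avg_square_sum[OF w(1) I n] a_def b_def R_def L_def N_def .
qed

section \<open>Characteristic functions of increments\<close>

text \<open>Taylor's bound is cubic for small and quadratic for large arguments. The minimum of both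
  is what a Lindeberg condition controls without third moments; the sharper constant 1/6 is given up
  to have one formula.\<close>

lemma iexp_second_order:
  fixes y :: real
  shows "cmod (iexp y - 1 - \<i> * y + y\<^sup>2 / 2) \<le> y\<^sup>2 * min 1 \<bar>y\<bar>"
proof -
  have sum: "(\<Sum>k\<le>2. (\<i> * complex_of_real y) ^ k / fact k) = 1 + \<i> * y - y\<^sup>2 / 2"
    by (simp add: numeral_2_eq_2 power2_eq_square field_simps)
  have "cmod (iexp y - (1 + \<i> * y - y\<^sup>2 / 2)) \<le> \<bar>y\<bar> ^ 3 / 6"
    using iexp_approx1[of y 2] unfolding sum by (simp add: numeral_3_eq_3 fact_numeral)
  also have "\<bar>y\<bar> ^ 3 = y\<^sup>2 * \<bar>y\<bar>"
    by (simp add: power3_eq_cube power2_eq_square)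
  also have "y\<^sup>2 * \<bar>y\<bar> / 6 \<le> y\<^sup>2 * \<bar>y\<bar>"
    using zero_le_mult_iff[of "y\<^sup>2" "\<bar>y\<bar>"] by simp
  finally have 1: "cmod (iexp y - (1 + \<i> * y - y\<^sup>2 / 2)) \<le> y\<^sup>2 * \<bar>y\<bar>" .
  have 2: "cmod (iexp y - (1 + \<i> * y - y\<^sup>2 / 2)) \<le> y\<^sup>2 * 1"
    using iexp_approx2[of y 2] unfolding sum by simp
  have eq: "iexp y - 1 - \<i> * y + y\<^sup>2 / 2 = iexp y - (1 + \<i> * y - y\<^sup>2 / 2)"
    by simp
  show ?thesis unfolding eq using 1 2 by (simp add: min_def)
qed

lemma exp_minus_first_order:
  fixes z :: real
  assumes "z \<ge> 0"
  shows "\<bar>exp (- z) - 1 + z\<bar> \<le> z\<^sup>2"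
proof (cases "z \<le> 1")
  case True
  have "exp (- z) \<ge> 1 - z" using exp_ge_add_one_self[of "-z"] by simp
  moreover have "exp (- z) \<le> 1 - z + z\<^sup>2"
  proof -
    have "exp (- z) * exp z = 1" by (simp flip: exp_add)
    \<comment> \<open>By this identity the product is at least 1 = exp (- z) * exp z, and replacing
      1 + z by exp z only enlarges it.\<close>
    moreover have "(1 - z + z\<^sup>2) * (1 + z) = 1 + z ^ 3"
      by (simp add: algebra_simps power2_eq_square power3_eq_cube)
    moreover have "(1 - z + z\<^sup>2) * (1 + z) \<le> (1 - z + z\<^sup>2) * exp z"
      using True assms exp_ge_add_one_self[of z] by (intro mult_left_mono) auto
    ultimately have "exp (- z) * exp z \<le> (1 - z + z\<^sup>2) * exp z"
      using assms zero_le_power[of z 3] by linarith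
    then show ?thesis by simp
  qed
  ultimately show ?thesis by linarith
next
  case False
  then have "z \<le> z\<^sup>2" by (simp add: power2_eq_square)
  moreover have "exp (- z) \<le> 1" "exp (- z) > 0" using assms by simp_all
  ultimately show ?thesis using False by linarith
qed

definition energy :: "nat \<Rightarrow> (nat \<Rightarrow> real) \<Rightarrow> real" where
  "energy n x = (\<Sum>j<n. (x j)\<^sup>2)"

text \<open>A Lindeberg sum in which min 1 (\<bar>x\<bar> / c) replaces the indicator of
  \<bar>x\<bar> > \<epsilon> c; it matches the Taylor remainder at scale c.\<close>

definition truncated_energy :: "nat \<Rightarrow> (nat \<Rightarrow> real) \<Rightarrow> real \<Rightarrow> real" where
  "truncated_energy n x c = (\<Sum>j<n. (x j)\<^sup>2 * min 1 (\<bar>x j\<bar> / c))"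

definition partial_sum :: "(nat \<Rightarrow> real) \<Rightarrow> (nat \<Rightarrow> nat) \<Rightarrow> nat \<Rightarrow> real" where
  "partial_sum x \<pi> k = (\<Sum>j<k. x (\<pi> j))"

text \<open>Four sources in order: the Taylor remainder, the mean of the remaining entries, the
  deviation of their second moment from \<open>s\<close> after at most \<open>b\<close> removals,
  and the replacement of 1 - z by exp (- z) with z = (u / c)^2 s / 2. The factor 2 / n bounds 1 / (n
  - k) for k \<le> n / 2.\<close>

definition step_error :: "nat \<Rightarrow> (nat \<Rightarrow> real) \<Rightarrow> real \<Rightarrow> real \<Rightarrow> nat \<Rightarrow> real \<Rightarrow> real" where
  "step_error n x c s b u =
     2 / real n * ((1 + \<bar>u\<bar>) * (u / c)\<^sup>2 * truncated_energy n x c + \<bar>u / c\<bar> * sqrt (energy n x + c\<^sup>2)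
       + (u / c)\<^sup>2 / 2 * (\<bar>energy n x - real n * s\<bar> + real b * (energy n x / real n + s))) + ((u / c)\<^sup>2 * s / 2)\<^sup>2"

lemma energy_nonneg: "energy n x \<ge> 0"
  by (simp add: energy_def sum_nonneg)

locale population =
  fixes n :: nat and x :: "nat \<Rightarrow> real" and c :: real
  assumes c_pos: "c > 0" and total: "(\<Sum>j<n. x j) = - c"
begin

lemma truncated_energy_nonneg: "truncated_energy n x c \<ge> 0"
  unfolding truncated_energy_def using c_pos by (intro sum_nonneg mult_nonneg_nonneg) auto

text \<open>The total of all entries is the constant - c, so the second moment of a tail is at most
  energy plus c^2. The first moment follows from \<bar>z\<bar> \<le> z^2 / (2 r) + r / 2, which
  stands in for the Cauchy-Schwarz inequality.\<close>

lemma perm_avg_tail_abs: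
  assumes "k \<le> n" "n \<ge> 2"
  shows "perm_avg n (\<lambda>\<pi>. \<bar>\<Sum>j\<in>{k..<n}. x (\<pi> j)\<bar>) \<le> sqrt (energy n x + c\<^sup>2)"
proof -
  define r where "r = sqrt (energy n x + c\<^sup>2)"
  have r: "r > 0" "r\<^sup>2 = energy n x + c\<^sup>2"
    using energy_nonneg c_pos by (auto simp: r_def add_nonneg_pos)
  \<comment> \<open>The bound is used with empty past and weight 1, the tail being viewed as a
    sample from all positions.\<close>
  have "perm_avg n (\<lambda>\<pi>. 1 * (\<Sum>i\<in>{k..<n}. x (\<pi> i))\<^sup>2)
      \<le> real (card {k..<n}) / real (n - 0) * (perm_avg n (\<lambda>_. 1) * energy n x)
       + (real (card {k..<n}) / real (n - 0))\<^sup>2 * perm_avg n (\<lambda>\<pi>. 1 * (\<Sum>j\<in>{0..<n}. x (\<pi> j))\<^sup>2)"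
    unfolding energy_def using assms by (intro perm_avg_square_sum_le) auto
  also have "perm_avg n (\<lambda>\<pi>. 1 * (\<Sum>j\<in>{0..<n}. x (\<pi> j))\<^sup>2) = c\<^sup>2"
  proof -
    have "perm_avg n (\<lambda>\<pi>. 1 * (\<Sum>j\<in>{0..<n}. x (\<pi> j))\<^sup>2) = perm_avg n (\<lambda>_. c\<^sup>2)"
      using perm_tail_sum[of _ n 0 x] total by (intro perm_avg_cong) auto
    then show ?thesis by simp
  qed
  also have "real (card {k..<n}) / real (n - 0) * (perm_avg n (\<lambda>_. 1) * energy n x) + (real (card {k..<n}) / real (n - 0))\<^sup>2 * c\<^sup>2
      \<le> 1 * energy n x + 1 * c\<^sup>2"
    using assms energy_nonneg
    by (intro add_mono mult_mono power_le_one) (auto simp: divide_le_eq)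
  finally have sq: "perm_avg n (\<lambda>\<pi>. (\<Sum>i\<in>{k..<n}. x (\<pi> i))\<^sup>2) \<le> r\<^sup>2"
    using r by simp
  have "\<bar>z\<bar> \<le> z\<^sup>2 * (1 / (2 * r)) + r / 2" for z :: real
  proof -
    have "2 * (\<bar>z\<bar> * r) \<le> z\<^sup>2 + r\<^sup>2"
      using sum_squares_bound[of "\<bar>z\<bar>" r] by simp
    then show ?thesis using r(1) by (simp add: field_simps power2_eq_square)
  qed
  then have "perm_avg n (\<lambda>\<pi>. \<bar>\<Sum>j\<in>{k..<n}. x (\<pi> j)\<bar>) \<le>
      perm_avg n (\<lambda>\<pi>. (\<Sum>j\<in>{k..<n}. x (\<pi> j))\<^sup>2 * (1 / (2 * r)) + r / 2)"
    by (intro perm_avg_mono)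
  also have "\<dots> = perm_avg n (\<lambda>\<pi>. (\<Sum>j\<in>{k..<n}. x (\<pi> j))\<^sup>2) * (1 / (2 * r)) + r / 2"
    unfolding perm_avg_add perm_avg_mult_right by simp
  also have "\<dots> \<le> r\<^sup>2 * (1 / (2 * r)) + r / 2"
    using sq r by (intro add_mono mult_right_mono) auto
  also have "\<dots> = r" using r(1) by (simp add: power2_eq_square)
  finally show ?thesis by (simp add: r_def)
qed

text \<open>A used entry has mean square energy / n, so \<open>k\<close> removals shift the sum of
  squares by k * energy / n on average, and the target by k * s.\<close>

lemma perm_avg_tail_square:
  assumes "k \<le> n" "n > 0" "s \<ge> 0"
  shows "perm_avg n (\<lambda>\<pi>. \<bar>(\<Sum>j\<in>{k..<n}. (x (\<pi> j))\<^sup>2) - real (n - k) * s\<bar>)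
    \<le> \<bar>energy n x - real n * s\<bar> + real k * (energy n x / real n + s)"
proof -
  have pt: "\<bar>(\<Sum>j\<in>{k..<n}. (x (\<pi> j))\<^sup>2) - real (n - k) * s\<bar>
      \<le> (\<bar>energy n x - real n * s\<bar> + real k * s) + (\<Sum>j<k. (x (\<pi> j))\<^sup>2)" if "\<pi> permutes {..<n}" for \<pi>
  proof -
    have eq: "(\<Sum>j\<in>{k..<n}. (x (\<pi> j))\<^sup>2) = energy n x - (\<Sum>j<k. (x (\<pi> j))\<^sup>2)"
      unfolding energy_def using perm_tail_sum[OF that assms(1), of "\<lambda>i. (x i)\<^sup>2"] by simp
    have "real (n - k) * s = real n * s - real k * s"
      using assms by (simp add: of_nat_diff left_diff_distrib)
    moreover have "(\<Sum>j<k. (x (\<pi> j))\<^sup>2) \<ge> 0" "real k * s \<ge> 0"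
      using assms by (auto intro: sum_nonneg)
    ultimately show ?thesis unfolding eq by linarith
  qed
  have one: "perm_avg n (\<lambda>\<pi>. (x (\<pi> j))\<^sup>2) = energy n x / real n" if "j < k" for j
  proof -
    have "real n * perm_avg n (\<lambda>\<pi>. (x (\<pi> j))\<^sup>2) = perm_avg n (\<lambda>\<pi>. \<Sum>j\<in>{0..<n}. (x (\<pi> j))\<^sup>2)"
      using perm_avg_next[of 0 "\<lambda>_. 1" j n "\<lambda>i. (x i)\<^sup>2"] that assms by simp
    also have "\<dots> = perm_avg n (\<lambda>_. energy n x)"
      unfolding energy_def by (intro perm_avg_cong) (use perm_tail_sum[of _ n 0 "\<lambda>i. (x i)\<^sup>2"] in simp)
    finally show ?thesis using assms by (simp add: field_simps)
  qed
  have "perm_avg n (\<lambda>\<pi>. \<bar>(\<Sum>j\<in>{k..<n}. (x (\<pi> j))\<^sup>2) - real (n - k) * s\<bar>)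
     \<le> perm_avg n (\<lambda>\<pi>. (\<bar>energy n x - real n * s\<bar> + real k * s) + (\<Sum>j<k. (x (\<pi> j))\<^sup>2))"
    by (intro perm_avg_mono pt)
  also have "\<dots> = \<bar>energy n x - real n * s\<bar> + real k * s + (\<Sum>j<k. energy n x / real n)"
    unfolding perm_avg_add perm_avg_sum using one by simp
  finally show ?thesis by (simp add: distrib_left)
qed

text \<open>Averaging the next step over the unseen entries gives \<open>A\<close>, the empirical
  characteristic function of the remaining population. It is compared with \<open>q\<close> for each
  permutation separately; the average comes afterwards, since the drift and variance errors are
  small only in mean.\<close>

lemma iexp_step:
  fixes w :: "(nat \<Rightarrow> nat) \<Rightarrow> complex" and u s :: real
  defines "q \<equiv> exp (- ((u / c)\<^sup>2 * s / 2))"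
  assumes w: "determined_by_first k w" "\<And>\<pi>. cmod (w \<pi>) \<le> D"
    and k: "k < b" "2 * b \<le> n" and s: "s \<ge> 0"
  shows "cmod (perm_avg n (\<lambda>\<pi>. w \<pi> * iexp (u / c * x (\<pi> k))) - q * perm_avg n w) \<le> D * step_error n x c s b u"
proof -
  define \<theta> where "\<theta> = u / c"
  define N where "N = real (n - k)"
  have n: "n \<ge> 2" "k < n" and N: "N > 0" "2 / real n \<ge> 1 / N"
    using k by (auto simp: N_def field_simps of_nat_diff)
  have D: "D \<ge> 0" using w(2) norm_ge_zero order_trans by blast
  define \<psi> where "\<psi> = (\<lambda>y. cmod (iexp (\<theta> * y) - 1 - \<i> * (\<theta> * y) + (\<theta> * y)\<^sup>2 / 2))"
  have \<psi>: "\<psi> (x j) \<le> (1 + \<bar>u\<bar>) * \<theta>\<^sup>2 * ((x j)\<^sup>2 * min 1 (\<bar>x j\<bar> / c))" for j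
  proof -
    have "\<psi> (x j) \<le> (\<theta> * x j)\<^sup>2 * min 1 \<bar>\<theta> * x j\<bar>"
      unfolding \<psi>_def using iexp_second_order[of "\<theta> * x j"] by simp
    \<comment> \<open>This removes \<open>u\<close> from the truncation, so that one Lindeberg
      condition serves every frequency.\<close>
    also have "min 1 \<bar>\<theta> * x j\<bar> \<le> (1 + \<bar>u\<bar>) * min 1 (\<bar>x j\<bar> / c)"
    proof -
      have "\<bar>\<theta> * x j\<bar> = \<bar>u\<bar> * (\<bar>x j\<bar> / c)"
        using c_pos by (simp add: \<theta>_def abs_mult)
      moreover have "\<bar>u\<bar> * (\<bar>x j\<bar> / c) \<le> (1 + \<bar>u\<bar>) * (\<bar>x j\<bar> / c)"
        using c_pos by (intro mult_right_mono) auto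
      ultimately show ?thesis
        by (cases "\<bar>x j\<bar> / c \<ge> 1") (simp_all add: min_le_iff_disj)
    qed
    finally have "\<psi> (x j) \<le> (\<theta> * x j)\<^sup>2 * ((1 + \<bar>u\<bar>) * min 1 (\<bar>x j\<bar> / c))"
      by (simp add: mult_left_mono)
    then show ?thesis by (simp add: power_mult_distrib mult_ac)
  qed
  define A where "A = (\<lambda>\<pi>. (\<Sum>j\<in>{k..<n}. iexp (\<theta> * x (\<pi> j))) / N)"
  have pt: "cmod (A \<pi> - q) \<le> 1 / N * ((1 + \<bar>u\<bar>) * \<theta>\<^sup>2 * truncated_energy n x c + \<bar>\<theta>\<bar> * \<bar>\<Sum>j\<in>{k..<n}. x (\<pi> j)\<bar>
       + \<theta>\<^sup>2 / 2 * \<bar>(\<Sum>j\<in>{k..<n}. (x (\<pi> j))\<^sup>2) - N * s\<bar>) + (\<theta>\<^sup>2 * s / 2)\<^sup>2"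
    if \<pi>: "\<pi> permutes {..<n}" for \<pi>
  proof -
    define P1 where "P1 = (\<Sum>j\<in>{k..<n}. iexp (\<theta> * x (\<pi> j)) - 1 - \<i> * (\<theta> * x (\<pi> j)) + (\<theta> * x (\<pi> j))\<^sup>2 / 2)"
    define P2 where "P2 = (\<Sum>j\<in>{k..<n}. x (\<pi> j))"
    define P3 where "P3 = (\<Sum>j\<in>{k..<n}. (x (\<pi> j))\<^sup>2) - N * s"
    have N': "N = (\<Sum>j\<in>{k..<n}. 1)" by (simp add: N_def)
    have eq: "(\<Sum>j\<in>{k..<n}. iexp (\<theta> * x (\<pi> j))) = P1 + complex_of_real N + \<i> * \<theta> * P2 - \<theta>\<^sup>2 / 2 * (P3 + N * s)"
      unfolding P1_def P2_def P3_def
      by (simp add: sum.distrib sum_subtractf sum_distrib_left sum_divide_distrib power_mult_distrib N_def mult.assoc)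
    have "A \<pi> - q = complex_of_real (1 / N) * (P1 + \<i> * \<theta> * P2 - complex_of_real (\<theta>\<^sup>2 / 2 * P3))
        - complex_of_real (q - 1 + \<theta>\<^sup>2 * s / 2)"
      unfolding A_def eq using N(1) by (simp add: field_simps)
    also have "cmod \<dots> \<le> 1 / N * (cmod P1 + \<bar>\<theta>\<bar> * \<bar>P2\<bar> + \<theta>\<^sup>2 / 2 * \<bar>P3\<bar>) + \<bar>q - 1 + \<theta>\<^sup>2 * s / 2\<bar>"
    proof (rule order_trans[OF norm_triangle_ineq4], intro add_mono)
      have "cmod (P1 + \<i> * \<theta> * P2 - complex_of_real (\<theta>\<^sup>2 / 2 * P3)) \<le> cmod P1 + \<bar>\<theta>\<bar> * \<bar>P2\<bar> + \<theta>\<^sup>2 / 2 * \<bar>P3\<bar>"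
      proof (rule order_trans[OF norm_triangle_ineq4], intro add_mono)
        show "cmod (P1 + \<i> * \<theta> * P2) \<le> cmod P1 + \<bar>\<theta>\<bar> * \<bar>P2\<bar>"
          by (rule order_trans[OF norm_triangle_ineq]) (simp add: norm_mult)
        show "cmod (complex_of_real (\<theta>\<^sup>2 / 2 * P3)) \<le> \<theta>\<^sup>2 / 2 * \<bar>P3\<bar>"
          unfolding norm_of_real by (simp add: abs_mult)
      qed
      then show "cmod (complex_of_real (1 / N) * (P1 + \<i> * \<theta> * P2 - complex_of_real (\<theta>\<^sup>2 / 2 * P3)))
          \<le> 1 / N * (cmod P1 + \<bar>\<theta>\<bar> * \<bar>P2\<bar> + \<theta>\<^sup>2 / 2 * \<bar>P3\<bar>)"
        unfolding norm_mult norm_of_real using N(1) by (simp add: divide_right_mono)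
      show "cmod (complex_of_real (q - 1 + \<theta>\<^sup>2 * s / 2)) \<le> \<bar>q - 1 + \<theta>\<^sup>2 * s / 2\<bar>"
        unfolding norm_of_real by simp
    qed
    also have "\<dots> \<le> 1 / N * ((1 + \<bar>u\<bar>) * \<theta>\<^sup>2 * truncated_energy n x c + \<bar>\<theta>\<bar> * \<bar>P2\<bar> + \<theta>\<^sup>2 / 2 * \<bar>P3\<bar>) + (\<theta>\<^sup>2 * s / 2)\<^sup>2"
    proof (intro add_mono mult_left_mono order_refl)
      have "cmod P1 \<le> (\<Sum>j\<in>{k..<n}. \<psi> (x (\<pi> j)))"
        unfolding P1_def \<psi>_def by (rule norm_sum)
      \<comment> \<open>The remainders are nonnegative, so the sum may be extended to all entries,
        where it no longer depends on the permutation.\<close>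
      also have "\<dots> \<le> (\<Sum>j<n. \<psi> (x (\<pi> j)))"
        by (intro sum_mono2) (auto simp: \<psi>_def)
      also have "\<dots> = (\<Sum>j<n. \<psi> (x j))"
        using sum.permute[OF \<pi>, of "\<lambda>j. \<psi> (x j)"] by (simp add: comp_def)
      also have "\<dots> \<le> (\<Sum>j<n. (1 + \<bar>u\<bar>) * \<theta>\<^sup>2 * ((x j)\<^sup>2 * min 1 (\<bar>x j\<bar> / c)))"
        by (intro sum_mono \<psi>)
      finally show "cmod P1 \<le> (1 + \<bar>u\<bar>) * \<theta>\<^sup>2 * truncated_energy n x c"
        by (simp add: truncated_energy_def sum_distrib_left)
      show "\<bar>q - 1 + \<theta>\<^sup>2 * s / 2\<bar> \<le> (\<theta>\<^sup>2 * s / 2)\<^sup>2"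
        unfolding q_def \<theta>_def[symmetric] using s by (intro exp_minus_first_order) auto
      show "0 \<le> 1 / N" using N by simp
    qed auto
    finally show ?thesis by (simp add: P2_def P3_def)
  qed
  have avg: "perm_avg n (\<lambda>\<pi>. w \<pi> * iexp (u / c * x (\<pi> k))) = perm_avg n (\<lambda>\<pi>. w \<pi> * A \<pi>)"
  proof -
    have "complex_of_nat (n - k) * perm_avg n (\<lambda>\<pi>. w \<pi> * iexp (\<theta> * x (\<pi> k))) 
        = perm_avg n (\<lambda>\<pi>. w \<pi> * (\<Sum>j\<in>{k..<n}. iexp (\<theta> * x (\<pi> j))))"
      using n by (intro perm_avg_next[OF w(1), of k n "\<lambda>i. iexp (\<theta> * x i)"]) auto
    then have "perm_avg n (\<lambda>\<pi>. w \<pi> * iexp (\<theta> * x (\<pi> k))) 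
        = perm_avg n (\<lambda>\<pi>. w \<pi> * (\<Sum>j\<in>{k..<n}. iexp (\<theta> * x (\<pi> j)))) * (1 / complex_of_real N)"
      using N(1) by (simp add: N_def field_simps)
    then show ?thesis
      unfolding perm_avg_mult_right[symmetric] by (simp add: A_def \<theta>_def)
  qed
  have "cmod (perm_avg n (\<lambda>\<pi>. w \<pi> * iexp (u / c * x (\<pi> k))) - q * perm_avg n w)
      = cmod (perm_avg n (\<lambda>\<pi>. w \<pi> * (A \<pi> - q)))"
    unfolding avg right_diff_distrib perm_avg_diff perm_avg_mult_right by (simp add: mult.commute)
  also have "\<dots> \<le> perm_avg n (\<lambda>\<pi>. cmod (w \<pi> * (A \<pi> - q)))"
    by (rule norm_perm_avg)
  also have "\<dots> \<le> perm_avg n (\<lambda>\<pi>. D * (1 / N * ((1 + \<bar>u\<bar>) * \<theta>\<^sup>2 * truncated_energy n x c + \<bar>\<theta>\<bar> * \<bar>\<Sum>j\<in>{k..<n}. x (\<pi> j)\<bar>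
       + \<theta>\<^sup>2 / 2 * \<bar>(\<Sum>j\<in>{k..<n}. (x (\<pi> j))\<^sup>2) - N * s\<bar>) + (\<theta>\<^sup>2 * s / 2)\<^sup>2))"
    unfolding norm_mult by (intro perm_avg_mono mult_mono w pt D norm_ge_zero)
  also have "\<dots> = D * (1 / N * ((1 + \<bar>u\<bar>) * \<theta>\<^sup>2 * truncated_energy n x c + \<bar>\<theta>\<bar> * perm_avg n (\<lambda>\<pi>. \<bar>\<Sum>j\<in>{k..<n}. x (\<pi> j)\<bar>)
       + \<theta>\<^sup>2 / 2 * perm_avg n (\<lambda>\<pi>. \<bar>(\<Sum>j\<in>{k..<n}. (x (\<pi> j))\<^sup>2) - N * s\<bar>)) + (\<theta>\<^sup>2 * s / 2)\<^sup>2)"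
    unfolding perm_avg_mult_left perm_avg_add by simp
  also have "\<dots> \<le> D * step_error n x c s b u"
    unfolding step_error_def \<theta>_def[symmetric]
  proof (intro mult_left_mono[OF _ D] add_mono[OF _ order_refl] mult_mono)
    show "1 / N \<le> 2 / real n" using N by simp
    show "(1 + \<bar>u\<bar>) * \<theta>\<^sup>2 * truncated_energy n x c + \<bar>\<theta>\<bar> * perm_avg n (\<lambda>\<pi>. \<bar>\<Sum>j\<in>{k..<n}. x (\<pi> j)\<bar>)
       + \<theta>\<^sup>2 / 2 * perm_avg n (\<lambda>\<pi>. \<bar>(\<Sum>j\<in>{k..<n}. (x (\<pi> j))\<^sup>2) - N * s\<bar>)
      \<le> (1 + \<bar>u\<bar>) * \<theta>\<^sup>2 * truncated_energy n x c + \<bar>\<theta>\<bar> * sqrt (energy n x + c\<^sup>2)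
       + \<theta>\<^sup>2 / 2 * (\<bar>energy n x - real n * s\<bar> + real b * (energy n x / real n + s))"
    proof (intro add_mono mult_left_mono order_refl)
      show "perm_avg n (\<lambda>\<pi>. \<bar>\<Sum>j\<in>{k..<n}. x (\<pi> j)\<bar>) \<le> sqrt (energy n x + c\<^sup>2)"
        using n by (intro perm_avg_tail_abs) auto
      have "perm_avg n (\<lambda>\<pi>. \<bar>(\<Sum>j\<in>{k..<n}. (x (\<pi> j))\<^sup>2) - N * s\<bar>)
          \<le> \<bar>energy n x - real n * s\<bar> + real k * (energy n x / real n + s)"
        unfolding N_def using n s by (intro perm_avg_tail_square) auto
      also have "\<dots> \<le> \<bar>energy n x - real n * s\<bar> + real b * (energy n x / real n + s)"
        using k s energy_nonneg by (intro add_left_mono mult_right_mono) auto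
      finally show "perm_avg n (\<lambda>\<pi>. \<bar>(\<Sum>j\<in>{k..<n}. (x (\<pi> j))\<^sup>2) - N * s\<bar>)
          \<le> \<bar>energy n x - real n * s\<bar> + real b * (energy n x / real n + s)" .
    qed auto
    show "0 \<le> 2 / real n" by simp
    show "0 \<le> (1 + \<bar>u\<bar>) * \<theta>\<^sup>2 * truncated_energy n x c + \<bar>\<theta>\<bar> * perm_avg n (\<lambda>\<pi>. \<bar>\<Sum>j\<in>{k..<n}. x (\<pi> j)\<bar>)
       + \<theta>\<^sup>2 / 2 * perm_avg n (\<lambda>\<pi>. \<bar>(\<Sum>j\<in>{k..<n}. (x (\<pi> j))\<^sup>2) - N * s\<bar>)"
      using truncated_energy_nonneg by (intro add_nonneg_nonneg mult_nonneg_nonneg perm_avg_nonneg) auto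
  qed
  finally show ?thesis .
qed

text \<open>The steps are peeled off one at a time. Exponentials of earlier steps have modulus 1 and
  join the weight without enlarging \<open>D\<close>, and since 0 \<le> q \<le> 1 the errors merely
  add up.\<close>

lemma iexp_increment:
  fixes w :: "(nat \<Rightarrow> nat) \<Rightarrow> complex" and u s :: real
  assumes w: "determined_by_first a w" "\<And>\<pi>. cmod (w \<pi>) \<le> D"
    and ab: "a \<le> b" "2 * b \<le> n" and s: "s \<ge> 0"
  shows "cmod (perm_avg n (\<lambda>\<pi>. w \<pi> * iexp (u / c * (partial_sum x \<pi> b - partial_sum x \<pi> a)))
      - exp (- (real (b - a) * ((u / c)\<^sup>2 * s / 2))) * perm_avg n w) \<le> real (b - a) * (D * step_error n x c s b u)"
proof -
  define q where "q = exp (- ((u / c)\<^sup>2 * s / 2))"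
  have q: "0 \<le> q" "q \<le> 1" using s by (auto simp: q_def)
  define W where "W = (\<lambda>i \<pi>. w \<pi> * iexp (u / c * (partial_sum x \<pi> (a + i) - partial_sum x \<pi> a)))"
  have "cmod (perm_avg n (W i) - q ^ i * perm_avg n w) \<le> real i * (D * step_error n x c s b u)" if "a + i \<le> b" for i
    using that
  proof (induction i)
    case 0
    then show ?case by (simp add: W_def)
  next
    case (Suc i)
    have past: "determined_by_first (a + i) (W i)"
      unfolding determined_by_first_def W_def partial_sum_def
      by (auto intro!: arg_cong2[of _ _ _ _ "(*)"] determined_by_firstD[OF w(1)] arg_cong[of _ _ iexp] sum.cong
          arg_cong2[of _ _ _ _ "(-)"])
    have bound: "cmod (W i \<pi>) \<le> D" for \<pi>
      unfolding W_def norm_mult using w(2) by simp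
    have "W (Suc i) = (\<lambda>\<pi>. W i \<pi> * iexp (u / c * x (\<pi> (a + i))))"
      by (simp add: W_def partial_sum_def fun_eq_iff exp_add[symmetric] algebra_simps add_divide_distrib)
    then have step: "cmod (perm_avg n (W (Suc i)) - q * perm_avg n (W i)) \<le> D * step_error n x c s b u"
      using iexp_step[OF past bound, of b s u] Suc.prems ab s by (simp add: q_def)
    have "perm_avg n (W (Suc i)) - q ^ Suc i * perm_avg n w
        = (perm_avg n (W (Suc i)) - q * perm_avg n (W i)) + q * (perm_avg n (W i) - q ^ i * perm_avg n w)"
      by (simp add: algebra_simps)
    also have "cmod \<dots> \<le> D * step_error n x c s b u + 1 * (real i * (D * step_error n x c s b u))"
      using Suc step q unfolding norm_mult
      by (intro order_trans[OF norm_triangle_ineq] add_mono) (auto simp: norm_mult intro!: mult_mono[of q 1, simplified])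
    finally show ?case by (simp add: algebra_simps)
  qed
  from this[of "b - a"] have "cmod (perm_avg n (W (b - a)) - q ^ (b - a) * perm_avg n w) \<le> real (b - a) * (D * step_error n x c s b u)"
    using ab by simp
  moreover have "q ^ (b - a) = exp (- (real (b - a) * ((u / c)\<^sup>2 * s / 2)))"
    by (simp add: q_def flip: exp_of_nat_mult)
  ultimately show ?thesis using ab by (simp add: W_def)
qed

end

section \<open>Finite-dimensional limits of the walk\<close>

text \<open>As an image of the standard normal law it includes v = 0, the point mass at 0, which has
  no density.\<close>

definition centered_gaussian :: "real \<Rightarrow> real measure" where
  "centered_gaussian v = distr std_normal_distribution borel (\<lambda>z. sqrt v * z)"

lemma real_distribution_centered_gaussian: "real_distribution (centered_gaussian v)"
proof -
  interpret real_distribution std_normal_distribution by (rule real_dist_normal_dist)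
  show ?thesis
    unfolding centered_gaussian_def by (intro real_distribution_distr) simp
qed

lemma integral_centered_gaussian:
  fixes h :: "real \<Rightarrow> 'a::{banach, second_countable_topology}"
  assumes "h \<in> borel_measurable borel"
  shows "integral\<^sup>L (centered_gaussian v) h = (\<integral>z. h (sqrt v * z) \<partial>std_normal_distribution)"
  unfolding centered_gaussian_def using assms by (subst integral_distr) auto

lemma char_centered_gaussian:
  assumes "v \<ge> 0"
  shows "char (centered_gaussian v) u = complex_of_real (exp (- (v * u\<^sup>2 / 2)))"
proof -
  have "char (centered_gaussian v) u = char std_normal_distribution (sqrt v * u)"
    unfolding char_def by (subst integral_centered_gaussian) (auto simp: mult_ac)
  also have "\<dots> = complex_of_real (exp (- (v * u\<^sup>2 / 2)))"
    unfolding char_std_normal_distribution using assms by (simp add: power_mult_distrib)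
  finally show ?thesis .
qed

text \<open>Normalised by its mass, \<open>v n\<close> defines a probability \<open>p n\<close> on
  permutations, and Levy's theorem applies to the law of \<open>Y n\<close> under it. The bounds 1
  and \<open>D\<close> keep the mass away from 0 and infinity. The masses themselves need not
  converge, hence the formulation with differences.\<close>

lemma weighted_perm_avg_tendsto:
  fixes v :: "nat \<Rightarrow> (nat \<Rightarrow> nat) \<Rightarrow> real" and Y :: "nat \<Rightarrow> (nat \<Rightarrow> nat) \<Rightarrow> real" and h :: "real \<Rightarrow> real"
  assumes v: "\<And>n \<pi>. 1 \<le> v n \<pi>" "\<And>n \<pi>. v n \<pi> \<le> D"
    and \<mu>: "real_distribution \<mu>"
    and char: "\<And>u. (\<lambda>n. perm_avg n (\<lambda>\<pi>. complex_of_real (v n \<pi>) * iexp (u * Y n \<pi>))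
        - complex_of_real (perm_avg n (v n)) * char \<mu> u) \<longlonglongrightarrow> 0"
    and h: "continuous_on UNIV h" "bounded (range h)"
  shows "(\<lambda>n. perm_avg n (\<lambda>\<pi>. v n \<pi> * h (Y n \<pi>)) - perm_avg n (v n) * integral\<^sup>L \<mu> h) \<longlonglongrightarrow> 0"
proof -
  define P where "P = (\<lambda>n. {\<pi>. \<pi> permutes {..<n::nat}})"
  define W where "W = (\<lambda>n. \<Sum>\<pi>\<in>P n. v n \<pi>)"
  define p where "p = (\<lambda>n. point_measure (P n) (\<lambda>\<pi>. ennreal (v n \<pi> / W n)))"
  define \<Q> where "\<Q> = (\<lambda>n. distr (p n) borel (Y n))"
  have avg1: "perm_avg n (v n) \<ge> 1" "perm_avg n (v n) \<le> D" for n
    using perm_avg_mono[of n "\<lambda>_. 1" "v n"] perm_avg_mono[of n "v n" "\<lambda>_. D"] v by auto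
  have avgW: "perm_avg n (v n) = W n / fact n" for n
    by (simp add: perm_avg_def W_def P_def divide_inverse mult.commute)
  have W: "W n > 0" for n
    using avg1(1)[of n] unfolding avgW by (smt (verit) divide_nonpos_pos fact_gt_zero)
  have v0: "0 \<le> v n \<pi>" for n \<pi>
    using v(1)[of n \<pi>] by linarith
  have p: "prob_space (p n)" for n
  proof -
    have "(\<Sum>\<pi>\<in>P n. v n \<pi> / W n) = 1"
      using W[of n] by (simp add: sum_divide_distrib[symmetric] W_def)
    moreover have "0 \<le> v n \<pi> / W n" for \<pi>
      using W[of n] v(1)[of n \<pi>] by simp
    ultimately show ?thesis
      unfolding p_def P_def
      by (intro prob_space_point_measure) (auto simp: P_def simp flip: ennreal_1)
  qed
  have meas: "Y n \<in> measurable (p n) borel" for n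
    by (auto simp: p_def measurable_def space_point_measure sets_point_measure)
  have \<Q>: "real_distribution (\<Q> n)" for n
  proof -
    interpret prob_space "p n" by (rule p)
    show ?thesis unfolding \<Q>_def by (intro real_distribution_distr meas)
  qed
  have int: "integral\<^sup>L (\<Q> n) g = perm_avg n (\<lambda>\<pi>. v n \<pi> *\<^sub>R g (Y n \<pi>)) /\<^sub>R perm_avg n (v n)"
    if "g \<in> borel_measurable borel" for n and g :: "real \<Rightarrow> 'b::{banach, second_countable_topology}"
  proof -
    have "integral\<^sup>L (\<Q> n) g = integral\<^sup>L (p n) (\<lambda>\<pi>. g (Y n \<pi>))"
      unfolding \<Q>_def using that meas by (subst integral_distr) auto
    also have "\<dots> = (\<Sum>\<pi>\<in>P n. (v n \<pi> / W n) *\<^sub>R g (Y n \<pi>))"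
      unfolding p_def using W[of n] v0
      by (intro lebesgue_integral_point_measure_finite) (auto simp: P_def intro!: divide_nonneg_pos)
    also have "\<dots> = perm_avg n (\<lambda>\<pi>. v n \<pi> *\<^sub>R g (Y n \<pi>)) /\<^sub>R perm_avg n (v n)"
      unfolding avgW by (simp add: perm_avg_def P_def scaleR_sum_right field_simps)
    finally show ?thesis .
  qed
  have "(\<lambda>n. char (\<Q> n) u) \<longlonglongrightarrow> char \<mu> u" for u
  proof (rule LIM_zero_cancel, rule Lim_null_comparison[OF _ tendsto_norm_zero[OF char[of u]]], rule always_eventually, rule allI)
    fix n
    define a where "a = perm_avg n (v n)"
    define b where "b = perm_avg n (\<lambda>\<pi>. complex_of_real (v n \<pi>) * iexp (u * Y n \<pi>))"
    have "char (\<Q> n) u = b / complex_of_real a"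
      unfolding char_def a_def b_def by (subst int) (auto simp: scaleR_conv_of_real field_simps)
    then have "char (\<Q> n) u - char \<mu> u = (b - complex_of_real a * char \<mu> u) / complex_of_real a"
      using avg1(1)[of n] by (simp add: a_def field_simps)
    then have "cmod (char (\<Q> n) u - char \<mu> u) = cmod (b - complex_of_real a * char \<mu> u) / a"
      using avg1(1)[of n] by (simp add: a_def norm_divide)
    also have "\<dots> \<le> cmod (b - complex_of_real a * char \<mu> u) / 1"
      using avg1(1)[of n] by (intro divide_left_mono) (auto simp: a_def)
    finally show "cmod (char (\<Q> n) u - char \<mu> u) \<le> cmod (b - complex_of_real a * char \<mu> u)" by simp
  qed
  then have "weak_conv_m \<Q> \<mu>"
    by (intro levy_continuity \<Q> \<mu>)
  moreover obtain B where "\<And>y. norm (h y) \<le> B"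
    using h(2) by (auto simp: bounded_iff)
  ultimately have "(\<lambda>n. integral\<^sup>L (\<Q> n) h) \<longlonglongrightarrow> integral\<^sup>L \<mu> h"
    using h(1) by (intro weak_conv_imp_integral_bdd_continuous_conv[OF \<Q> \<mu>]) (auto simp: continuous_on_eq_continuous_at)
  then have lim: "(\<lambda>n. D * norm (integral\<^sup>L (\<Q> n) h - integral\<^sup>L \<mu> h)) \<longlonglongrightarrow> 0"
    by (intro tendsto_mult_right_zero tendsto_norm_zero) (simp add: LIM_zero_iff)
  show ?thesis
  proof (rule Lim_null_comparison[OF _ lim], rule always_eventually, rule allI)
    fix n
    have "integral\<^sup>L (\<Q> n) h = perm_avg n (\<lambda>\<pi>. v n \<pi> * h (Y n \<pi>)) / perm_avg n (v n)"
      using int[OF borel_measurable_continuous_onI[OF h(1)], of n] by (simp add: divide_inverse mult.commute)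
    then have "perm_avg n (\<lambda>\<pi>. v n \<pi> * h (Y n \<pi>)) - perm_avg n (v n) * integral\<^sup>L \<mu> h
       = perm_avg n (v n) * (integral\<^sup>L (\<Q> n) h - integral\<^sup>L \<mu> h)"
      using avg1(1)[of n] by (simp add: field_simps)
    then show "norm (perm_avg n (\<lambda>\<pi>. v n \<pi> * h (Y n \<pi>)) - perm_avg n (v n) * integral\<^sup>L \<mu> h)
       \<le> D * norm (integral\<^sup>L (\<Q> n) h - integral\<^sup>L \<mu> h)"
      using avg1[of n] by (simp add: abs_mult mult_right_mono)
  qed
qed

text \<open>The last assumption holds if \<open>c\<close> tends to infinity and also if \<open>s = 0\<close>.\<close>

locale population_sequence =
  fixes x :: "nat \<Rightarrow> nat \<Rightarrow> real" and c :: "nat \<Rightarrow> real" and s :: real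
  assumes c_ge_1: "\<And>n. n \<ge> 1 \<Longrightarrow> c n \<ge> 1"
    and total: "\<And>n. n \<ge> 1 \<Longrightarrow> (\<Sum>j<n. x n j) = - c n"
    and s_nonneg: "s \<ge> 0"
    and c_small: "(\<lambda>n. (c n)\<^sup>2 / real n) \<longlonglongrightarrow> 0"
    and energy_limit: "(\<lambda>n. energy n (x n) / real n) \<longlonglongrightarrow> s"
    and lindeberg: "(\<lambda>n. truncated_energy n (x n) (c n) / real n) \<longlonglongrightarrow> 0"
    and s_over_c: "(\<lambda>n. s / (c n)\<^sup>2) \<longlonglongrightarrow> 0"
begin

abbreviation S :: "nat \<Rightarrow> (nat \<Rightarrow> nat) \<Rightarrow> nat \<Rightarrow> real" where
  "S n \<equiv> partial_sum (x n)"

lemma population: "n \<ge> 1 \<Longrightarrow> population n (x n) (c n)"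
  using c_ge_1[of n] total[of n] by unfold_locales auto

text \<open>\<open>R\<close> is T c^2 times the step error, written in ratios with known limits. The
  drift term becomes a square root containing c^2 / n, and the quadratic error of the exponential
  becomes a multiple of s^2 / c^2.\<close>

lemma step_error_tendsto:
  assumes T: "T \<ge> 0" and b: "\<forall>\<^sub>F n in sequentially. real (b n) \<le> T * (c n)\<^sup>2"
    and a: "\<forall>\<^sub>F n in sequentially. a n \<le> b n"
  shows "(\<lambda>n. real (b n - a n) * step_error n (x n) (c n) s (b n) u) \<longlonglongrightarrow> 0"
proof -
  define R where "R = (\<lambda>n. 2 * T * ((1 + \<bar>u\<bar>) * u\<^sup>2 * (truncated_energy n (x n) (c n) / real n)
      + \<bar>u\<bar> * sqrt ((c n)\<^sup>2 / real n * (energy n (x n) / real n + (c n)\<^sup>2 / real n))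
      + u\<^sup>2 / 2 * (\<bar>energy n (x n) / real n - s\<bar> + T * ((c n)\<^sup>2 / real n) * (energy n (x n) / real n + s)))
      + T * u ^ 4 * s / 4 * (s / (c n)\<^sup>2))"
  have "R \<longlonglongrightarrow> 2 * T * ((1 + \<bar>u\<bar>) * u\<^sup>2 * 0 + \<bar>u\<bar> * sqrt (0 * (s + 0))
      + u\<^sup>2 / 2 * (\<bar>s - s\<bar> + T * 0 * (s + s))) + T * u ^ 4 * s / 4 * 0"
    unfolding R_def by (intro tendsto_intros lindeberg c_small energy_limit s_over_c)
  then have R: "R \<longlonglongrightarrow> 0" by simp
  show ?thesis
  proof (rule Lim_null_comparison[OF _ R])
    show "\<forall>\<^sub>F n in sequentially. norm (real (b n - a n) * step_error n (x n) (c n) s (b n) u) \<le> R n"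
      using b a eventually_ge_at_top[of 1]
    proof eventually_elim
      case (elim n)
      interpret population n "x n" "c n" using elim by (intro population)
      have n: "real n > 0" and c: "c n > 0" using elim c_pos by auto
      define K where "K = T * (c n)\<^sup>2"
      define F where "F = (\<lambda>b. 2 / real n * ((1 + \<bar>u\<bar>) * (u / c n)\<^sup>2 * truncated_energy n (x n) (c n) + \<bar>u / c n\<bar> * sqrt (energy n (x n) + (c n)\<^sup>2)
       + (u / c n)\<^sup>2 / 2 * (\<bar>energy n (x n) - real n * s\<bar> + b * (energy n (x n) / real n + s))) + ((u / c n)\<^sup>2 * s / 2)\<^sup>2)"
      have e: "step_error n (x n) (c n) s (b n) u = F (real (b n))"
        by (simp add: F_def step_error_def)
      have F0: "0 \<le> F (real (b n))"
        unfolding F_def using s_nonneg energy_nonneg truncated_energy_nonneg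
        by (intro add_nonneg_nonneg mult_nonneg_nonneg) (auto intro!: add_nonneg_nonneg)
      have bK: "real (b n) \<le> K" "real (b n - a n) \<le> K" using elim by (auto simp: K_def)
      have "F (real (b n)) \<le> F K"
        unfolding F_def using bK s_nonneg energy_nonneg
        by (intro add_right_mono add_left_mono mult_left_mono mult_right_mono) auto
      then have "norm (real (b n - a n) * step_error n (x n) (c n) s (b n) u) \<le> K * F K"
        unfolding e using F0 bK by (auto simp: abs_mult intro!: mult_mono)
      also have "K * F K = R n"
      proof -
        have sq: "(c n / real n) * sqrt (energy n (x n) + (c n)\<^sup>2)
            = sqrt ((c n)\<^sup>2 / real n * (energy n (x n) / real n + (c n)\<^sup>2 / real n))"
        proof -
          have "sqrt ((c n)\<^sup>2 / real n * (energy n (x n) / real n + (c n)\<^sup>2 / real n))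
             = sqrt ((c n / real n)\<^sup>2 * (energy n (x n) + (c n)\<^sup>2))"
            using n by (intro arg_cong[of _ _ sqrt]) (simp add: field_simps power2_eq_square)
          then show ?thesis using c n by (simp add: real_sqrt_mult)
        qed
        have ab: "\<bar>energy n (x n) - real n * s\<bar> = real n * \<bar>energy n (x n) / real n - s\<bar>"
        proof -
          have "energy n (x n) - real n * s = real n * (energy n (x n) / real n - s)"
            using n by (simp add: field_simps)
          then show ?thesis using n by (simp add: abs_mult)
        qed
        have "K * F K = 2 * T * ((1 + \<bar>u\<bar>) * u\<^sup>2 * (truncated_energy n (x n) (c n) / real n)
            + \<bar>u\<bar> * ((c n / real n) * sqrt (energy n (x n) + (c n)\<^sup>2))
            + u\<^sup>2 / 2 * (\<bar>energy n (x n) / real n - s\<bar> + T * ((c n)\<^sup>2 / real n) * (energy n (x n) / real n + s)))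
            + T * u ^ 4 * s / 4 * (s / (c n)\<^sup>2)"
          unfolding F_def K_def ab using n c
          by (simp add: field_simps power2_eq_square power4_eq_xxxx)
        then show ?thesis unfolding R_def sq .
      qed
      finally show ?case .
    qed
  qed
qed

lemma char_increment_tendsto:
  fixes w :: "nat \<Rightarrow> (nat \<Rightarrow> nat) \<Rightarrow> complex"
  assumes w: "\<And>n. determined_by_first (a n) (w n)" "\<And>n \<pi>. cmod (w n \<pi>) \<le> D"
    and T: "T \<ge> 0" "\<forall>\<^sub>F n in sequentially. real (b n) \<le> T * (c n)\<^sup>2"
    and ab: "\<forall>\<^sub>F n in sequentially. a n \<le> b n"
    and lim: "(\<lambda>n. s * (real (b n - a n) / (c n)\<^sup>2)) \<longlonglongrightarrow> v"
  shows "(\<lambda>n. perm_avg n (\<lambda>\<pi>. w n \<pi> * iexp (u * ((S n \<pi> (b n) - S n \<pi> (a n)) / c n)))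
      - perm_avg n (w n) * exp (- (v * u\<^sup>2 / 2))) \<longlonglongrightarrow> 0"
proof -
  have D: "D \<ge> 0" using w(2) norm_ge_zero order_trans by blast
  define q where "q = (\<lambda>n. exp (- (s * (real (b n - a n) / (c n)\<^sup>2) * u\<^sup>2 / 2)))"
  define r where "r = exp (- (v * u\<^sup>2 / 2))"
  have "q \<longlonglongrightarrow> r" unfolding q_def r_def by (intro tendsto_intros lim) simp
  then have "(\<lambda>n. D * (real (b n - a n) * step_error n (x n) (c n) s (b n) u) + \<bar>q n - r\<bar> * D) \<longlonglongrightarrow> D * 0 + \<bar>r - r\<bar> * D"
    by (intro tendsto_intros step_error_tendsto[OF T ab])
  then have R: "(\<lambda>n. D * (real (b n - a n) * step_error n (x n) (c n) s (b n) u) + \<bar>q n - r\<bar> * D) \<longlonglongrightarrow> 0" by simp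
  \<comment> \<open>This ensures 2 * b \<le> n, so at least half of the population is still
    unseen.\<close>
  have half: "\<forall>\<^sub>F n in sequentially. T * ((c n)\<^sup>2 / real n) < 1 / 2"
    using tendsto_mult_right_zero[OF c_small, of T] by (rule order_tendstoD) simp
  show ?thesis
    unfolding r_def[symmetric]
  proof (intro Lim_null_comparison[OF _ R], use half T(2) ab eventually_ge_at_top[of 1] in eventually_elim)
    case (elim n)
    interpret population n "x n" "c n" using elim by (intro population)
    have "2 * real (b n) \<le> real n"
      using elim by (simp add: field_simps; linarith)
    then have "2 * b n \<le> n" by linarith
    from iexp_increment[OF w(1)[of n] w(2) _ this s_nonneg, of u] elim
    have 1: "cmod (perm_avg n (\<lambda>\<pi>. w n \<pi> * iexp (u / c n * (S n \<pi> (b n) - S n \<pi> (a n))))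
      - exp (- (real (b n - a n) * ((u / c n)\<^sup>2 * s / 2))) * perm_avg n (w n)) \<le> real (b n - a n) * (D * step_error n (x n) (c n) s (b n) u)"
      by simp
    have q: "exp (- (real (b n - a n) * ((u / c n)\<^sup>2 * s / 2))) = q n"
      unfolding q_def by (simp add: power_divide mult_ac)
    have "cmod (perm_avg n (w n)) \<le> perm_avg n (\<lambda>_. D)"
      by (rule order_trans[OF norm_perm_avg]) (intro perm_avg_mono w)
    then have 2: "cmod (complex_of_real (q n - r) * perm_avg n (w n)) \<le> \<bar>q n - r\<bar> * D"
      unfolding norm_mult norm_of_real by (intro mult_mono) auto
    have eq: "perm_avg n (\<lambda>\<pi>. w n \<pi> * iexp (u * ((S n \<pi> (b n) - S n \<pi> (a n)) / c n))) - perm_avg n (w n) * r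
       = (perm_avg n (\<lambda>\<pi>. w n \<pi> * iexp (u / c n * (S n \<pi> (b n) - S n \<pi> (a n)))) - q n * perm_avg n (w n))
        + complex_of_real (q n - r) * perm_avg n (w n)"
      by (simp add: algebra_simps diff_divide_distrib)
    show ?case
      unfolding eq
      by (rule order_trans[OF order_trans[OF norm_triangle_ineq add_mono[OF 1[unfolded q] 2]]]) (simp add: mult_ac)
  qed
qed

text \<open>With a product of earlier test functions as \<open>w\<close>, this is asymptotic
  independence of the increment from the past together with its Gaussian limit.\<close>

lemma increment_tendsto:
  fixes w :: "nat \<Rightarrow> (nat \<Rightarrow> nat) \<Rightarrow> real"
  assumes w: "\<And>n. determined_by_first (a n) (w n)" "\<And>n \<pi>. \<bar>w n \<pi>\<bar> \<le> D"
    and T: "T \<ge> 0" "\<forall>\<^sub>F n in sequentially. real (b n) \<le> T * (c n)\<^sup>2"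
    and ab: "\<forall>\<^sub>F n in sequentially. a n \<le> b n"
    and lim: "(\<lambda>n. s * (real (b n - a n) / (c n)\<^sup>2)) \<longlonglongrightarrow> v" and v: "v \<ge> 0"
    and h: "continuous_on UNIV h" "bounded (range h)"
  shows "(\<lambda>n. perm_avg n (\<lambda>\<pi>. w n \<pi> * h ((S n \<pi> (b n) - S n \<pi> (a n)) / c n))
      - perm_avg n (w n) * integral\<^sup>L (centered_gaussian v) h) \<longlonglongrightarrow> 0"
proof -
  let ?Y = "\<lambda>n \<pi>. (S n \<pi> (b n) - S n \<pi> (a n)) / c n" and ?I = "integral\<^sup>L (centered_gaussian v) h"
  have pos: "(\<lambda>n. perm_avg n (\<lambda>\<pi>. z n \<pi> * h (?Y n \<pi>)) - perm_avg n (z n) * ?I) \<longlonglongrightarrow> 0"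
    if z: "\<And>n. determined_by_first (a n) (z n)" "\<And>n \<pi>. 1 \<le> z n \<pi>" "\<And>n \<pi>. z n \<pi> \<le> D'" for z D'
  proof (rule weighted_perm_avg_tendsto[OF z(2,3) real_distribution_centered_gaussian _ h])
    fix u
    have "(\<lambda>n. perm_avg n (\<lambda>\<pi>. complex_of_real (z n \<pi>) * iexp (u * ?Y n \<pi>))
        - perm_avg n (\<lambda>\<pi>. complex_of_real (z n \<pi>)) * exp (- (v * u\<^sup>2 / 2))) \<longlonglongrightarrow> 0"
    proof (rule char_increment_tendsto[OF _ _ T ab lim])
      show "determined_by_first (a n) (\<lambda>\<pi>. complex_of_real (z n \<pi>))" for n
        using z(1)[of n] unfolding determined_by_first_def by metis
      show "cmod (complex_of_real (z n \<pi>)) \<le> D'" for n \<pi>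
        using z(2,3)[of n \<pi>] by simp
    qed
    then show "(\<lambda>n. perm_avg n (\<lambda>\<pi>. complex_of_real (z n \<pi>) * iexp (u * ?Y n \<pi>))
        - complex_of_real (perm_avg n (z n)) * char (centered_gaussian v) u) \<longlonglongrightarrow> 0"
      unfolding char_centered_gaussian[OF v] perm_avg_of_real by simp
  qed
  \<comment> \<open>Adding a constant makes the weight positive without losing the original one.\<close>
  have 1: "(\<lambda>n. perm_avg n (\<lambda>\<pi>. (w n \<pi> + D + 1) * h (?Y n \<pi>)) - perm_avg n (\<lambda>\<pi>. w n \<pi> + D + 1) * ?I) \<longlonglongrightarrow> 0"
  proof (rule pos)
    show "determined_by_first (a n) (\<lambda>\<pi>. w n \<pi> + D + 1)" for n
      using w(1)[of n] unfolding determined_by_first_def by metis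
    show "1 \<le> w n \<pi> + D + 1" "w n \<pi> + D + 1 \<le> 2 * D + 1" for n \<pi>
      using w(2)[of n \<pi>] by linarith+
  qed
  have "(\<lambda>n. perm_avg n (\<lambda>\<pi>. 1 * h (?Y n \<pi>)) - perm_avg n (\<lambda>\<pi>. 1) * ?I) \<longlonglongrightarrow> 0"
    by (rule pos[of "\<lambda>_ _. 1" 1]) auto
  from tendsto_diff[OF 1 tendsto_mult_right_zero[OF this, of "D + 1"]]
  show ?thesis
    by (simp add: distrib_right perm_avg_add perm_avg_mult_left perm_avg_mult_right algebra_simps)
qed

section \<open>Increments over a time grid\<close>

definition steps :: "real \<Rightarrow> nat \<Rightarrow> nat" where
  "steps t n = nat \<lfloor>t * (c n)\<^sup>2\<rfloor>"

lemma steps_mono: "t \<le> t' \<Longrightarrow> steps t n \<le> steps t' n"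
  unfolding steps_def by (intro nat_mono floor_mono mult_right_mono) auto

lemma steps_bounds:
  assumes "t \<ge> 0"
  shows "real (steps t n) \<le> t * (c n)\<^sup>2" "t * (c n)\<^sup>2 < real (steps t n) + 1"
proof -
  have "0 \<le> t * (c n)\<^sup>2" using assms by simp
  then have "real (steps t n) = of_int \<lfloor>t * (c n)\<^sup>2\<rfloor>"
    unfolding steps_def by (simp add: of_nat_nat)
  then show "real (steps t n) \<le> t * (c n)\<^sup>2" "t * (c n)\<^sup>2 < real (steps t n) + 1"
    by linarith+
qed

text \<open>Rounding changes a length by at most 1, at the cost of s / c^2. The factor
  \<open>s\<close> has to stay: for bounded c and s = 0 the ratio l / c^2 itself may fail to
  converge.\<close>

lemma near_length_tendsto:
  assumes "\<forall>\<^sub>F n in sequentially. \<bar>real (l n) - v * (c n)\<^sup>2\<bar> \<le> 1"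
  shows "(\<lambda>n. s * (real (l n) / (c n)\<^sup>2)) \<longlonglongrightarrow> s * v"
proof (rule LIM_zero_cancel, rule Lim_null_comparison[OF _ s_over_c],
    use assms eventually_ge_at_top[of 1] in eventually_elim)
  case (elim n)
  have c: "c n > 0" using c_ge_1[of n] elim by simp
  have "s * (real (l n) / (c n)\<^sup>2) - s * v = s / (c n)\<^sup>2 * (real (l n) - v * (c n)\<^sup>2)"
    using c by (simp add: field_simps)
  then have "norm (s * (real (l n) / (c n)\<^sup>2) - s * v) = s / (c n)\<^sup>2 * \<bar>real (l n) - v * (c n)\<^sup>2\<bar>"
    using s_nonneg by (simp add: abs_mult)
  also have "\<dots> \<le> s / (c n)\<^sup>2 * 1"
    using elim s_nonneg by (intro mult_left_mono) auto
  finally show ?case by simp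
qed

lemma products_tendsto:
  assumes h: "\<And>i. continuous_on UNIV (h i)" "\<And>i. bounded (range (h i))" and m: "m > 0"
  shows "(\<lambda>n. perm_avg n (\<lambda>\<pi>. \<Prod>i<d. h i ((S n \<pi> (steps (real (Suc i) / real m) n) - S n \<pi> (steps (real i / real m) n)) / c n)))
     \<longlonglongrightarrow> (\<Prod>i<d. integral\<^sup>L (centered_gaussian (s / real m)) (h i) :: real)"
proof (induction d)
  case 0
  then show ?case by simp
next
  case (Suc d)
  define Y where "Y = (\<lambda>i n \<pi>. (S n \<pi> (steps (real (Suc i) / real m) n) - S n \<pi> (steps (real i / real m) n)) / c n)"
  \<comment> \<open>In the induction the first \<open>d\<close> factors form the weight carried by
    the past, and the last factor is the new increment.\<close>
  define w where "w = (\<lambda>n \<pi>. \<Prod>i<d. h i (Y i n \<pi>))"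
  define I where "I = (\<lambda>i. integral\<^sup>L (centered_gaussian (s / real m)) (h i))"
  obtain B where B: "\<And>i y. \<bar>h i y\<bar> \<le> B i"
    using h(2) unfolding bounded_iff by (metis rangeI real_norm_def)
  have "(\<lambda>n. perm_avg n (\<lambda>\<pi>. w n \<pi> * h d (Y d n \<pi>)) - perm_avg n (w n) * I d) \<longlonglongrightarrow> 0"
    unfolding Y_def I_def
  proof (rule increment_tendsto[where D = "\<Prod>i<d. B i" and T = "real (Suc d) / real m"])
    show "determined_by_first (steps (real d / real m) n) (w n)" for n
      unfolding determined_by_first_def w_def
    proof (intro allI impI prod.cong refl)
      fix \<pi> \<rho> :: "nat \<Rightarrow> nat" and i assume eq: "\<forall>i<steps (real d / real m) n. \<pi> i = \<rho> i" and i: "i \<in> {..<d}"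
      have "S n \<pi> k = S n \<rho> k" if "k \<le> steps (real d / real m) n" for k
        unfolding partial_sum_def using eq that by (intro sum.cong) auto
      moreover have "steps (real i / real m) n \<le> steps (real d / real m) n"
        "steps (real (Suc i) / real m) n \<le> steps (real d / real m) n"
        using i by (intro steps_mono divide_right_mono; simp)+
      ultimately show "h i (Y i n \<pi>) = h i (Y i n \<rho>)" by (simp add: Y_def)
    qed
    show "\<bar>w n \<pi>\<bar> \<le> (\<Prod>i<d. B i)" for n \<pi>
      unfolding w_def abs_prod by (intro prod_mono) (use B in auto)
    show "\<forall>\<^sub>F n in sequentially. real (steps (real (Suc d) / real m) n) \<le> real (Suc d) / real m * (c n)\<^sup>2"
      by (intro always_eventually allI steps_bounds) auto
    show le: "\<forall>\<^sub>F n in sequentially. steps (real d / real m) n \<le> steps (real (Suc d) / real m) n"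
      by (intro always_eventually allI steps_mono divide_right_mono) auto
    have "(\<lambda>n. s * (real (steps (real (Suc d) / real m) n - steps (real d / real m) n) / (c n)\<^sup>2)) \<longlonglongrightarrow> s * (1 / real m)"
    proof (rule near_length_tendsto, use le in eventually_elim)
      case (elim n)
      have "real (Suc d) / real m * (c n)\<^sup>2 = real d / real m * (c n)\<^sup>2 + 1 / real m * (c n)\<^sup>2"
        by (simp add: add_divide_distrib algebra_simps)
      then show ?case
        using elim steps_bounds[of "real d / real m" n] steps_bounds[of "real (Suc d) / real m" n]
        unfolding of_nat_diff[OF elim] by simp
    qed
    then show "(\<lambda>n. s * (real (steps (real (Suc d) / real m) n - steps (real d / real m) n) / (c n)\<^sup>2)) \<longlonglongrightarrow> s / real m"
      by simp
    show "0 \<le> s / real m" using s_nonneg by simp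
  qed (use h in auto)
  moreover have "(\<lambda>n. perm_avg n (w n) * I d) \<longlonglongrightarrow> (\<Prod>i<d. I i) * I d"
    using Suc unfolding w_def I_def Y_def by (intro tendsto_mult tendsto_const)
  ultimately have "(\<lambda>n. (perm_avg n (\<lambda>\<pi>. w n \<pi> * h d (Y d n \<pi>)) - perm_avg n (w n) * I d) + perm_avg n (w n) * I d)
      \<longlonglongrightarrow> 0 + (\<Prod>i<d. I i) * I d"
    by (rule tendsto_add)
  then have "(\<lambda>n. perm_avg n (\<lambda>\<pi>. w n \<pi> * h d (Y d n \<pi>))) \<longlonglongrightarrow> (\<Prod>i<d. I i) * I d"
    by simp
  then show ?case by (simp add: w_def I_def Y_def)
qed

end

section \<open>Tightness\<close>

lemma partial_sum_diff:
  assumes "k \<le> l"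
  shows "partial_sum x \<pi> l - partial_sum x \<pi> k = (\<Sum>i\<in>{k..<l}. x (\<pi> i))"
proof -
  have "partial_sum x \<pi> l = partial_sum x \<pi> k + (\<Sum>i\<in>{k..<l}. x (\<pi> i))"
    unfolding partial_sum_def using assms
    by (subst sum.union_disjoint[symmetric]) (auto intro!: sum.cong)
  then show ?thesis by simp
qed

definition max_exceeds :: "(nat \<Rightarrow> real) \<Rightarrow> nat \<Rightarrow> real \<Rightarrow> nat \<Rightarrow> (nat \<Rightarrow> nat) \<Rightarrow> bool" where
  "max_exceeds x L r a \<pi> \<longleftrightarrow> (\<exists>k\<le>L. \<bar>partial_sum x \<pi> (a + k) - partial_sum x \<pi> a\<bar> > r)"

text \<open>A cyclic shift of the first n positions by \<open>a\<close> carries the initial window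
  to the one starting at \<open>a\<close>. Because a + L \<le> n, no position of the window wraps
  around.\<close>

lemma perm_avg_max_exceeds_shift:
  assumes "a + L \<le> n"
  shows "perm_avg n (\<lambda>\<pi>. of_bool (max_exceeds x L r a \<pi>))
    = (perm_avg n (\<lambda>\<pi>. of_bool (max_exceeds x L r 0 \<pi>)) :: real)"
proof -
  define \<rho> where "\<rho> = (\<lambda>j. if j < n then (j + a) mod n else j)"
  have inj: "inj_on \<rho> {..<n}"
  proof (rule linorder_inj_onI)
    fix i j assume ij: "i < j" "i \<in> {..<n}" "j \<in> {..<n}"
    then have "\<not> n dvd (j + a) - (i + a)" by (auto dest: dvd_imp_le)
    then have "(j + a) mod n \<noteq> (i + a) mod n"
      using ij by (subst mod_eq_dvd_iff_nat) auto
    then show "\<rho> i \<noteq> \<rho> j" using ij by (auto simp: \<rho>_def)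
  qed auto
  have "\<rho> ` {..<n} \<subseteq> {..<n}" by (auto simp: \<rho>_def)
  then have "bij_betw \<rho> {..<n} {..<n}"
    using inj by (simp add: bij_betw_def endo_inj_surj)
  then have \<rho>: "\<rho> permutes {..<n}"
    by (rule bij_imp_permutes) (auto simp: \<rho>_def)
  have "max_exceeds x L r 0 (\<pi> \<circ> \<rho>) = max_exceeds x L r a \<pi>" for \<pi>
  proof -
    have "partial_sum x (\<pi> \<circ> \<rho>) k = partial_sum x \<pi> (a + k) - partial_sum x \<pi> a" if "k \<le> L" for k
    proof -
      have "partial_sum x \<pi> (a + k) - partial_sum x \<pi> a = (\<Sum>i\<in>{a..<a + k}. x (\<pi> i))"
        by (rule partial_sum_diff) simp
      also have "\<dots> = (\<Sum>j<k. x (\<pi> (j + a)))"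
        using sum.shift_bounds_nat_ivl[of "\<lambda>i. x (\<pi> i)" 0 a k] by (simp add: atLeast0LessThan add.commute)
      also have "\<dots> = partial_sum x (\<pi> \<circ> \<rho>) k"
        unfolding partial_sum_def using that assms by (intro sum.cong) (auto simp: \<rho>_def)
      finally show ?thesis by simp
    qed
    then show ?thesis
      by (auto simp: max_exceeds_def partial_sum_def[of _ _ 0])
  qed
  then show ?thesis using perm_avg_compose[OF \<rho>, of "\<lambda>\<pi>. of_bool (max_exceeds x L r 0 \<pi>) :: real"] by simp
qed

context population begin

text \<open>\<delta> bounds the conditional probability that the walk, after first exceeding r =
  \<epsilon> c at some k \<le> L, is within r / 2 at time L. For lack of independence it comes from
  a conditional second moment divided by the square of \<open>S \<pi> k\<close>. In it, 2 L / n
  bounds (L - k) / (n - k), the factor 4 is due to returning at least half way, and (1 + 1 /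
  \<epsilon>)^2 accounts for the known sum of the unseen entries.\<close>

lemma ottaviani:
  fixes L :: nat and \<epsilon> :: real
  defines "\<delta> \<equiv> 4 * (2 * real L / real n * (energy n x / (\<epsilon> * c)\<^sup>2) + (2 * real L / real n)\<^sup>2 * (1 + 1 / \<epsilon>)\<^sup>2)"
  assumes L: "2 * L \<le> n" "n \<ge> 4" and \<epsilon>: "\<epsilon> > 0" and \<delta>: "\<delta> \<le> 1 / 2"
  shows "perm_avg n (\<lambda>\<pi>. of_bool (max_exceeds x L (\<epsilon> * c) 0 \<pi>))
    \<le> 2 * perm_avg n (\<lambda>\<pi>. of_bool (\<bar>partial_sum x \<pi> L\<bar> > \<epsilon> * c / 2) :: real)"
proof -
  define r where "r = \<epsilon> * c"
  have r: "r > 0" using \<epsilon> c_pos by (simp add: r_def)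
  define A where "A = (\<lambda>k \<pi>. \<bar>partial_sum x \<pi> k\<bar> > r \<and> (\<forall>j<k. \<bar>partial_sum x \<pi> j\<bar> \<le> r))"
  define S where "S = partial_sum x"
  define low where "low = (\<lambda>\<pi>. \<bar>S \<pi> L\<bar> \<le> r / 2)"
  \<comment> \<open>Decomposition according to the first passage time, of which there is at most
    one.\<close>
  have decomp: "of_bool (max_exceeds x L r 0 \<pi>) = (\<Sum>k\<le>L. of_bool (A k \<pi>) :: real)" for \<pi>
  proof (cases "max_exceeds x L r 0 \<pi>")
    case True
    then obtain k0 where k0: "k0 \<le> L" "\<bar>partial_sum x \<pi> k0\<bar> > r"
      by (auto simp: max_exceeds_def partial_sum_def[of _ _ 0])
    define k where "k = (LEAST k. \<bar>partial_sum x \<pi> k\<bar> > r)"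
    have k: "\<bar>partial_sum x \<pi> k\<bar> > r" "k \<le> L"
      unfolding k_def using LeastI[of "\<lambda>k. \<bar>partial_sum x \<pi> k\<bar> > r", OF k0(2)]
        Least_le[of "\<lambda>k. \<bar>partial_sum x \<pi> k\<bar> > r", OF k0(2)] k0(1) by auto
    have below: "\<bar>partial_sum x \<pi> j\<bar> \<le> r" if "j < k" for j
      using not_less_Least[OF that[unfolded k_def]] by simp
    have "A j \<pi> \<longleftrightarrow> j = k" for j
    proof
      assume "A j \<pi>"
      then show "j = k" using k(1) below[of j] by (auto simp: A_def not_less[symmetric] dest: linorder_neqE_nat)
    qed (auto simp: A_def k below)
    then show ?thesis using True k(2) by simp
  next
    case False
    then have "\<not> A k \<pi>" if "k \<le> L" for k
      using that by (auto simp: A_def max_exceeds_def partial_sum_def[of _ _ 0])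
    then show ?thesis using False by simp
  qed
  have bound: "perm_avg n (\<lambda>\<pi>. of_bool (A k \<pi> \<and> low \<pi>)) \<le> \<delta> * perm_avg n (\<lambda>\<pi>. of_bool (A k \<pi>))" if k: "k \<le> L" for k
  proof -
    \<comment> \<open>Dividing by \<open>(S \<pi> k)\<^sup>2\<close> takes care of the overshoot at the first passage time \<open>k\<close>.\<close>
    define w where "w = (\<lambda>\<pi>. of_bool (A k \<pi>) * (1 / (S \<pi> k)\<^sup>2))"
    define q where "q = real (L - k) / real (n - k)"
    have q: "0 \<le> q" "q \<le> 2 * real L / real n"
    proof -
      have "real n / 2 \<le> real (n - k)" using L k by linarith
      then have "real (L - k) / real (n - k) \<le> real L / (real n / 2)"
        using L by (intro frac_le) auto
      then show "q \<le> 2 * real L / real n" by (simp add: q_def mult.commute)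
    qed (simp add: q_def)
    have w0: "w \<pi> \<ge> 0" for \<pi> by (simp add: w_def)
    have det: "determined_by_first k w"
      unfolding determined_by_first_def
    proof (intro allI impI)
      fix \<pi> \<rho> :: "nat \<Rightarrow> nat" assume eq: "\<forall>i<k. \<pi> i = \<rho> i"
      have "partial_sum x \<pi> j = partial_sum x \<rho> j" if "j \<le> k" for j
        unfolding partial_sum_def using that eq by (intro sum.cong) auto
      then show "w \<pi> = w \<rho>" by (simp add: w_def A_def S_def)
    qed
    \<comment> \<open>To come from beyond r back to r / 2, the walk must move by at least \<bar>S
      \<pi> k\<bar> / 2; this is Chebyshev's inequality before averaging.\<close>
    have pt1: "of_bool (A k \<pi> \<and> low \<pi>) \<le> 4 * (w \<pi> * (\<Sum>i\<in>{k..<L}. x (\<pi> i))\<^sup>2)" for \<pi>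
    proof (cases "A k \<pi> \<and> low \<pi>")
      case True
      then have "\<bar>S \<pi> k\<bar> > r" "\<bar>S \<pi> L\<bar> \<le> r / 2" by (auto simp: A_def low_def S_def)
      moreover have "\<bar>S \<pi> k\<bar> \<le> \<bar>S \<pi> L - S \<pi> k\<bar> + \<bar>S \<pi> L\<bar>" by linarith
      ultimately have "\<bar>S \<pi> k\<bar> / 2 \<le> \<bar>S \<pi> L - S \<pi> k\<bar>" "S \<pi> k \<noteq> 0" using r by auto
      then have "\<bar>S \<pi> k\<bar> \<le> \<bar>2 * (S \<pi> L - S \<pi> k)\<bar>" "S \<pi> k \<noteq> 0" by (simp_all only: abs_mult abs_numeral) auto
      then have "(S \<pi> k)\<^sup>2 \<le> (2 * (S \<pi> L - S \<pi> k))\<^sup>2" "(S \<pi> k)\<^sup>2 > 0"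
        by (simp_all add: abs_le_square_iff)
      then have "1 \<le> (2 * (S \<pi> L - S \<pi> k))\<^sup>2 / (S \<pi> k)\<^sup>2" by simp
      then have "1 \<le> 4 * (S \<pi> L - S \<pi> k)\<^sup>2 / (S \<pi> k)\<^sup>2" unfolding power_mult_distrib by simp
      then show ?thesis
        using True k by (simp add: w_def S_def partial_sum_diff[symmetric] power_mult_distrib)
    next
      case False
      then show ?thesis using w0[of \<pi>] by auto
    qed
    have Ew: "perm_avg n w \<le> 1 / r\<^sup>2 * perm_avg n (\<lambda>\<pi>. of_bool (A k \<pi>))"
      unfolding perm_avg_mult_left[symmetric]
    proof (rule perm_avg_mono)
      fix \<pi>
      show "w \<pi> \<le> 1 / r\<^sup>2 * of_bool (A k \<pi>)"
      proof (cases "A k \<pi>")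
        case True
        then have "r \<le> \<bar>S \<pi> k\<bar>" by (simp add: A_def S_def)
        then have "r\<^sup>2 \<le> (S \<pi> k)\<^sup>2" using r abs_le_square_iff[of r "S \<pi> k"] by simp
        then show ?thesis using True r by (simp add: w_def frac_le)
      qed (simp add: w_def)
    qed
    \<comment> \<open>The unseen entries sum to - c - S \<pi> k, and on the passage event c <
      \<bar>S \<pi> k\<bar> / \<epsilon>.\<close>
    have ER: "perm_avg n (\<lambda>\<pi>. w \<pi> * (\<Sum>j\<in>{k..<n}. x (\<pi> j))\<^sup>2) \<le> (1 + 1 / \<epsilon>)\<^sup>2 * perm_avg n (\<lambda>\<pi>. of_bool (A k \<pi>))"
      unfolding perm_avg_mult_left[symmetric]
    proof (rule perm_avg_mono)
      fix \<pi> assume \<pi>: "\<pi> permutes {..<n}"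
      show "w \<pi> * (\<Sum>j\<in>{k..<n}. x (\<pi> j))\<^sup>2 \<le> (1 + 1 / \<epsilon>)\<^sup>2 * of_bool (A k \<pi>)"
      proof (cases "A k \<pi>")
        case True
        then have S: "\<bar>S \<pi> k\<bar> > r" by (simp add: A_def S_def)
        have "(\<Sum>j\<in>{k..<n}. x (\<pi> j)) = - c - S \<pi> k"
          using perm_tail_sum[OF \<pi>, of k x] L k total by (simp add: S_def partial_sum_def)
        then have "\<bar>\<Sum>j\<in>{k..<n}. x (\<pi> j)\<bar> \<le> \<bar>S \<pi> k\<bar> + c" using c_pos by linarith
        also have "c \<le> \<bar>S \<pi> k\<bar> / \<epsilon>" using S \<epsilon> by (simp add: r_def field_simps)
        finally have "\<bar>\<Sum>j\<in>{k..<n}. x (\<pi> j)\<bar> \<le> \<bar>(1 + 1 / \<epsilon>) * S \<pi> k\<bar>"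
          using \<epsilon> by (simp add: abs_mult distrib_right)
        then have "(\<Sum>j\<in>{k..<n}. x (\<pi> j))\<^sup>2 \<le> ((1 + 1 / \<epsilon>) * S \<pi> k)\<^sup>2"
          by (simp only: abs_le_square_iff)
        moreover have "(S \<pi> k)\<^sup>2 > 0" using S r by auto
        ultimately show ?thesis
          using True by (simp add: w_def divide_le_eq power_mult_distrib)
      qed (simp add: w_def)
    qed
    have "perm_avg n (\<lambda>\<pi>. of_bool (A k \<pi> \<and> low \<pi>)) \<le> perm_avg n (\<lambda>\<pi>. 4 * (w \<pi> * (\<Sum>i\<in>{k..<L}. x (\<pi> i))\<^sup>2))"
      by (intro perm_avg_mono pt1)
    also have "\<dots> = 4 * perm_avg n (\<lambda>\<pi>. w \<pi> * (\<Sum>i\<in>{k..<L}. x (\<pi> i))\<^sup>2)"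
      by (rule perm_avg_mult_left)
    also have "perm_avg n (\<lambda>\<pi>. w \<pi> * (\<Sum>i\<in>{k..<L}. x (\<pi> i))\<^sup>2)
        \<le> q * (perm_avg n w * energy n x) + q\<^sup>2 * perm_avg n (\<lambda>\<pi>. w \<pi> * (\<Sum>j\<in>{k..<n}. x (\<pi> j))\<^sup>2)"
      using perm_avg_square_sum_le[OF det w0, of "{k..<L}" n x] L k
      by (simp add: q_def energy_def)
    also have "\<dots> \<le> (2 * real L / real n) * ((1 / r\<^sup>2 * perm_avg n (\<lambda>\<pi>. of_bool (A k \<pi>))) * energy n x)
        + (2 * real L / real n)\<^sup>2 * ((1 + 1 / \<epsilon>)\<^sup>2 * perm_avg n (\<lambda>\<pi>. of_bool (A k \<pi>)))"
      using q energy_nonneg[of n x]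
      by (intro add_mono mult_mono Ew ER power_mono order_refl)
        (auto intro!: mult_nonneg_nonneg divide_nonneg_nonneg perm_avg_nonneg w0)
    finally show ?thesis
      unfolding \<delta>_def r_def[symmetric] by (simp add: algebra_simps)
  qed
  let ?P = "perm_avg n (\<lambda>\<pi>. of_bool (max_exceeds x L r 0 \<pi>)) :: real"
  \<comment> \<open>Either the walk has returned to r / 2 at time \<open>L\<close> or it is still
    beyond it. The first alternative costs at most half of \<open>?P\<close> and is absorbed on the
    left.\<close>
  have "?P \<le> perm_avg n (\<lambda>\<pi>. of_bool (max_exceeds x L r 0 \<pi>) * of_bool (low \<pi>) + of_bool (\<bar>S \<pi> L\<bar> > r / 2))"
    by (intro perm_avg_mono) (auto simp: low_def)
  also have "\<dots> = (\<Sum>k\<le>L. perm_avg n (\<lambda>\<pi>. of_bool (A k \<pi> \<and> low \<pi>))) + perm_avg n (\<lambda>\<pi>. of_bool (\<bar>S \<pi> L\<bar> > r / 2))"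
    unfolding decomp sum_distrib_right perm_avg_add perm_avg_sum by (simp flip: of_bool_conj)
  also have "\<dots> \<le> (\<Sum>k\<le>L. \<delta> * perm_avg n (\<lambda>\<pi>. of_bool (A k \<pi>))) + perm_avg n (\<lambda>\<pi>. of_bool (\<bar>S \<pi> L\<bar> > r / 2))"
    by (intro add_right_mono sum_mono bound) simp
  also have "(\<Sum>k\<le>L. \<delta> * perm_avg n (\<lambda>\<pi>. of_bool (A k \<pi>))) = \<delta> * ?P"
    unfolding decomp perm_avg_sum by (simp add: sum_distrib_left)
  also have "\<delta> * ?P \<le> 1 / 2 * ?P"
    using \<delta> by (intro mult_right_mono perm_avg_nonneg) auto
  finally have "?P \<le> 2 * perm_avg n (\<lambda>\<pi>. of_bool (\<bar>S \<pi> L\<bar> > r / 2))" by simp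
  then show ?thesis by (simp add: r_def S_def)
qed

end

text \<open>15 is the sixth moment of the standard normal law; the minimum with 1 makes the
  integrand a bounded test function for weak convergence.\<close>

lemma centered_gaussian_sixth_moment:
  assumes "v \<ge> 0"
  shows "integral\<^sup>L (centered_gaussian v) (\<lambda>y. min 1 ((a * y) ^ 6)) \<le> 15 * a ^ 6 * v ^ 3"
proof -
  have s6: "sqrt v ^ 6 = v ^ 3"
  proof -
    have "sqrt v ^ 6 = (sqrt v ^ 2) ^ 3" by (simp flip: power_mult)
    then show ?thesis using assms by simp
  qed
  have int: "integrable std_normal_distribution (\<lambda>z. z ^ 6)" "(LINT z|std_normal_distribution. z ^ 6) = 15"
    using std_normal_distribution_even_moments[of 3] by (simp_all add: fact_numeral)
  have "integral\<^sup>L (centered_gaussian v) (\<lambda>y. min 1 ((a * y) ^ 6))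
      = (\<integral>z. min 1 ((a * (sqrt v * z)) ^ 6) \<partial>std_normal_distribution)"
    by (rule integral_centered_gaussian) simp
  also have "\<dots> \<le> (\<integral>z. a ^ 6 * v ^ 3 * z ^ 6 \<partial>std_normal_distribution)"
  proof (rule integral_mono)
    interpret prob_space std_normal_distribution by (rule prob_space_normal_density) simp
    show "integrable std_normal_distribution (\<lambda>z. min 1 ((a * (sqrt v * z)) ^ 6))"
      by (rule integrable_const_bound[where B = 1]) (auto simp: min_def intro!: AE_I2)
    show "integrable std_normal_distribution (\<lambda>z. a ^ 6 * v ^ 3 * z ^ 6)"
      using int(1) by simp
  qed (simp add: power_mult_distrib s6)
  also have "\<dots> = 15 * a ^ 6 * v ^ 3" using int by simp
  finally show ?thesis .
qed

context population_sequence begin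

text \<open>A union bound over m^2 windows. By stationarity all have the same probability of a large
  maximum; this is reduced to the endpoint by the maximal inequality and estimated through the
  Gaussian limit, with total at most K / m.\<close>

lemma max_increment_tendsto:
  assumes \<epsilon>: "\<epsilon> > 0"
  shows "\<forall>\<^sub>F m in sequentially. \<forall>\<^sub>F n in sequentially.
    perm_avg n (\<lambda>\<pi>. of_bool (\<exists>i<m * m. max_exceeds (x n) (steps (1 / real m) n + 1) (\<epsilon> * c n) (steps (real i / real m) n) \<pi>)) \<le> \<epsilon>"
proof -
  define K where "K = 2 * (15 * (2 / \<epsilon>) ^ 6 * s ^ 3 + 1)"
  have "K > 0" unfolding K_def using s_nonneg \<epsilon> by (auto intro!: add_nonneg_pos)
  \<comment> \<open>The first condition gives K / m \<le> \<epsilon>. The second makes 8 s /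
    (\<epsilon>^2 m), the limit of \<open>R\<close> below, smaller than 1/2 as the maximal
    inequality requires.\<close>
  have "\<forall>\<^sub>F m in sequentially. real m > K / \<epsilon>" "\<forall>\<^sub>F m in sequentially. real m > 16 * s / \<epsilon>\<^sup>2"
    using filterlim_real_sequentially by (simp_all add: filterlim_at_top_dense)
  then show ?thesis
    using eventually_gt_at_top[of 0]
  proof eventually_elim
    case (elim m)
    \<comment> \<open>Because of rounding, the number of steps from a grid point to a time before
      the next one can exceed \<open>steps (1 / real m) n\<close>, but by at most 1.\<close>
    define L where "L = (\<lambda>n. steps (1 / real m) n + 1)"
    have m: "real m \<ge> 1" using elim by linarith
    have Lc: "\<bar>real (L n) - 1 / real m * (c n)\<^sup>2\<bar> \<le> 1" for n
      using steps_bounds[of "1 / real m" n] unfolding L_def by simp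
    have L2: "real (L n) \<le> 2 * (c n)\<^sup>2" if "n \<ge> 1" for n
    proof -
      have "1 / real m * (c n)\<^sup>2 \<le> 1 * (c n)\<^sup>2" using m by (intro mult_right_mono) auto
      moreover have "1 \<le> (c n)\<^sup>2" using c_ge_1[OF that] by simp
      ultimately show ?thesis using Lc[of n] by linarith
    qed
    have lenlim: "(\<lambda>n. s * (real (L n) / (c n)\<^sup>2)) \<longlonglongrightarrow> s * (1 / real m)"
      by (rule near_length_tendsto) (use Lc in auto)
    define \<delta> where "\<delta> = (\<lambda>n. 4 * (2 * real (L n) / real n * (energy n (x n) / (\<epsilon> * c n)\<^sup>2)
        + (2 * real (L n) / real n)\<^sup>2 * (1 + 1 / \<epsilon>)\<^sup>2))"
    \<comment> \<open>The energy is split as (energy / n - s) + s: L / c^2 is merely bounded by 2,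
      while s * (L / c^2) has a limit.\<close>
    define R where "R = (\<lambda>n. 4 * (2 / \<epsilon>\<^sup>2 * (2 * \<bar>energy n (x n) / real n - s\<bar> + s * (real (L n) / (c n)\<^sup>2))
        + (4 * ((c n)\<^sup>2 / real n))\<^sup>2 * (1 + 1 / \<epsilon>)\<^sup>2))"
    have "R \<longlonglongrightarrow> 4 * (2 / \<epsilon>\<^sup>2 * (2 * \<bar>s - s\<bar> + s * (1 / real m)) + (4 * 0)\<^sup>2 * (1 + 1 / \<epsilon>)\<^sup>2)"
      unfolding R_def by (intro tendsto_intros energy_limit lenlim c_small)
    moreover have "4 * (2 / \<epsilon>\<^sup>2 * (2 * \<bar>s - s\<bar> + s * (1 / real m)) + (4 * 0)\<^sup>2 * (1 + 1 / \<epsilon>)\<^sup>2) < 1 / 2"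
      using elim \<epsilon> by (simp add: field_simps)
    ultimately have Rsmall: "\<forall>\<^sub>F n in sequentially. R n < 1 / 2" by (rule order_tendstoD)
    have \<delta>R: "\<delta> n \<le> R n" if n: "n \<ge> 1" for n
    proof -
      have c: "c n > 0" "real n > 0" using c_ge_1[OF n] n by auto
      have split: "e * l = (e - s) * l + s * l" for e l :: real by (simp add: left_diff_distrib)
      have "2 * real (L n) / real n * (energy n (x n) / (\<epsilon> * c n)\<^sup>2) 
          = 2 / \<epsilon>\<^sup>2 * ((energy n (x n) / real n) * (real (L n) / (c n)\<^sup>2))"
        using c \<epsilon> by (simp add: field_simps power_mult_distrib)
      also have "(energy n (x n) / real n) * (real (L n) / (c n)\<^sup>2)
          = (energy n (x n) / real n - s) * (real (L n) / (c n)\<^sup>2) + s * (real (L n) / (c n)\<^sup>2)"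
        by (rule split)
      also have "(energy n (x n) / real n - s) * (real (L n) / (c n)\<^sup>2) \<le> \<bar>energy n (x n) / real n - s\<bar> * 2"
        using L2[OF n] c by (intro mult_mono) (auto simp: divide_le_eq)
      finally have 1: "2 * real (L n) / real n * (energy n (x n) / (\<epsilon> * c n)\<^sup>2)
          \<le> 2 / \<epsilon>\<^sup>2 * (2 * \<bar>energy n (x n) / real n - s\<bar> + s * (real (L n) / (c n)\<^sup>2))"
        using \<epsilon> by (simp add: mult_left_mono divide_right_mono mult.commute)
      have "2 * real (L n) / real n \<le> 4 * ((c n)\<^sup>2 / real n)"
        using L2[OF n] c by (simp add: divide_le_eq)
      then have "(2 * real (L n) / real n)\<^sup>2 \<le> (4 * ((c n)\<^sup>2 / real n))\<^sup>2"
        by (intro power_mono) auto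
      then show ?thesis
        unfolding \<delta>_def R_def using 1 by (intro mult_left_mono add_mono mult_right_mono) auto
    qed
    \<comment> \<open>A continuous bounded majorant of the indicator of \<bar>y\<bar> > \<epsilon> /
      2.\<close>
    define h where "h = (\<lambda>y. min 1 ((2 / \<epsilon> * y) ^ 6) :: real)"
    define I where "I = integral\<^sup>L (centered_gaussian (s / real m)) h"
    have I: "I \<le> 15 * (2 / \<epsilon>) ^ 6 * (s / real m) ^ 3"
      unfolding I_def h_def using s_nonneg by (intro centered_gaussian_sixth_moment) auto
    have h01: "0 \<le> h y" "h y \<le> 1" for y
      unfolding h_def by (auto simp: min_def zero_le_power_eq)
    have "(\<lambda>n. perm_avg n (\<lambda>\<pi>. 1 * h ((S n \<pi> (L n) - S n \<pi> 0) / c n)) - perm_avg n (\<lambda>_. 1) * I) \<longlonglongrightarrow> 0"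
      unfolding I_def
    proof (rule increment_tendsto[where T = 2 and D = 1])
      show "\<forall>\<^sub>F n in sequentially. real (L n) \<le> 2 * (c n)\<^sup>2"
        using eventually_ge_at_top[of 1] by eventually_elim (rule L2)
      show "(\<lambda>n. s * (real (L n - 0) / (c n)\<^sup>2)) \<longlonglongrightarrow> s / real m" using lenlim by simp
      show "continuous_on UNIV h" unfolding h_def by (intro continuous_intros)
      show "bounded (range h)" using h01 by (auto simp: bounded_iff intro!: exI[of _ 1])
    qed (use s_nonneg in auto)
    then have "(\<lambda>n. perm_avg n (\<lambda>\<pi>. h (S n \<pi> (L n) / c n))) \<longlonglongrightarrow> I"
      by (simp add: partial_sum_def LIM_zero_iff)
    \<comment> \<open>The slack is of the same order m^{-3} as the Gaussian moment, so it also
      survives multiplication by m^2.\<close>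
    then have "\<forall>\<^sub>F n in sequentially. perm_avg n (\<lambda>\<pi>. h (S n \<pi> (L n) / c n)) < I + 1 / real m ^ 3"
      using m by (intro order_tendstoD) auto
    \<comment> \<open>All windows up to time m, each of length at most 2 c^2, then fit into the
      first half of the positions.\<close>
    moreover have "\<forall>\<^sub>F n in sequentially. real m * ((c n)\<^sup>2 / real n) + 2 * ((c n)\<^sup>2 / real n) < 1 / 2"
    proof (rule order_tendstoD)
      show "(\<lambda>n. real m * ((c n)\<^sup>2 / real n) + 2 * ((c n)\<^sup>2 / real n)) \<longlonglongrightarrow> real m * 0 + 2 * 0"
        by (intro tendsto_intros c_small)
    qed simp
    ultimately show ?case
      using Rsmall eventually_ge_at_top[of 4]
    proof eventually_elim
      case (elim n)
      interpret population n "x n" "c n" using elim by (intro population) simp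
      have n: "n \<ge> 1" "real n > 0" using elim by auto
      have small: "real m * (c n)\<^sup>2 + 2 * (c n)\<^sup>2 < real n / 2"
        using elim n by (simp add: field_simps)
      have Ln: "2 * L n \<le> n"
      proof -
        have "real m * (c n)\<^sup>2 \<ge> 0" by simp
        then have "2 * real (L n) \<le> real n" using L2[OF n(1)] small by linarith
        then show ?thesis by linarith
      qed
      have win: "steps (real i / real m) n + L n \<le> n" if "i < m * m" for i
      proof -
        have "real i / real m \<le> real m"
          using that m by (simp add: divide_le_eq) (metis less_imp_le of_nat_le_iff of_nat_mult)
        then have "real i / real m * (c n)\<^sup>2 \<le> real m * (c n)\<^sup>2" by (intro mult_right_mono) auto
        then have "real (steps (real i / real m) n) + real (L n) \<le> real n"
          using steps_bounds(1)[of "real i / real m" n] L2[OF n(1)] small by simp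
        then show ?thesis by linarith
      qed
      have "perm_avg n (\<lambda>\<pi>. of_bool (\<exists>i<m * m. max_exceeds (x n) (L n) (\<epsilon> * c n) (steps (real i / real m) n) \<pi>))
          \<le> perm_avg n (\<lambda>\<pi>. \<Sum>i<m * m. of_bool (max_exceeds (x n) (L n) (\<epsilon> * c n) (steps (real i / real m) n) \<pi>) :: real)"
      proof (intro perm_avg_mono)
        fix \<pi>
        let ?f = "\<lambda>i. of_bool (max_exceeds (x n) (L n) (\<epsilon> * c n) (steps (real i / real m) n) \<pi>) :: real"
        show "of_bool (\<exists>i<m * m. max_exceeds (x n) (L n) (\<epsilon> * c n) (steps (real i / real m) n) \<pi>) \<le> (\<Sum>i<m * m. ?f i)"
        proof (cases "\<exists>i<m * m. max_exceeds (x n) (L n) (\<epsilon> * c n) (steps (real i / real m) n) \<pi>")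
          case True
          then obtain i where i: "i < m * m" "max_exceeds (x n) (L n) (\<epsilon> * c n) (steps (real i / real m) n) \<pi>" by blast
          have "?f i \<le> (\<Sum>i<m * m. ?f i)" by (rule member_le_sum) (use i in auto)
          then show ?thesis using True i by simp
        qed (simp add: sum_nonneg)
      qed
      also have "\<dots> = (\<Sum>i<m * m. perm_avg n (\<lambda>\<pi>. of_bool (max_exceeds (x n) (L n) (\<epsilon> * c n) 0 \<pi>)))"
        unfolding perm_avg_sum using win by (intro sum.cong perm_avg_max_exceeds_shift) auto
      also have "\<dots> = real (m * m) * perm_avg n (\<lambda>\<pi>. of_bool (max_exceeds (x n) (L n) (\<epsilon> * c n) 0 \<pi>))"
        by simp
      also have "\<dots> \<le> real (m * m) * (2 * (15 * (2 / \<epsilon>) ^ 6 * (s / real m) ^ 3 + 1 / real m ^ 3))"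
      proof (intro mult_left_mono)
        have "perm_avg n (\<lambda>\<pi>. of_bool (max_exceeds (x n) (L n) (\<epsilon> * c n) 0 \<pi>))
            \<le> 2 * perm_avg n (\<lambda>\<pi>. of_bool (\<bar>S n \<pi> (L n)\<bar> > \<epsilon> * c n / 2) :: real)"
          using ottaviani[OF Ln _ \<epsilon>] \<delta>R[OF n(1)] elim by (simp add: \<delta>_def)
        also have "perm_avg n (\<lambda>\<pi>. of_bool (\<bar>S n \<pi> (L n)\<bar> > \<epsilon> * c n / 2)) \<le> perm_avg n (\<lambda>\<pi>. h (S n \<pi> (L n) / c n))"
        proof (rule perm_avg_mono)
          fix \<pi>
          show "of_bool (\<bar>S n \<pi> (L n)\<bar> > \<epsilon> * c n / 2) \<le> h (S n \<pi> (L n) / c n)"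
          proof (cases "\<bar>S n \<pi> (L n)\<bar> > \<epsilon> * c n / 2")
            case True
            then have "1 \<le> \<bar>2 / \<epsilon> * (S n \<pi> (L n) / c n)\<bar>"
              using \<epsilon> c_pos by (simp add: abs_mult field_simps)
            then have "1 \<le> \<bar>2 / \<epsilon> * (S n \<pi> (L n) / c n)\<bar> ^ 6" by (rule one_le_power)
            also have "\<dots> = (2 / \<epsilon> * (S n \<pi> (L n) / c n)) ^ 6" by (rule power_even_abs) simp
            finally have "1 \<le> h (S n \<pi> (L n) / c n)" unfolding h_def by simp
            then show ?thesis by (rule order_trans[rotated]) simp
          qed (use h01 in simp)
        qed
        finally show "perm_avg n (\<lambda>\<pi>. of_bool (max_exceeds (x n) (L n) (\<epsilon> * c n) 0 \<pi>))
            \<le> 2 * (15 * (2 / \<epsilon>) ^ 6 * (s / real m) ^ 3 + 1 / real m ^ 3)"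
          using elim(1) I by simp
      qed simp
      also have "\<dots> = K / real m"
        using m by (simp add: K_def field_simps power3_eq_cube)
      also have "\<dots> \<le> \<epsilon>"
        using \<open>real m > K / \<epsilon>\<close> \<epsilon> m by (simp add: field_simps)
      finally show ?case by (simp add: L_def)
    qed
  qed
qed

end

section \<open>Comparison with Brownian motion\<close>

lemma brownian_increment_integral:
  fixes h :: "real \<Rightarrow> real"
  assumes B: "standard_brownian_motion N B" and t: "0 \<le> r" "r < t" and \<sigma>: "\<sigma> \<ge> 0"
    and h: "h \<in> borel_measurable borel"
  shows "(\<integral>\<omega>. h (\<sigma> * (B t \<omega> - B r \<omega>)) \<partial>N) = integral\<^sup>L (centered_gaussian (\<sigma>\<^sup>2 * (t - r))) h"
proof -
  interpret prob_space N using B by (simp add: standard_brownian_motion_def)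
  define d where "d = sqrt (t - r)"
  have d: "d > 0" using t by (simp add: d_def)
  have "distributed N lborel (\<lambda>\<omega>. B t \<omega> - B r \<omega>) (normal_density 0 d)"
    using B t unfolding standard_brownian_motion_def d_def by blast
  then have Z: "distributed N lborel (\<lambda>\<omega>. (B t \<omega> - B r \<omega>) / d) std_normal_density"
    using normal_standard_normal_convert[OF d, of "\<lambda>\<omega>. B t \<omega> - B r \<omega>" 0] by simp
  have sq: "sqrt (\<sigma>\<^sup>2 * (t - r)) = \<sigma> * d"
    using \<sigma> by (simp add: d_def real_sqrt_mult)
  have meas: "(\<lambda>z. h (\<sigma> * d * z)) \<in> borel_measurable borel"
    by (rule measurable_compose[OF _ h]) simp
  have "integral\<^sup>L (centered_gaussian (\<sigma>\<^sup>2 * (t - r))) h = (\<integral>z. h (\<sigma> * d * z) \<partial>std_normal_distribution)"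
    unfolding integral_centered_gaussian[OF h] sq ..
  also have "\<dots> = (\<integral>z. std_normal_density z * h (\<sigma> * d * z) \<partial>lborel)"
    using meas by (subst integral_density) auto
  also have "\<dots> = (\<integral>\<omega>. h (\<sigma> * d * ((B t \<omega> - B r \<omega>) / d)) \<partial>N)"
    using meas by (intro distributed_integral[OF Z]) auto
  finally show ?thesis using d by simp
qed

lemma brownian_product:
  fixes h :: "nat \<Rightarrow> real \<Rightarrow> real"
  assumes B: "standard_brownian_motion N B" and m: "m > 0" and \<sigma>: "\<sigma> \<ge> 0"
    and h: "\<And>i. h i \<in> borel_measurable borel" "\<And>i. bounded (range (h i))"
  shows "(\<integral>\<omega>. (\<Prod>i<d. h i (\<sigma> * (B (real (Suc i) / real m) \<omega> - B (real i / real m) \<omega>))) \<partial>N)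
    = (\<Prod>i<d. integral\<^sup>L (centered_gaussian (\<sigma>\<^sup>2 / real m)) (h i))"
proof -
  interpret prob_space N using B by (simp add: standard_brownian_motion_def)
  let ?I = "\<lambda>i \<omega>. B (real (Suc i) / real m) \<omega> - B (real i / real m) \<omega>"
  have mono: "strict_mono (\<lambda>i. real i / real m)"
    using m by (auto simp: strict_mono_def divide_strict_right_mono)
  have "\<forall>(k::nat) \<tau>. 0 \<le> \<tau> 0 \<and> strict_mono \<tau> \<longrightarrow>
        indep_vars (\<lambda>_. borel) (\<lambda>i \<omega>. B (\<tau> (Suc i)) \<omega> - B (\<tau> i) \<omega>) {..<k}"
    using B by (simp add: standard_brownian_motion_def)
  from this[rule_format, of "\<lambda>i. real i / real m" d] mono
  have "indep_vars (\<lambda>_. borel) ?I {..<d}" by simp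
  then have ind: "indep_vars (\<lambda>_. borel) (\<lambda>i \<omega>. h i (\<sigma> * ?I i \<omega>)) {..<d}"
    by (rule indep_vars_compose2) (intro measurable_compose[OF _ h(1)], simp)
  have "(\<integral>\<omega>. (\<Prod>i<d. h i (\<sigma> * ?I i \<omega>)) \<partial>N) = (\<Prod>i<d. \<integral>\<omega>. h i (\<sigma> * ?I i \<omega>) \<partial>N)"
  proof (rule indep_vars_lebesgue_integral[OF _ ind])
    fix i assume i: "i \<in> {..<d}"
    obtain K where K: "\<And>y. \<bar>h i y\<bar> \<le> K" using h(2)[of i] by (auto simp: bounded_iff)
    have "(\<lambda>\<omega>. h i (\<sigma> * ?I i \<omega>)) \<in> borel_measurable N"
      using ind i by (simp add: indep_vars_def)
    then show "integrable N (\<lambda>\<omega>. h i (\<sigma> * ?I i \<omega>))"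
      by (intro integrable_const_bound[where B = K]) (use K in auto)
  qed simp
  also have "\<dots> = (\<Prod>i<d. integral\<^sup>L (centered_gaussian (\<sigma>\<^sup>2 / real m)) (h i))"
  proof (rule prod.cong[OF refl])
    fix i
    have "real (Suc i) / real m - real i / real m = 1 / real m"
      by (simp flip: diff_divide_distrib)
    then show "(\<integral>\<omega>. h i (\<sigma> * ?I i \<omega>) \<partial>N) = integral\<^sup>L (centered_gaussian (\<sigma>\<^sup>2 / real m)) (h i)"
      using brownian_increment_integral[OF B _ _ \<sigma> h(1)[of i], of "real i / real m" "real (Suc i) / real m"] m
      by (simp add: divide_strict_right_mono)
  qed
  finally show ?thesis .
qed

lemma brownian_continuous_process:
  assumes B: "standard_brownian_motion N B"
  shows "continuous_process N (\<lambda>\<omega>. \<lambda>t\<in>{0..}. \<sigma> * B t \<omega>)"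
proof (rule continuous_process.intro)
  show "prob_space N" using B by (simp add: standard_brownian_motion_def)
  fix t :: real assume t: "t \<ge> 0"
  then have "B t \<in> borel_measurable N" using B by (simp add: standard_brownian_motion_def)
  then show "(\<lambda>\<omega>. (\<lambda>t\<in>{0..}. \<sigma> * B t \<omega>) t) \<in> borel_measurable N" using t by simp
next
  fix \<omega> assume "\<omega> \<in> space N"
  then have "continuous_on {0..} (\<lambda>t. \<sigma> * B t \<omega>)"
    using B by (auto simp: standard_brownian_motion_def intro!: continuous_on_mult_left)
  then show c: "continuous_on {0..} (\<lambda>t\<in>{0..}. \<sigma> * B t \<omega>)"
    by (rule continuous_on_eq) simp
  show "(\<lambda>t\<in>{0..}. \<sigma> * B t \<omega>) \<in> cadlag_paths"
    unfolding cadlag_paths_def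
  proof (intro CollectI conjI allI impI)
    let ?x = "\<lambda>t\<in>{0..}. \<sigma> * B t \<omega>"
    fix t :: real assume t: "t \<ge> 0"
    then have "continuous (at t within {0..}) ?x"
      using c unfolding continuous_on_eq_continuous_within by blast
    then show "continuous (at_right t) ?x"
      by (rule continuous_within_subset) (use t in auto)
  next
    let ?x = "\<lambda>t\<in>{0..}. \<sigma> * B t \<omega>"
    fix t :: real assume t: "t > 0"
    have "continuous_on {0<..} ?x" by (rule continuous_on_subset[OF c]) auto
    then have "isCont ?x t"
      by (rule continuous_on_interior) (use t in \<open>simp add: interior_open\<close>)
    then show "\<exists>l. (?x \<longlongrightarrow> l) (at_left t)"
      unfolding isCont_def filterlim_at_split by blast
  qed simp
qed

section \<open>Discretisation and increments of the rescaled walk\<close>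

context population_sequence begin

definition scaled_path :: "nat \<Rightarrow> (nat \<Rightarrow> nat) \<Rightarrow> real \<Rightarrow> real" where
  "scaled_path n \<pi> = (\<lambda>t\<in>{0..}. S n \<pi> (steps t n) / c n)"

lemma scaled_path_cadlag: "n \<ge> 1 \<Longrightarrow> scaled_path n \<pi> \<in> cadlag_paths"
  using floor_step_cadlag[of "(c n)\<^sup>2" "\<lambda>k. S n \<pi> k / c n"] c_ge_1[of n]
  by (simp add: scaled_path_def steps_def mult.commute)

lemma scaled_path_grid_dist:
  assumes n: "n \<ge> 1" and m: "m > 0" "1 / (1 + real m) \<le> \<epsilon>"
    and small: "\<not> (\<exists>i<m * m. max_exceeds (x n) (steps (1 / real m) n + 1) (\<epsilon> * c n) (steps (real i / real m) n) \<pi>)"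
  shows "path_dist (scaled_path n \<pi>) (grid_path m (scaled_path n \<pi>)) \<le> \<epsilon>"
proof (rule path_dist_le_window[of "real m"])
  fix t assume t: "0 \<le> t" "t < real m"
  define i where "i = nat \<lfloor>real m * t\<rfloor>"
  define a where "a = steps (real i / real m) n"
  have "real i = of_int \<lfloor>real m * t\<rfloor>" using t by (simp add: i_def)
  then have i: "real i \<le> real m * t" "real m * t < real i + 1" by linarith+
  have c: "c n > 0" using c_ge_1[OF n] by simp
  have "real m * t < real m * real m" using t m by simp
  then have "real i < real (m * m)" using i by simp
  then have im: "i < m * m" by (simp only: of_nat_less_iff)
  have ti: "real i / real m \<le> t" "t < real i / real m + 1 / real m"
    using i m by (simp_all add: field_simps)
  have "a \<le> steps t n" unfolding a_def by (rule steps_mono[OF ti(1)])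
  then obtain k where k: "steps t n = a + k" using le_Suc_ex by blast
  have "t * (c n)\<^sup>2 \<le> (real i / real m + 1 / real m) * (c n)\<^sup>2"
    using ti by (intro mult_right_mono) auto
  \<comment> \<open>Undoing the two floors on the right costs less than 1 each; as the counts are
    integers, an excess below 2 is at most 1.\<close>
  then have "real (steps t n) < real a + real (steps (1 / real m) n) + 2"
    using steps_bounds[of t n] steps_bounds[of "real i / real m" n] steps_bounds[of "1 / real m" n] t
    by (simp add: a_def distrib_right)
  then have "k \<le> steps (1 / real m) n + 1" using k by linarith
  then have "\<bar>S n \<pi> (a + k) - S n \<pi> a\<bar> \<le> \<epsilon> * c n"
    using small im unfolding max_exceeds_def a_def by (metis not_less)
  then have "\<bar>S n \<pi> (a + k) / c n - S n \<pi> a / c n\<bar> \<le> \<epsilon>"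
    using c by (simp add: divide_le_eq flip: diff_divide_distrib)
  moreover have "grid_path m (scaled_path n \<pi>) t = S n \<pi> a / c n"
    using t by (simp add: grid_path_apply i_def[symmetric] scaled_path_def a_def)
  ultimately show "\<bar>scaled_path n \<pi> t - grid_path m (scaled_path n \<pi>) t\<bar> \<le> \<epsilon>"
    using t by (simp add: scaled_path_def k)
qed (use m in auto)

theorem scaled_path_process_approximation:
  assumes B: "standard_brownian_motion N B" and \<sigma>: "\<sigma> \<ge> 0" "s = \<sigma>\<^sup>2"
  shows "process_approximation N (\<lambda>\<omega>. \<lambda>t\<in>{0..}. \<sigma> * B t \<omega>)
    (\<lambda>n. pmf_of_set {\<pi>. \<pi> permutes {..<n}}) scaled_path"
proof -
  interpret Y: continuous_process N "\<lambda>\<omega>. \<lambda>t\<in>{0..}. \<sigma> * B t \<omega>"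
    by (rule brownian_continuous_process[OF B])
  show ?thesis
  proof
    show "\<forall>\<^sub>F n in sequentially. \<forall>\<pi>. scaled_path n \<pi> \<in> cadlag_paths"
      using eventually_ge_at_top[of 1] by eventually_elim (simp add: scaled_path_cadlag)
  next
    fix e :: real assume e: "e > 0"
    have "(\<lambda>m. 1 / (1 + real m)) \<longlonglongrightarrow> 0"
      using LIMSEQ_inverse_real_of_nat by (simp add: inverse_eq_divide add.commute)
    then have "\<forall>\<^sub>F m in sequentially. 1 / (1 + real m) < e / 2"
      using e by (intro order_tendstoD) auto
    with max_increment_tendsto[OF half_gt_zero[OF e]] eventually_gt_at_top[of 0]
    show "\<forall>\<^sub>F m in sequentially. \<forall>\<^sub>F n in sequentially.
        measure_pmf.expectation (pmf_of_set {\<pi>. \<pi> permutes {..<n}}) (\<lambda>\<pi>. path_dist (scaled_path n \<pi>) (grid_path m (scaled_path n \<pi>))) \<le> e"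
      unfolding perm_avg_eq_expectation[symmetric]
    proof (eventually_elim, goal_cases)
      case (1 m)
      let ?bad = "\<lambda>n \<pi>. \<exists>i<m * m. max_exceeds (x n) (steps (1 / real m) n + 1) (e / 2 * c n) (steps (real i / real m) n) \<pi>"
      from 1(1) eventually_ge_at_top[of 1] show ?case
      proof (eventually_elim, goal_cases)
        case (1 n)
        have "perm_avg n (\<lambda>\<pi>. path_dist (scaled_path n \<pi>) (grid_path m (scaled_path n \<pi>)))
           \<le> perm_avg n (\<lambda>\<pi>. e / 2 + of_bool (?bad n \<pi>))"
        proof (rule perm_avg_mono)
          fix \<pi>
          show "path_dist (scaled_path n \<pi>) (grid_path m (scaled_path n \<pi>)) \<le> e / 2 + of_bool (?bad n \<pi>)"
          \<comment> \<open>The metric is bounded by 1, so the bad event costs no more than its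
            probability.\<close>
          proof (cases "?bad n \<pi>")
            case True
            then show ?thesis using path_dist_le_1[of "scaled_path n \<pi>" "grid_path m (scaled_path n \<pi>)"] e by simp
          next
            case False
            then have "path_dist (scaled_path n \<pi>) (grid_path m (scaled_path n \<pi>)) \<le> e / 2"
              using 1 \<open>0 < m\<close> \<open>1 / (1 + real m) < e / 2\<close> by (intro scaled_path_grid_dist) auto
            then show ?thesis using False by simp
          qed
        qed
        also have "\<dots> = e / 2 + perm_avg n (\<lambda>\<pi>. of_bool (?bad n \<pi>))"
          by (simp add: perm_avg_add)
        finally show ?case using 1 e by simp
      qed
    qed
  next
    fix m d :: nat and G :: "(nat \<Rightarrow> real) \<Rightarrow> real"
    assume m: "m > 0" and G: "continuous_on UNIV G" "bounded (range G)"
      and dep: "\<And>v w. (\<And>i. i \<le> d \<Longrightarrow> v i = w i) \<Longrightarrow> G v = G w"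
    define inc where "inc = (\<lambda>v i. v (real (Suc i) / real m) - v (real i / real m) :: real)"
    interpret product_convergence N "\<lambda>\<omega>. inc (\<lambda>t\<in>{0..}. \<sigma> * B t \<omega>)"
      "\<lambda>n. pmf_of_set {\<pi>. \<pi> permutes {..<n}}" "\<lambda>n \<pi>. inc (scaled_path n \<pi>)" d
    proof
      show "(\<lambda>\<omega>. inc (\<lambda>t\<in>{0..}. \<sigma> * B t \<omega>) i) \<in> borel_measurable N" for i
        unfolding inc_def by (intro borel_measurable_diff Y.coordinate_measurable) auto
      fix h :: "nat \<Rightarrow> real \<Rightarrow> real"
      assume h: "\<And>i. continuous_on UNIV (h i)" "\<And>i. bounded (range (h i))"
      have "(\<integral>\<omega>. (\<Prod>i\<le>d. h i (inc (\<lambda>t\<in>{0..}. \<sigma> * B t \<omega>) i)) \<partial>N) = (\<Prod>i<Suc d. integral\<^sup>L (centered_gaussian (s / real m)) (h i))"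
        using brownian_product[OF B m \<sigma>(1) borel_measurable_continuous_onI[OF h(1)] h(2), where d = "Suc d"]
        by (simp add: inc_def \<sigma>(2) lessThan_Suc_atMost right_diff_distrib)
      then show "(\<lambda>n. measure_pmf.expectation (pmf_of_set {\<pi>. \<pi> permutes {..<n}}) (\<lambda>\<pi>. \<Prod>i\<le>d. h i (inc (scaled_path n \<pi>) i)))
          \<longlonglongrightarrow> (\<integral>\<omega>. (\<Prod>i\<le>d. h i (inc (\<lambda>t\<in>{0..}. \<sigma> * B t \<omega>) i)) \<partial>N)"
        using products_tendsto[OF h m, where d = "Suc d"]
        unfolding perm_avg_eq_expectation[symmetric]
        by (simp add: inc_def scaled_path_def lessThan_Suc_atMost diff_divide_distrib)
    qed
    \<comment> \<open>Independence concerns increments, whereas \<open>G\<close> reads values.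
      Partial sums translate between them because both processes start at 0.\<close>
    define H where "H = (\<lambda>y :: nat \<Rightarrow> real. G (\<lambda>i. \<Sum>j<i. y j))"
    have "continuous_on UNIV H"
      unfolding H_def
      by (rule continuous_on_compose2[OF G(1)]) (auto intro!: continuous_intros continuous_on_product_coordinates)
    moreover have "bounded (range H)"
      by (rule bounded_subset[OF G(2)]) (auto simp: H_def)
    moreover have "H v = H w" if "\<And>i. i \<le> d \<Longrightarrow> v i = w i" for v w
      unfolding H_def by (rule dep) (auto intro!: sum.cong that)
    ultimately have lim: "(\<lambda>n. measure_pmf.expectation (pmf_of_set {\<pi>. \<pi> permutes {..<n}}) (\<lambda>\<pi>. H (inc (scaled_path n \<pi>))))
        \<longlonglongrightarrow> Y.expectation (\<lambda>\<omega>. H (inc (\<lambda>t\<in>{0..}. \<sigma> * B t \<omega>)))"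
      by (rule continuous_converges)
    have tele: "H (inc v) = G (\<lambda>i. v (real i / real m))" if "v 0 = 0" for v
    proof -
      have "(\<Sum>j<i. inc v j) = v (real i / real m)" for i
        unfolding inc_def using sum_lessThan_telescope[of "\<lambda>j. v (real j / real m)" i] that by simp
      then show ?thesis by (simp add: H_def)
    qed
    have "H (inc (scaled_path n \<pi>)) = G (\<lambda>i. scaled_path n \<pi> (real i / real m))" for n \<pi>
      by (rule tele) (simp add: scaled_path_def steps_def partial_sum_def)
    moreover have "Y.expectation (\<lambda>\<omega>. H (inc (\<lambda>t\<in>{0..}. \<sigma> * B t \<omega>)))
        = Y.expectation (\<lambda>\<omega>. G (\<lambda>i. (\<lambda>t\<in>{0..}. \<sigma> * B t \<omega>) (real i / real m)))"
      by (intro Bochner_Integration.integral_cong refl tele)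
        (use B in \<open>simp add: standard_brownian_motion_def\<close>)
    ultimately show "(\<lambda>n. measure_pmf.expectation (pmf_of_set {\<pi>. \<pi> permutes {..<n}}) (\<lambda>\<pi>. G (\<lambda>i. scaled_path n \<pi> (real i / real m))))
        \<longlonglongrightarrow> Y.expectation (\<lambda>\<omega>. G (\<lambda>i. (\<lambda>t\<in>{0..}. \<sigma> * B t \<omega>) (real i / real m)))"
      using lim by simp
  qed
qed

end

section \<open>Degree sequences\<close>

text \<open>Convergent partial sums of natural numbers are eventually constant.\<close>

lemma summable_nat_finite_support:
  fixes s :: "nat \<Rightarrow> nat"
  assumes "summable s"
  shows "finite {i. s i \<noteq> 0}"
proof -
  obtain l where "s sums l" using assms by (auto simp: summable_def)
  then have "\<forall>\<^sub>F n in sequentially. (\<Sum>i<n. s i) = l"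
    by (simp add: sums_def tendsto_discrete)
  then obtain M where M: "\<And>n. n \<ge> M \<Longrightarrow> (\<Sum>i<n. s i) = l"
    by (auto simp: eventually_sequentially)
  have "s n = 0" if "n \<ge> M" for n
  proof -
    have "(\<Sum>i<Suc n. s i) = (\<Sum>i<n. s i)"
      unfolding M[OF that] M[OF le_SucI[OF that]] ..
    then show ?thesis by simp
  qed
  then have "{i. s i \<noteq> 0} \<subseteq> {..<M}"
    by (intro subsetI) (metis lessThan_iff mem_Collect_eq not_le)
  then show ?thesis using finite_subset by blast
qed

lemma sum_mset_image_count:
  fixes f :: "'a \<Rightarrow> real"
  shows "sum_mset (image_mset f A) = (\<Sum>a\<in>set_mset A. real (count A a) * f a)"
proof (induction A)
  case (add a A)
  have "(\<Sum>b\<in>set_mset (add_mset a A). real (count (add_mset a A) b) * f b)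
      = (\<Sum>b\<in>insert a (set_mset A). real (count A b) * f b + (if b = a then f b else 0))"
    by (intro sum.cong) (auto simp: distrib_right)
  also have "\<dots> = (\<Sum>b\<in>insert a (set_mset A). real (count A b) * f b) + f a"
    by (simp add: sum.distrib)
  also have "(\<Sum>b\<in>insert a (set_mset A). real (count A b) * f b) = (\<Sum>b\<in>set_mset A. real (count A b) * f b)"
    by (rule sum.mono_neutral_right) (auto simp: not_in_iff)
  finally show ?case using add by simp
qed simp

text \<open>Turns statistics of the vector into series over degrees, the form in which the
  convergence to \<open>p\<close> is given.\<close>

lemma sum_degree_vector:
  fixes f :: "nat \<Rightarrow> real"
  assumes "summable s"
  shows "(\<Sum>j<length (degree_vector s). f (degree_vector s ! j)) = (\<Sum>i. real (s i) * f i)"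
proof -
  have fin: "finite {i. s i \<noteq> 0}" by (rule summable_nat_finite_support[OF assms])
  then have count: "count (Abs_multiset s) = s"
    by (intro count_Abs_multiset) simp
  have "(\<Sum>j<length (degree_vector s). f (degree_vector s ! j)) = sum_list (map f (degree_vector s))"
    by (simp add: sum_list_sum_nth atLeast0LessThan)
  also have "\<dots> = sum_mset (image_mset f (Abs_multiset s))"
    by (simp add: degree_vector_def flip: sum_mset_sum_list)
  also have "\<dots> = (\<Sum>i\<in>{i. s i \<noteq> 0}. real (s i) * f i)"
    unfolding sum_mset_image_count count set_mset_def by simp
  also have "\<dots> = (\<Sum>i. real (s i) * f i)"
    by (rule suminf_finite[symmetric]) (use fin in auto)
  finally show ?thesis .
qed

lemma length_degree_vector:
  assumes "summable s"
  shows "length (degree_vector s) = (\<Sum>i. s i)"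
proof -
  have fin: "finite {i. s i \<noteq> 0}" by (rule summable_nat_finite_support[OF assms])
  have "real (length (degree_vector s)) = (\<Sum>i. real (s i))"
    using sum_degree_vector[OF assms, of "\<lambda>_. 1"] by simp
  also have "\<dots> = (\<Sum>i\<in>{i. s i \<noteq> 0}. real (s i))"
    by (rule suminf_finite) (use fin in auto)
  also have "\<dots> = real (\<Sum>i\<in>{i. s i \<noteq> 0}. s i)" by simp
  also have "(\<Sum>i\<in>{i. s i \<noteq> 0}. s i) = (\<Sum>i. s i)"
    by (rule suminf_finite[symmetric]) (use fin in auto)
  finally show ?thesis by (simp only: of_nat_eq_iff)
qed

lemma degree_excess_eq_sum:
  assumes "summable s"
  shows "(\<Sum>j<length (degree_vector s). real (degree_vector s ! j) - 1) = - real_of_int (degree_excess s)"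
proof -
  have fin: "finite {i. s i \<noteq> 0}" by (rule summable_nat_finite_support[OF assms])
  have "real_of_int (degree_excess s) = (\<Sum>i\<in>{i. s i \<noteq> 0}. (1 - real i) * real (s i))"
    unfolding degree_excess_def by (subst suminf_finite[OF fin]) auto
  moreover have "(\<Sum>i. real (s i) * (real i - 1)) = (\<Sum>i\<in>{i. s i \<noteq> 0}. real (s i) * (real i - 1))"
    by (rule suminf_finite) (use fin in auto)
  ultimately show ?thesis
    unfolding sum_degree_vector[OF assms, of "\<lambda>i. real i - 1"]
    by (simp add: algebra_simps flip: sum_negf)
qed

section \<open>Expectations under convergence in L2\<close>

lemma pmf_nat_sums:
  fixes f :: "nat \<Rightarrow> real"
  assumes "integrable (measure_pmf p) f"
  shows "(\<lambda>i. pmf p i * f i) sums measure_pmf.expectation p f"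
proof -
  have "integrable (count_space UNIV) (\<lambda>i. pmf p i * f i)"
    using assms unfolding measure_pmf_eq_density by (subst (asm) integrable_density) auto
  from sums_integral_count_space_nat[OF this] show ?thesis
    unfolding measure_pmf_eq_density by (subst integral_density) auto
qed

lemma pmf_nat_summable_abs:
  fixes f :: "nat \<Rightarrow> real"
  assumes "integrable (measure_pmf p) f"
  shows "summable (\<lambda>i. pmf p i * \<bar>f i\<bar>)"
  using pmf_nat_sums[of p "\<lambda>i. \<bar>f i\<bar>"] assms by (auto simp: sums_iff)

text \<open>The weight i^2 vanishes at i = 0, so the second-moment condition is blind there and
  coordinatewise convergence at 0 has to help; this explains the shape of the bound on
  \<open>f\<close>. The function may vary with n, as the truncated square does.\<close>

lemma L2_convergent_expectation:
  fixes f :: "nat \<Rightarrow> nat \<Rightarrow> real"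
  assumes L2: "L2_convergent_to q (pmf p)"
    and fv: "integrable (measure_pmf p) (\<lambda>i. (real i)\<^sup>2)"
    and fin: "\<And>n. n \<ge> 1 \<Longrightarrow> finite {i. q n i \<noteq> 0}"
    and f: "\<And>n i. \<bar>f n i\<bar> \<le> of_bool (i = 0) + (real i)\<^sup>2"
  shows "(\<lambda>n. (\<Sum>i. q n i * f n i) - measure_pmf.expectation p (f n)) \<longlonglongrightarrow> 0"
proof -
  have fi: "integrable (measure_pmf p) (f n)" for n
  proof (rule Bochner_Integration.integrable_bound)
    show "integrable (measure_pmf p) (\<lambda>i. 1 + (real i)\<^sup>2)" using fv by simp
    show "AE i in measure_pmf p. norm (f n i) \<le> norm (1 + (real i)\<^sup>2)"
      using f[of n] by (auto intro!: AE_I2 order_trans[OF f[of n]] simp: add_nonneg_nonneg)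
  qed simp
  have "(\<lambda>n. \<bar>q n 0 - pmf p 0\<bar> + (\<Sum>i. (real i)\<^sup>2 * \<bar>q n i - pmf p i\<bar>)) \<longlonglongrightarrow> \<bar>pmf p 0 - pmf p 0\<bar> + 0"
    using L2 unfolding L2_convergent_to_def by (intro tendsto_intros) auto
  then have R: "(\<lambda>n. \<bar>q n 0 - pmf p 0\<bar> + (\<Sum>i. (real i)\<^sup>2 * \<bar>q n i - pmf p i\<bar>)) \<longlonglongrightarrow> 0" by simp
  show ?thesis
  proof (rule Lim_null_comparison[OF _ R], use eventually_ge_at_top[of 1] in eventually_elim)
    case (elim n)
    have finsum: "summable (\<lambda>i. q n i * g i)" "summable (\<lambda>i. \<bar>q n i\<bar> * g i)" for g :: "nat \<Rightarrow> real"
      by (rule summable_finite[OF fin[OF elim]]; simp)+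
    have sumD: "summable (\<lambda>i. \<bar>q n i - pmf p i\<bar> * \<bar>g i\<bar>)" if g: "integrable (measure_pmf p) g" for g
    proof (rule summable_comparison_test')
      show "summable (\<lambda>i. \<bar>q n i\<bar> * \<bar>g i\<bar> + pmf p i * \<bar>g i\<bar>)"
        by (intro summable_add finsum pmf_nat_summable_abs g)
      show "norm (\<bar>q n i - pmf p i\<bar> * \<bar>g i\<bar>) \<le> \<bar>q n i\<bar> * \<bar>g i\<bar> + pmf p i * \<bar>g i\<bar>" for i
      proof -
        have "\<bar>q n i - pmf p i\<bar> \<le> \<bar>q n i\<bar> + pmf p i"
          using abs_triangle_ineq4[of "q n i" "pmf p i"] by simp
        from mult_right_mono[OF this, of "\<bar>g i\<bar>"] show ?thesis by (simp add: distrib_right)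
      qed
    qed
    have sq: "summable (\<lambda>i. (real i)\<^sup>2 * \<bar>q n i - pmf p i\<bar>)"
      using sumD[OF fv] by (simp add: mult.commute)
    have "(\<Sum>i. q n i * f n i) - measure_pmf.expectation p (f n) = (\<Sum>i. q n i * f n i) - (\<Sum>i. pmf p i * f n i)"
      using pmf_nat_sums[OF fi] by (simp add: sums_iff)
    also have "\<dots> = (\<Sum>i. (q n i - pmf p i) * f n i)"
      using pmf_nat_sums[OF fi] finsum(1) by (subst suminf_diff) (auto simp: sums_iff left_diff_distrib)
    also have "norm \<dots> \<le> (\<Sum>i. norm ((q n i - pmf p i) * f n i))"
      by (rule summable_norm) (use sumD[OF fi] in \<open>simp add: abs_mult\<close>)
    also have "\<dots> \<le> (\<Sum>i. (if i = 0 then \<bar>q n 0 - pmf p 0\<bar> else 0) + (real i)\<^sup>2 * \<bar>q n i - pmf p i\<bar>)"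
    proof (rule suminf_le)
      show "norm ((q n i - pmf p i) * f n i) \<le> (if i = 0 then \<bar>q n 0 - pmf p 0\<bar> else 0) + (real i)\<^sup>2 * \<bar>q n i - pmf p i\<bar>" for i
        using mult_left_mono[OF f[of n i], of "\<bar>q n i - pmf p i\<bar>"]
        by (auto simp: abs_mult distrib_left mult.commute)
      show "summable (\<lambda>i. norm ((q n i - pmf p i) * f n i))" using sumD[OF fi] by (simp add: abs_mult)
      show "summable (\<lambda>i. (if i = 0 then \<bar>q n 0 - pmf p 0\<bar> else 0) + (real i)\<^sup>2 * \<bar>q n i - pmf p i\<bar>)"
        by (intro summable_add sq summable_finite[of "{0}"]) auto
    qed
    also have "\<dots> = (\<Sum>i. if i = 0 then \<bar>q n 0 - pmf p 0\<bar> else 0) + (\<Sum>i. (real i)\<^sup>2 * \<bar>q n i - pmf p i\<bar>)"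
      by (intro suminf_add[symmetric] sq summable_finite[of "{0}"]) auto
    also have "(\<Sum>i. if i = 0 then \<bar>q n 0 - pmf p 0\<bar> else 0 :: real) = \<bar>q n 0 - pmf p 0\<bar>"
      by (subst suminf_finite[of "{0}"]) auto
    finally show ?case .
  qed
qed

text \<open>The value \<open>0\<close> beyond \<open>n\<close> reflects that the walk is frozen after \<open>n\<close> steps.\<close>

definition degree_steps :: "(nat \<Rightarrow> nat \<Rightarrow> nat) \<Rightarrow> nat \<Rightarrow> nat \<Rightarrow> real" where
  "degree_steps s n j = (if j < n then real (degree_vector (s n) ! j) - 1 else 0)"

lemma scaled_walk_permute_list:
  assumes len: "length (degree_vector (s n)) = n" and \<pi>: "\<pi> permutes {..<n}"
  shows "scaled_walk c (permute_list \<pi> (degree_vector (s n)))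
    = (\<lambda>t\<in>{0..}. partial_sum (degree_steps s n) \<pi> (nat \<lfloor>t * (real_of_int c)\<^sup>2\<rfloor>) / real_of_int c)"
proof -
  have "real_of_int (walk (permute_list \<pi> (degree_vector (s n))) k) = partial_sum (degree_steps s n) \<pi> k" for k
  proof -
    have "\<pi> j < n \<longleftrightarrow> j < n" for j
      using permutes_in_image[OF \<pi>, of j] by simp
    then have "partial_sum (degree_steps s n) \<pi> k
        = (\<Sum>j<k. if j < n then real (degree_vector (s n) ! \<pi> j) - 1 else 0)"
      by (simp add: partial_sum_def degree_steps_def)
    also have "\<dots> = (\<Sum>j\<in>{..<k} \<inter> {j. j < n}. real (degree_vector (s n) ! \<pi> j) - 1)"
      by (simp add: sum.inter_restrict)
    also have "{..<k} \<inter> {j. j < n} = {..<min k n}" by auto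
    finally show ?thesis
      using len \<pi> by (simp add: walk_def permute_list_nth)
  qed
  then show ?thesis by (simp add: scaled_walk_def)
qed

text \<open>Integrality turns a positive excess into \<open>c n\<close> \<ge> 1. The limits of
  energy and Lindeberg sum are those of the corresponding expectations under \<open>p\<close>, the
  latter by dominated convergence.\<close>

lemma degree_population_sequence:
  fixes p :: "nat pmf" and s :: "nat \<Rightarrow> nat \<Rightarrow> nat"
  defines "c \<equiv> (\<lambda>n. degree_excess (s n))"
  assumes mean: "measure_pmf.expectation p real = 1"
    and finite_variance: "integrable (measure_pmf p) (\<lambda>i. (real i)\<^sup>2)"
    and variance: "measure_pmf.variance p real = \<sigma>\<^sup>2" "\<sigma> \<ge> 0"
    and degree_sequence: "\<And>n. n \<ge> 1 \<Longrightarrow> degree_sequence (s n)"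
    and size: "\<And>n. n \<ge> 1 \<Longrightarrow> (\<Sum>i. s n i) = n"
    and excess_small: "(\<lambda>n. real_of_int (c n)) \<in> o(\<lambda>n. real n powr (1 / 2))"
    and excess_unbounded: "\<sigma> > 0 \<Longrightarrow> filterlim c at_top sequentially"
    and L2: "L2_convergent_to (\<lambda>n i. real (s n i) / real n) (pmf p)"
  shows "population_sequence (degree_steps s) (\<lambda>n. real_of_int (c n)) (\<sigma>\<^sup>2)"
proof
  have sm: "summable (s n)" if "n \<ge> 1" for n
    using degree_sequence[OF that] by (simp add: degree_sequence_def)
  have len: "length (degree_vector (s n)) = n" if "n \<ge> 1" for n
    using length_degree_vector[OF sm[OF that]] size[OF that] by simp
  have fin: "finite {i. real (s n i) / real n \<noteq> 0}" if "n \<ge> 1" for n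
    by (rule finite_subset[OF _ summable_nat_finite_support[OF sm[OF that]]]) auto
  show cge: "1 \<le> real_of_int (c n)" if "n \<ge> 1" for n
    using degree_sequence[OF that] by (simp add: degree_sequence_def c_def)
  have sumn: "(\<Sum>j<n. f (degree_steps s n j)) / real n = (\<Sum>i. real (s n i) / real n * f (real i - 1))"
    if "n \<ge> 1" for f :: "real \<Rightarrow> real" and n
  proof -
    have "(\<Sum>j<n. f (degree_steps s n j)) = (\<Sum>j<n. f (real (degree_vector (s n) ! j) - 1))"
      by (simp add: degree_steps_def)
    also have "\<dots> = (\<Sum>i. real (s n i) * f (real i - 1))"
      using sum_degree_vector[OF sm[OF that], of "\<lambda>i. f (real i - 1)"] len[OF that] by simp
    finally have "(\<Sum>j<n. f (degree_steps s n j)) / real n = (\<Sum>i. real (s n i) * f (real i - 1)) / real n" by simp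
    also have "\<dots> = (\<Sum>i. real (s n i) * f (real i - 1) / real n)"
      by (rule suminf_divide[symmetric], rule summable_finite[OF summable_nat_finite_support[OF sm[OF that]]]) simp
    finally show ?thesis by simp
  qed
  show "(\<Sum>j<n. degree_steps s n j) = - real_of_int (c n)" if "n \<ge> 1" for n
    using degree_excess_eq_sum[OF sm[OF that]] len[OF that] by (simp add: degree_steps_def c_def)
  show "0 \<le> \<sigma>\<^sup>2" by simp
  have "(\<lambda>n. real_of_int (c n) / real n powr (1 / 2)) \<longlonglongrightarrow> 0"
    by (rule smalloD_tendsto[OF excess_small])
  then have "(\<lambda>n. (real_of_int (c n) / real n powr (1 / 2))\<^sup>2) \<longlonglongrightarrow> 0\<^sup>2"
    by (rule tendsto_power)
  then show "(\<lambda>n. (real_of_int (c n))\<^sup>2 / real n) \<longlonglongrightarrow> 0"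
    by (simp add: power_divide powr_half_sqrt)
  have sq_le: "(real i - 1)\<^sup>2 \<le> of_bool (i = 0) + (real i)\<^sup>2" for i :: nat
    by (cases i) (auto simp: power_mono)
  \<comment> \<open>With mean 1 the second moment of i - 1 is the variance.\<close>
  have e1: "measure_pmf.expectation p (\<lambda>i. (real i - 1)\<^sup>2) = \<sigma>\<^sup>2"
    using variance(1) by (simp add: mean)
  have "(\<lambda>n. (\<Sum>i. real (s n i) / real n * (real i - 1)\<^sup>2) - measure_pmf.expectation p (\<lambda>i. (real i - 1)\<^sup>2)) \<longlonglongrightarrow> 0"
    by (rule L2_convergent_expectation[OF L2 finite_variance fin]) (use sq_le in auto)
  then have "(\<lambda>n. \<Sum>i. real (s n i) / real n * (real i - 1)\<^sup>2) \<longlonglongrightarrow> \<sigma>\<^sup>2"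
    unfolding e1 by (simp add: LIM_zero_iff)
  then show en: "(\<lambda>n. energy n (degree_steps s n) / real n) \<longlonglongrightarrow> \<sigma>\<^sup>2"
  proof (rule Lim_transform_eventually)
    show "\<forall>\<^sub>F n in sequentially. (\<Sum>i. real (s n i) / real n * (real i - 1)\<^sup>2) = energy n (degree_steps s n) / real n"
      using eventually_ge_at_top[of 1] by eventually_elim (use sumn[of _ "\<lambda>y. y\<^sup>2"] in \<open>simp add: energy_def\<close>)
  qed
  have c_top: "filterlim (\<lambda>n. real_of_int (c n)) at_top sequentially" if "\<sigma> > 0"
    using excess_unbounded[OF that] by (rule filterlim_compose[OF filterlim_real_of_int_at_top])
  show "(\<lambda>n. \<sigma>\<^sup>2 / (real_of_int (c n))\<^sup>2) \<longlonglongrightarrow> 0"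
  proof (cases "\<sigma> = 0")
    case False
    then have "(\<lambda>n. \<sigma>\<^sup>2 / real_of_int (c n) ^ 2) \<longlonglongrightarrow> 0"
      using variance(2) c_top
      by (intro real_tendsto_divide_at_top[OF tendsto_const] filterlim_pow_at_top) auto
    then show ?thesis by simp
  qed simp
  show "(\<lambda>n. truncated_energy n (degree_steps s n) (real_of_int (c n)) / real n) \<longlonglongrightarrow> 0"
  proof (cases "\<sigma> = 0")
    \<comment> \<open>Here \<open>c\<close> may stay bounded, so truncation does not help; the full
      energy already vanishes in the limit.\<close>
    case True
    have lim: "(\<lambda>n. energy n (degree_steps s n) / real n) \<longlonglongrightarrow> 0" using en True by simp
    show ?thesis
    proof (rule Lim_null_comparison[OF _ lim], use eventually_ge_at_top[of 1] in eventually_elim)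
      case (elim n)
      have "0 \<le> truncated_energy n (degree_steps s n) (real_of_int (c n))"
        unfolding truncated_energy_def using cge[OF elim] by (intro sum_nonneg mult_nonneg_nonneg) auto
      moreover have "truncated_energy n (degree_steps s n) (real_of_int (c n)) \<le> energy n (degree_steps s n)"
        unfolding truncated_energy_def energy_def by (intro sum_mono mult_left_le) auto
      ultimately show ?case by (simp add: divide_right_mono)
    qed
  next
    case False
    \<comment> \<open>The maximum with 1 keeps the denominator positive at n = 0, where nothing is
      assumed about \<open>s\<close>; for n \<ge> 1 it equals \<open>c n\<close>.\<close>
    define f where "f = (\<lambda>n i. (real i - 1)\<^sup>2 * min 1 (\<bar>real i - 1\<bar> / max 1 (real_of_int (c n))))"
    have f_abs: "\<bar>f n i\<bar> \<le> (real i - 1)\<^sup>2" for n i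
    proof -
      have "0 \<le> \<bar>real i - 1\<bar> / max 1 (real_of_int (c n))" by (intro divide_nonneg_pos) auto
      then have "\<bar>min 1 (\<bar>real i - 1\<bar> / max 1 (real_of_int (c n)))\<bar> \<le> 1" by linarith
      from mult_left_le[OF this, of "(real i - 1)\<^sup>2"] show ?thesis
        unfolding f_def abs_mult by simp
    qed
    have c_top': "filterlim (\<lambda>n. max 1 (real_of_int (c n))) at_top sequentially"
      by (rule filterlim_at_top_mono[OF c_top]) (use False variance(2) in auto)
    have "(\<lambda>n. measure_pmf.expectation p (f n)) \<longlonglongrightarrow> measure_pmf.expectation p (\<lambda>_. 0)"
    proof (rule integral_dominated_convergence[where w = "\<lambda>i. (real i - 1)\<^sup>2"])
      show "integrable (measure_pmf p) (\<lambda>i. (real i - 1)\<^sup>2)"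
      proof (rule Bochner_Integration.integrable_bound)
        show "integrable (measure_pmf p) (\<lambda>i. 1 + (real i)\<^sup>2)" using finite_variance by simp
        show "AE i in measure_pmf p. norm ((real i - 1)\<^sup>2) \<le> norm (1 + (real i)\<^sup>2)"
        proof (rule AE_I2)
          fix i
          have "(real i - 1)\<^sup>2 \<le> 1 + (real i)\<^sup>2" by (simp add: power2_diff)
          then show "norm ((real i - 1)\<^sup>2) \<le> norm (1 + (real i)\<^sup>2)" by simp
        qed
      qed simp
      show "AE i in measure_pmf p. (\<lambda>n. f n i) \<longlonglongrightarrow> 0"
      proof (rule AE_I2)
        fix i
        have "(\<lambda>n. \<bar>real i - 1\<bar> / max 1 (real_of_int (c n))) \<longlonglongrightarrow> 0"
          by (rule real_tendsto_divide_at_top[OF tendsto_const c_top'])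
        then have "(\<lambda>n. f n i) \<longlonglongrightarrow> (real i - 1)\<^sup>2 * min 1 0"
          unfolding f_def by (intro tendsto_intros)
        then show "(\<lambda>n. f n i) \<longlonglongrightarrow> 0" by simp
      qed
      show "AE i in measure_pmf p. norm (f n i) \<le> (real i - 1)\<^sup>2" for n
        using f_abs by (auto intro: AE_I2)
    qed auto
    moreover have "(\<lambda>n. (\<Sum>i. real (s n i) / real n * f n i) - measure_pmf.expectation p (f n)) \<longlonglongrightarrow> 0"
      by (rule L2_convergent_expectation[OF L2 finite_variance fin]) (use order_trans[OF f_abs sq_le] in auto)
    ultimately have "(\<lambda>n. ((\<Sum>i. real (s n i) / real n * f n i) - measure_pmf.expectation p (f n)) + measure_pmf.expectation p (f n)) \<longlonglongrightarrow> 0 + 0"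
      by (intro tendsto_add) simp_all
    then have "(\<lambda>n. \<Sum>i. real (s n i) / real n * f n i) \<longlonglongrightarrow> 0" by simp
    then show ?thesis
    proof (rule Lim_transform_eventually)
      show "\<forall>\<^sub>F n in sequentially. (\<Sum>i. real (s n i) / real n * f n i)
          = truncated_energy n (degree_steps s n) (real_of_int (c n)) / real n"
        using eventually_ge_at_top[of 1]
      proof eventually_elim
        case (elim n)
        then show ?case
          using sumn[OF elim, of "\<lambda>y. y\<^sup>2 * min 1 (\<bar>y\<bar> / real_of_int (c n))"] cge[OF elim]
          by (simp add: truncated_energy_def f_def max_absorb2)
      qed
    qed
  qed
qed

text \<open>For \<sigma> > 0 the excess must tend to infinity, as \<open>excess_unbounded\<close>
  says: on a subsequence with a constant integer value c the scaled walk takes values in the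
  multiples of 1 / c, which excludes a nondegenerate Gaussian limit at a fixed time. For \<sigma> =
  0 the limit is the zero path and bounded excesses are allowed.\<close>

theorem theorem1p4:
  fixes p :: "nat pmf"
    and \<sigma> :: real
    and s :: "nat \<Rightarrow> nat \<Rightarrow> nat"
    and M :: "nat \<Rightarrow> 'a measure"
    and C :: "nat \<Rightarrow> 'a \<Rightarrow> nat list"
    and N :: "'b measure"
    and B :: "real \<Rightarrow> 'b \<Rightarrow> real"
  defines "c \<equiv> (\<lambda>n. degree_excess (s n))"
  assumes mean: "measure_pmf.expectation p real = 1"
    and finite_variance: "integrable (measure_pmf p) (\<lambda>i. (real i)\<^sup>2)"
    and variance: "measure_pmf.variance p real = \<sigma>\<^sup>2" "\<sigma> \<ge> 0"
    and degree_sequence: "\<And>n. n \<ge> 1 \<Longrightarrow> degree_sequence (s n)"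
    and size: "\<And>n. n \<ge> 1 \<Longrightarrow> (\<Sum>i. s n i) = n"
    and excess_small: "(\<lambda>n. real_of_int (c n)) \<in> o(\<lambda>n. real n powr (1 / 2))"
    and excess_unbounded: "\<sigma> > 0 \<Longrightarrow> filterlim c at_top sequentially"
    and L2: "L2_convergent_to (\<lambda>n i. real (s n i) / real n) (pmf p)"
    and prob_space: "\<And>n. n \<ge> 1 \<Longrightarrow> prob_space (M n)"
    and measurable: "\<And>n. n \<ge> 1 \<Longrightarrow> C n \<in> measurable (M n) (count_space UNIV)"
    and uniform: "\<And>n. n \<ge> 1 \<Longrightarrow>
      distr (M n) (count_space UNIV) (C n) = measure_pmf (uniform_permutation (degree_vector (s n)))"
    and brownian: "standard_brownian_motion N B"
  shows "converges_in_distribution skorokhod_topology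
           M (\<lambda>n \<omega>. scaled_walk (c n) (C n \<omega>))
           N (\<lambda>\<omega>. \<lambda>t\<in>{0..}. \<sigma> * B t \<omega>)"
proof -
  interpret population_sequence "degree_steps s" "\<lambda>n. real_of_int (c n)" "\<sigma>\<^sup>2"
    unfolding c_def
    by (rule degree_population_sequence[OF mean finite_variance variance degree_sequence size
          excess_small[unfolded c_def] excess_unbounded[unfolded c_def] L2])
  interpret process_approximation N "\<lambda>\<omega>. \<lambda>t\<in>{0..}. \<sigma> * B t \<omega>"
      "\<lambda>n. pmf_of_set {\<pi>. \<pi> permutes {..<n}}" scaled_path
    by (rule scaled_path_process_approximation[OF brownian variance(2) refl])
  have walk_cadlag: "scaled_walk (c n) D \<in> cadlag_paths" if "n \<ge> 1" for n D
    using floor_step_cadlag[of "(real_of_int (c n))\<^sup>2" "\<lambda>k. real_of_int (walk D k) / real_of_int (c n)"]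
      c_ge_1[OF that] by (simp add: scaled_walk_def mult.commute)
  have expect: "(\<integral>\<omega>. f (scaled_walk (c n) (C n \<omega>)) \<partial>M n)
      = measure_pmf.expectation (pmf_of_set {\<pi>. \<pi> permutes {..<n}}) (\<lambda>\<pi>. f (scaled_path n \<pi>))"
    if n: "n \<ge> 1" for n and f :: "(real \<Rightarrow> real) \<Rightarrow> real"
  proof -
    have len: "length (degree_vector (s n)) = n"
      using length_degree_vector[of "s n"] degree_sequence[OF n] size[OF n]
      by (simp add: degree_sequence_def)
    have "(\<integral>\<omega>. f (scaled_walk (c n) (C n \<omega>)) \<partial>M n)
        = (\<integral>D. f (scaled_walk (c n) D) \<partial>distr (M n) (count_space UNIV) (C n))"
      using measurable[OF n] by (subst integral_distr) auto
    also have "\<dots> = measure_pmf.expectation (pmf_of_set {\<pi>. \<pi> permutes {..<n}})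
        (\<lambda>\<pi>. f (scaled_walk (c n) (permute_list \<pi> (degree_vector (s n)))))"
      unfolding uniform[OF n] by (simp add: uniform_permutation_def len)
    also have "\<dots> = measure_pmf.expectation (pmf_of_set {\<pi>. \<pi> permutes {..<n}}) (\<lambda>\<pi>. f (scaled_path n \<pi>))"
    proof (rule integral_cong_AE)
      show "AE \<pi> in measure_pmf (pmf_of_set {\<pi>. \<pi> permutes {..<n}}).
          f (scaled_walk (c n) (permute_list \<pi> (degree_vector (s n)))) = f (scaled_path n \<pi>)"
        by (simp add: AE_measure_pmf_iff set_pmf_of_set[OF perms_nonempty finite_perms] scaled_walk_permute_list[where s = s, OF len] scaled_path_def steps_def)
    qed auto
    finally show ?thesis .
  qed
  show ?thesis
    unfolding converges_in_distribution_def
  proof (intro conjI allI impI)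
    show "\<forall>\<^sub>F n in sequentially. (\<lambda>\<omega>. scaled_walk (c n) (C n \<omega>)) \<in> measurable (M n) (borel_algebra skorokhod_topology)"
      using eventually_ge_at_top[of 1]
    proof eventually_elim
      case (elim n)
      \<comment> \<open>Every function on the discrete space of lists is measurable, so it remains
        to see that the values are cadlag paths.\<close>
      show ?case
        by (rule measurable_compose[OF measurable[OF elim]])
          (auto simp: borel_algebra_def space_measure_of_conv walk_cadlag[OF elim])
    qed
    show "(\<lambda>\<omega>. \<lambda>t\<in>{0..}. \<sigma> * B t \<omega>) \<in> measurable N (borel_algebra skorokhod_topology)"
      by (rule measurable_skorokhod)
    fix f :: "(real \<Rightarrow> real) \<Rightarrow> real"
    assume f: "continuous_map skorokhod_topology euclideanreal f \<and> bounded (f ` topspace skorokhod_topology)"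
    have "(\<lambda>n. measure_pmf.expectation (pmf_of_set {\<pi>. \<pi> permutes {..<n}}) (\<lambda>\<pi>. f (scaled_path n \<pi>)))
        \<longlonglongrightarrow> (\<integral>\<omega>. f (\<lambda>t\<in>{0..}. \<sigma> * B t \<omega>) \<partial>N)"
      using f by (intro skorokhod_converges) auto
    then show "(\<lambda>n. \<integral>\<omega>. f (scaled_walk (c n) (C n \<omega>)) \<partial>M n) \<longlonglongrightarrow> (\<integral>\<omega>. f (\<lambda>t\<in>{0..}. \<sigma> * B t \<omega>) \<partial>N)"
      by (rule Lim_transform_eventually)
        (use eventually_ge_at_top[of 1] in \<open>eventually_elim, simp add: expect\<close>)
  qed
qed

end
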